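(* Let $p_1,p_2$ be real polynomials and let $$L:\quad x'=x+p_1(y),\qquad y'=y+p_2(x')$$ be a polynomial automorphism of $\mathbb{R}^2$ in generalised standard form. Consider affine transformations $T:(x,y)\mapsto(\alpha x+\beta,\gamma y+\delta)$ with $\alpha,\beta,\gamma,\delta\in\mathbb{R}$, $\alpha\gamma\ne0$; then $L'=T\circ L\circ T^{-1}$ is again in generalised standard form, $L': x'=x+\hat p_1(y),\ y'=y+\hat p_2(x')$, with $\hat p_1(y)=\alpha\,p_1\!\left(\frac{y-\delta}{\gamma}\right)$ and $\hat p_2(x)=\gamma\,p_2\!\left(\frac{x-\beta}{\alpha}\right)$. **(A)** Suppose $\deg p_1\ge2$ and $\deg p_2\ge 2$. (A1) $L$ has a symmetry in $\mathcal{G}$ that is not a power $L^k$, $k\in\mathbb{Z}$, if and only if there is such a $T$ for which $(\hat p_1,\hat p_2)$ satisfies at least one of S1–S3; the indicated map is then a symmetry of $L'$. - S1: $\hat p_1$ and $\hat p_2$ are both odd around $0$. $S_1: x'=-x,\ y'=-y$ ($S_1^2=\mathrm{id}$). - S2: $\hat p_2=\hat p_1$. $S_2: x'=y,\ y'=x+\hat p_1(y)$ ($S_2^2=L'$). - S3: $\hat p_1$ is odd around $0$ and $\hat p_2=-\hat p_1$. $S_3: x'=y,\ y'=-x-\hat p_1(y)$ ($S_3^2=-L'$). (A2) $L$ has a reversing symmetry in $\mathcal{G}$ if and only if there is such a $T$ for which $(\hat p_1,\hat p_2)$ satisfies at least one of R1–R5; the indicated maps are then reversing symmetries of $L'$.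 - R1: $\hat p_2$ is odd around $0$ ($\hat p_1$ arbitrary). $R_1: x'=-x-\hat p_1(y),\ y'=y$ ($R_1^2=\mathrm{id}$), and $L'\circ R_1: x'=-x,\ y'=y-\hat p_2(x)$. - R2: $\hat p_1$ is odd around $0$ ($\hat p_2$ arbitrary). $R_2: x'=x+\hat p_1(y),\ y'=-y$ ($R_2^2=\mathrm{id}$), and $L'\circ R_2: x'=x,\ y'=-y+\hat p_2(x)$. - R3: $\hat p_1$ and $\hat p_2$ are both even around $0$. $R_3: x'=-x-\hat p_1(y),\ y'=-y$ ($R_3^2=\mathrm{id}$), and $L'\circ R_3: x'=-x,\ y'=-y+\hat p_2(x)$. - R4: $\hat p_2=-\hat p_1$. $R_4: x'=y,\ y'=x$ ($R_4^2=\mathrm{id}$), and $L'\circ R_4: x'=y+\hat p_1(x),\ y'=x-\hat p_1(x')$. - R5: $\hat p_1$ is odd around $0$ and $\hat p_2=\hat p_1$. $R_5: x'=y,\ y'=-x$ ($R_5^4=\mathrm{id}$). **(B)** Suppose $\deg p_1=1$ and $\deg p_2\ge2$. (B1) $L$ has a symmetry in $\mathcal{G}$ that is not a power $L^k$, $k\in\mathbb{Z}$, if and only if there is such a $T$ for which $\hat p_1(y)=y$ and $\hat p_2$ is odd around $0$; then $S_1: x'=-x,\ y'=-y$ is a symmetry of $L'$. (B2) $L$ always has a reversing symmetry in $\mathcal{G}$, and there is always such a $T$ for which $\hat p_1(y)=y$, i.e. $L': x'=x+y,\ y'=y+\hat p_2(x')$. For any such $T$, $R_2: x'=x,\ y'=-y+\hat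 p_2(x)$ ($R_2^2=\mathrm{id}$) and $R_2\circ L': x'=x+y,\ y'=-y$ are reversing symmetries of $L'$; if in addition $\hat p_2$ is odd around $0$, then $R_1: x'=-x,\ y'=y-\hat p_2(x)$ ($R_1^2=\mathrm{id}$) and $R_1\circ L': x'=-x-y,\ y'=y$ are also reversing symmetries of $L'$.
   Context: A polynomial automorphism of $\mathbb{R}^2$ is a bijective polynomial map $\mathbb{R}^2\to\mathbb{R}^2$ whose inverse is also a polynomial map; these form a group $\mathcal{G}$ under composition. A map written "$x'=\dots,\ y'=\dots$" sends $(x,y)$ to $(x',y')$; where $x'$ occurs in the formula for $y'$, the already computed value of $x'$ is substituted. A symmetry of a map $M\in\mathcal{G}$ is $S\in\mathcal{G}$ with $S\circ M\circ S^{-1}=M$. A reversing symmetry of $M$ is $R\in\mathcal{G}$ with $R\circ M\circ R^{-1}=M^{-1}$. A polynomial $p$ is odd (respectively even) around $0$ if $p(-x)=-p(x)$ (respectively $p(-x)=p(x)$) for all $x$. $-L'$ denotes the map $(x,y)\mapsto -L'(x,y)$. *)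

theory Defs
  imports "HOL-Analysis.Weierstrass_Theorems" "HOL-Computational_Algebra.Polynomial"
begin

definition poly_automorphisms :: "(real \<times> real \<Rightarrow> real \<times> real) set" where
  "poly_automorphisms = {f. bij f \<and> polynomial_function f \<and> polynomial_function (inv f)}"

definition symmetries ::
    "(real \<times> real \<Rightarrow> real \<times> real) \<Rightarrow> (real \<times> real \<Rightarrow> real \<times> real) set" where
  "symmetries M = {S \<in> poly_automorphisms. S \<circ> M \<circ> inv S = M}"

definition reversing_symmetries ::
    "(real \<times> real \<Rightarrow> real \<times> real) \<Rightarrow> (real \<times> real \<Rightarrow> real \<times> real) set" where
  "reversing_symmetries M = {R \<in> poly_automorphisms. R \<circ> M \<circ> inv R = inv M}"

definition int_iterate :: "('a \<Rightarrow> 'a) \<Rightarrow> int \<Rightarrow> 'a \<Rightarrow> 'a" where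
  "int_iterate f k = (if 0 \<le> k then f ^^ nat k else inv f ^^ nat (- k))"

definition gen_standard_map :: "real poly \<Rightarrow> real poly \<Rightarrow> real \<times> real \<Rightarrow> real \<times> real" where
  "gen_standard_map p1 p2 = (\<lambda>(x, y). let x' = x + poly p1 y in (x', y + poly p2 x'))"

definition diag_affine :: "real \<Rightarrow> real \<Rightarrow> real \<Rightarrow> real \<Rightarrow> real \<times> real \<Rightarrow> real \<times> real" where
  "diag_affine \<alpha> \<beta> \<gamma> \<delta> = (\<lambda>(x, y). (\<alpha> * x + \<beta>, \<gamma> * y + \<delta>))"

text \<open>The polynomial \<open>a * p ((x - d) / c)\<close> in \<open>x\<close>.\<close>

definition rescale_poly :: "real \<Rightarrow> real \<Rightarrow> real \<Rightarrow> real poly \<Rightarrow> real poly" where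
  "rescale_poly a c d p = smult a (pcompose p [:- d / c, 1 / c:])"

definition odd_poly :: "real poly \<Rightarrow> bool" where
  "odd_poly p \<longleftrightarrow> (\<forall>x. poly p (- x) = - poly p x)"

definition even_poly :: "real poly \<Rightarrow> bool" where
  "even_poly p \<longleftrightarrow> (\<forall>x. poly p (- x) = poly p x)"

end

theory Submission
  imports Defs
begin

text \<open>
  With \<open>E \<epsilon> Q (x, y) = (y, \<epsilon> * x + Q y)\<close>, a standard map is \<open>E 1 p2 \<circ> E 1 p1\<close>; a reversing symmetry
  of it, followed by the swap of coordinates, is a conjugacy to a map of the same kind. If \<open>p1\<close> is
  linear, the map is conjugate to a single \<open>E (- 1) Q\<close>. So let \<open>S \<circ> F = G \<circ> S\<close> for two compositions
  of steps \<open>E\<close> of degree at least 2. The components of all \<open>G ^ k \<circ> S\<close> form one sequence with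
  \<open>h (j + 1) = \<epsilon> * h (j - 1) + R j (h j)\<close>, whose degrees fall to a minimum and then rise, by exact
  factors on either side. Relative to the orbit of the identity this defines a forward rate \<open>\<lambda>\<close> and a
  backward rate \<open>\<mu>\<close>. At the minimum one reads off \<open>\<lambda> * \<mu> \<ge> 1\<close>, with equality only if two
  consecutive \<open>h j\<close> have degree 1. On the other hand either rate of \<open>inv S\<close> is the reciprocal of that
  of \<open>S\<close>: iterated curves approach one point at infinity tangentially to a fixed weighted
  homogeneous curve, on which the leading form of a component of \<open>F ^ j \<circ> inv S\<close> eventually does
  not vanish. Hence \<open>\<lambda> * \<mu> = 1\<close>, and \<open>S\<close> is affine up to iterates of \<open>G\<close> and one step \<open>E\<close>; no
  structure theorem for the automorphism group is needed. An affine conjugacy is diagonal, and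
  comparing leading coefficients in the resulting equations for \<open>p1\<close> and \<open>p2\<close> gives the cases.
\<close>

section \<open>Leading forms of bivariate polynomials\<close>

text \<open>The obstacle is cancellation: degrees of bivariate polynomials do not multiply under
  composition, since leading forms may cancel. The recurrence composes only with polynomials of one
  variable, where degrees do multiply, and \<open>S\<close> and \<open>inv S\<close> are seen only
  through restrictions to polynomial curves \<open>(a z, b z)\<close>. One real parameter can avoid
  countably many exceptional values, so a single generic curve shows the true weighted degree of
  every \<open>h j\<close>. The bound on the product of the two rates holds for \<open>inv S\<close>
  as well; rates that are reciprocal to each other leave only equality in both bounds. Backward
  rates need no argument of their own: swapping the coordinates of the inverse maps reverses the
  index and makes them forward rates. The weight of \<open>y\<close> is the degree of the last step
  of the map. On far iterates of the curves considered, the degree of the second coordinate is that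
  multiple of the degree of the first, and the leading coefficients are tied by the leading
  coefficient of the last step. This determines the limiting weighted homogeneous curve, whatever
  the curve at the start.\<close>

lemma real_polynomial_function_bipoly:
  fixes f :: "real \<times> real \<Rightarrow> real"
  assumes "real_polynomial_function f"
  shows "\<exists>H :: real poly poly. \<forall>x y. f (x, y) = poly (poly H [:y:]) x"
  using assms
proof (induction rule: real_polynomial_function.induct)
  case (linear f)
  interpret bounded_linear f by fact
  have "f (x, y) = poly (poly [:[:0, f (1, 0):], [:f (0, 1):]:] [:y:]) x" for x y
  proof -
    have "(x, y) = x *\<^sub>R (1, 0) + y *\<^sub>R (0, 1)" by simp
    then have "f (x, y) = x * f (1, 0) + y * f (0, 1)"
      by (metis add scaleR real_scaleR_def)
    then show ?thesis by simp
  qed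
  then show ?case by blast
next
  case (const c)
  have "c = poly (poly [:[:c:]:] [:y:]) x" for x y :: real by simp
  then show ?case by blast
next
  case (add f g)
  then obtain H K where "\<forall>x y. f (x, y) = poly (poly H [:y:]) x" "\<forall>x y. g (x, y) = poly (poly K [:y:]) x"
    by blast
  then have "\<forall>x y. f (x, y) + g (x, y) = poly (poly (H + K) [:y:]) x" by simp
  then show ?case by blast
next
  case (mult f g)
  then obtain H K where "\<forall>x y. f (x, y) = poly (poly H [:y:]) x" "\<forall>x y. g (x, y) = poly (poly K [:y:]) x"
    by blast
  then have "\<forall>x y. f (x, y) * g (x, y) = poly (poly (H * K) [:y:]) x" by simp
  then show ?case by blast
qed

lemma real_polynomial_function_monomials:
  fixes f :: "real \<times> real \<Rightarrow> real"
  assumes "real_polynomial_function f"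
  obtains A :: "(nat \<times> nat) set" and c where
    "finite A" "\<And>m. m \<in> A \<Longrightarrow> c m \<noteq> 0" "\<And>x y. f (x, y) = (\<Sum>(i, j)\<in>A. c (i, j) * x ^ i * y ^ j)"
proof -
  obtain H :: "real poly poly" where H: "\<And>x y. f (x, y) = poly (poly H [:y:]) x"
    using real_polynomial_function_bipoly[OF assms] by blast
  define c where "c = (\<lambda>(i, j). coeff (coeff H j) i)"
  \<comment> \<open>A common bound on the degrees in \<open>x\<close> makes the index set a
    rectangle; vanishing coefficients are filtered out at the end.\<close>
  define N where "N = Max ((\<lambda>j. degree (coeff H j)) ` {..degree H})"
  define B where "B = {..N} \<times> {..degree H}"
  have inner: "poly (coeff H j) x = (\<Sum>i\<le>N. c (i, j) * x ^ i)" if "j \<le> degree H" for j x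
  proof -
    have "degree (coeff H j) \<le> N" unfolding N_def using that by (intro Max_ge) auto
    then have "(\<Sum>i\<le>N. c (i, j) * x ^ i) = (\<Sum>i\<le>degree (coeff H j). c (i, j) * x ^ i)"
      by (intro sum.mono_neutral_right) (auto simp: c_def coeff_eq_0)
    then show ?thesis by (simp add: poly_altdef c_def)
  qed
  have f: "f (x, y) = (\<Sum>(i, j)\<in>B. c (i, j) * x ^ i * y ^ j)" for x y
  proof -
    have "f (x, y) = poly (\<Sum>j\<le>degree H. coeff H j * [:y:] ^ j) x"
      by (simp add: H poly_altdef[of H])
    also have "\<dots> = (\<Sum>j\<le>degree H. poly (coeff H j) x * y ^ j)"
      by (simp add: poly_sum)
    also have "\<dots> = (\<Sum>j\<le>degree H. \<Sum>i\<le>N. c (i, j) * x ^ i * y ^ j)"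
      by (intro sum.cong refl) (simp add: inner sum_distrib_right)
    also have "\<dots> = (\<Sum>i\<le>N. \<Sum>j\<le>degree H. c (i, j) * x ^ i * y ^ j)"
      by (rule sum.swap)
    also have "\<dots> = (\<Sum>(i, j)\<in>B. c (i, j) * x ^ i * y ^ j)"
      unfolding B_def by (rule sum.cartesian_product)
    finally show ?thesis .
  qed
  have B: "finite B" by (simp add: B_def)
  have "f (x, y) = (\<Sum>(i, j)\<in>{m \<in> B. c m \<noteq> 0}. c (i, j) * x ^ i * y ^ j)" for x y
    unfolding f using B by (intro sum.mono_neutral_right) auto
  then show ?thesis using B by (intro that[of "{m \<in> B. c m \<noteq> 0}" c]) auto
qed

text \<open>Chosen by its values, so that no normal form of \<open>f\<close> has to be fixed. For
  polynomial \<open>f\<close> such a polynomial exists, and it is unique because a real polynomial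
  is determined by its values.\<close>

definition curve_poly :: "(real \<times> real \<Rightarrow> real) \<Rightarrow> real poly \<Rightarrow> real poly \<Rightarrow> real poly" where
  "curve_poly f a b = (SOME q. \<forall>z. poly q z = f (poly a z, poly b z))"

lemma poly_curve_poly:
  assumes "real_polynomial_function f"
  shows "poly (curve_poly f a b) z = f (poly a z, poly b z)"
proof -
  obtain A c where A: "finite A" "\<And>m. m \<in> A \<Longrightarrow> c m \<noteq> 0" "\<And>x y. f (x, y) = (\<Sum>(i, j)\<in>A. c (i, j) * x ^ i * y ^ j)"
    by (rule real_polynomial_function_monomials[OF assms]) blast
  have "\<forall>z. poly (\<Sum>(i, j)\<in>A. smult (c (i, j)) (a ^ i * b ^ j)) z = f (poly a z, poly b z)"
    by (simp add: A(3) poly_sum case_prod_unfold mult.assoc)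
  then have "\<exists>q. \<forall>z. poly q z = f (poly a z, poly b z)" by blast
  then have "\<forall>z. poly (curve_poly f a b) z = f (poly a z, poly b z)"
    unfolding curve_poly_def by (rule someI_ex)
  then show ?thesis by blast
qed

lemma curve_poly_eqI:
  assumes "real_polynomial_function f" "\<And>z. f (poly a z, poly b z) = poly q z"
  shows "curve_poly f a b = q"
proof -
  have "poly (curve_poly f a b) = poly q"
    using assms by (simp add: fun_eq_iff poly_curve_poly)
  then show ?thesis by (simp add: poly_eq_poly_eq_iff)
qed

text \<open>The part of \<open>f\<close> of top weight \<open>w\<close>, where \<open>x\<close> has weight \<open>1\<close> and \<open>y\<close> has weight \<open>m\<close>,
  is \<open>x ^ w * P (y / x ^ m)\<close>.\<close>

definition has_leading_form :: "nat \<Rightarrow> (real \<times> real \<Rightarrow> real) \<Rightarrow> nat \<Rightarrow> real poly \<Rightarrow> bool" where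
  "has_leading_form m f w P \<longleftrightarrow> P \<noteq> 0 \<and>
     (\<forall>a b c. degree a > 0 \<and> degree b \<le> m * degree a \<and> coeff b (m * degree a) = c * lead_coeff a ^ m \<longrightarrow>
        degree (curve_poly f a b) \<le> w * degree a \<and>
        coeff (curve_poly f a b) (w * degree a) = lead_coeff a ^ w * poly P c)"

text \<open>Stated for a bound on the degree instead of the degree itself: the second coordinate of
  a curve may fall short of \<open>m * degree a\<close>, with coefficient \<open>0\<close>
  there.\<close>

lemma coeff_power_at_bound:
  fixes b :: "'a::comm_semiring_1 poly"
  assumes "degree b \<le> n"
  shows "degree (b ^ j) \<le> n * j" and "coeff (b ^ j) (n * j) = coeff b n ^ j"
proof -
  have "degree (b ^ j) \<le> n * j \<and> coeff (b ^ j) (n * j) = coeff b n ^ j"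
  proof (induction j)
    case (Suc j)
    have "degree (b * b ^ j) \<le> n + n * j"
      using Suc assms degree_mult_le[of b "b ^ j"] by linarith
    moreover have "coeff (b * b ^ j) (n + n * j) = coeff b n * coeff b n ^ j"
    proof -
      have "coeff (b * b ^ j) (n + n * j) = (\<Sum>i\<le>n + n * j. coeff b i * coeff (b ^ j) (n + n * j - i))"
        by (rule coeff_mult)
      also have "\<dots> = (\<Sum>i\<in>{n}. coeff b i * coeff (b ^ j) (n + n * j - i))"
      proof (intro sum.mono_neutral_right ballI)
        fix i assume i: "i \<in> {..n + n * j} - {n}"
        show "coeff b i * coeff (b ^ j) (n + n * j - i) = 0"
        proof (cases "i > n")
          case True
          then show ?thesis using assms by (simp add: coeff_eq_0)
        next
          case False
          then have "degree (b ^ j) < n + n * j - i" using i Suc by auto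
          then show ?thesis by (simp add: coeff_eq_0)
        qed
      qed auto
      also have "\<dots> = coeff b n * coeff b n ^ j" using Suc by simp
      finally show ?thesis .
    qed
    ultimately show ?case by simp
  qed auto
  then show "degree (b ^ j) \<le> n * j" "coeff (b ^ j) (n * j) = coeff b n ^ j" by auto
qed

lemma coeff_mult_at_bound:
  fixes a b :: "'a::comm_semiring_1 poly"
  assumes "degree a \<le> k" "degree b \<le> l"
  shows "coeff (a * b) (k + l) = coeff a k * coeff b l"
proof -
  have "coeff (a * b) (k + l) = (\<Sum>i\<le>k + l. coeff a i * coeff b (k + l - i))"
    by (rule coeff_mult)
  also have "\<dots> = (\<Sum>i\<in>{k}. coeff a i * coeff b (k + l - i))"
  proof (intro sum.mono_neutral_right ballI)
    fix i assume i: "i \<in> {..k + l} - {k}"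
    show "coeff a i * coeff b (k + l - i) = 0"
    proof (cases "i > k")
      case False
      then have "degree b < k + l - i" using i assms by auto
      then show ?thesis by (simp add: coeff_eq_0)
    qed (use assms in \<open>simp add: coeff_eq_0\<close>)
  qed auto
  finally show ?thesis by simp
qed

definition affine_fun :: "(real \<times> real \<Rightarrow> real) \<Rightarrow> bool" where
  "affine_fun f \<longleftrightarrow> (\<exists>\<alpha> \<beta> \<gamma>. \<forall>x y. f (x, y) = \<alpha> * x + \<beta> * y + \<gamma>)"

text \<open>On a curve with \<open>degree a = D\<close> and \<open>degree b \<le> m * D\<close> the
  monomial \<open>x ^ i * y ^ j\<close> has degree at most \<open>D * (i + m * j)\<close>, so only
  monomials of top weight reach the coefficient at \<open>w * D\<close>. The last two clauses
  identify low weights: weight \<open>0\<close> is to be excluded for surjective coordinates, and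
  weight \<open>1\<close> with \<open>m = 1\<close> is what the degree argument aims at.\<close>

lemma ex_leading_form:
  assumes f: "real_polynomial_function f" "f \<noteq> (\<lambda>_. 0)" and m: "m > 0"
  shows "\<exists>w P. has_leading_form m f w P \<and> (w = 0 \<longrightarrow> (\<exists>c. f = (\<lambda>_. c))) \<and>
    (m = 1 \<and> w = 1 \<longrightarrow> affine_fun f)"
proof -
  obtain A C where A: "finite A" and C: "\<And>m. m \<in> A \<Longrightarrow> C m \<noteq> 0"
    and fA: "\<And>x y. f (x, y) = (\<Sum>(i, j)\<in>A. C (i, j) * x ^ i * y ^ j)"
    by (rule real_polynomial_function_monomials[OF f(1)]) blast
  have "A \<noteq> {}" using f(2) fA by (auto simp: fun_eq_iff)
  define wt where "wt = (\<lambda>(i, j). i + m * j)"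
  define w where "w = Max (wt ` A)"
  have wt_le: "wt p \<le> w" if "p \<in> A" for p
    unfolding w_def using A that by auto
  have "w \<in> wt ` A" unfolding w_def using A \<open>A \<noteq> {}\<close> by (intro Max_in) auto
  then obtain p0 where p0: "p0 \<in> A" "wt p0 = w" by blast
  define P where "P = (\<Sum>(i, j)\<in>{p \<in> A. wt p = w}. monom (C (i, j)) j)"
  \<comment> \<open>Among monomials of the same weight the exponent of \<open>y\<close> determines
    the monomial, so nothing cancels in \<open>P\<close>.\<close>
  have "coeff P (snd p0) = (\<Sum>p\<in>{p \<in> A. wt p = w}. if p = p0 then C p else 0)"
    unfolding P_def coeff_sum using p0
    by (intro sum.cong refl) (auto simp: wt_def split: prod.splits)
  also have "\<dots> = C p0" using A p0 by simp
  finally have "P \<noteq> 0" using C[OF p0(1)] by auto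
  moreover have "degree (curve_poly f a b) \<le> w * degree a \<and>
        coeff (curve_poly f a b) (w * degree a) = lead_coeff a ^ w * poly P c"
    if a: "degree a > 0" and b: "degree b \<le> m * degree a" "coeff b (m * degree a) = c * lead_coeff a ^ m"
    for a b c
  proof -
    define D where "D = degree a"
    have q: "curve_poly f a b = (\<Sum>p\<in>A. smult (C p) (a ^ fst p * b ^ snd p))"
      by (rule curve_poly_eqI[OF f(1)]) (simp add: fA poly_sum case_prod_unfold mult.assoc)
    have dt: "degree (a ^ i * b ^ j) \<le> D * (i + m * j)" for i j
    proof -
      have "degree (a ^ i * b ^ j) \<le> degree (a ^ i) + degree (b ^ j)" by (rule degree_mult_le)
      also have "\<dots> \<le> D * i + (m * D) * j"
        using coeff_power_at_bound(1)[of a D i] coeff_power_at_bound(1)[of b "m * D" j] b(1)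
        by (intro add_mono) (auto simp: D_def)
      also have "\<dots> = D * (i + m * j)" by (simp add: algebra_simps)
      finally show ?thesis .
    qed
    have ct: "coeff (a ^ i * b ^ j) (D * (i + m * j)) = lead_coeff a ^ (i + m * j) * c ^ j" for i j
    proof -
      have "coeff (a ^ i * b ^ j) (D * i + (m * D) * j) = coeff (a ^ i) (D * i) * coeff (b ^ j) ((m * D) * j)"
        using b(1) by (intro coeff_mult_at_bound coeff_power_at_bound) (auto simp: D_def)
      also have "\<dots> = lead_coeff a ^ i * (c * lead_coeff a ^ m) ^ j"
        using coeff_power_at_bound(2)[of a D i] coeff_power_at_bound(2)[of b "m * D" j] b
        by (simp add: D_def)
      also have "\<dots> = lead_coeff a ^ (i + m * j) * c ^ j"
        by (simp add: power_add power_mult power_mult_distrib)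
      finally show ?thesis by (simp add: algebra_simps)
    qed
    have "degree (curve_poly f a b) \<le> w * D"
      unfolding q
    proof (rule degree_sum_le[OF A])
      fix p assume "p \<in> A"
      have "degree (smult (C p) (a ^ fst p * b ^ snd p)) \<le> D * wt p"
        using dt[of "fst p" "snd p"] by (cases p) (auto simp: wt_def)
      also have "\<dots> \<le> w * D" using wt_le[OF \<open>p \<in> A\<close>] by simp
      finally show "degree (smult (C p) (a ^ fst p * b ^ snd p)) \<le> w * D" .
    qed
    moreover have "coeff (curve_poly f a b) (w * D) = lead_coeff a ^ w * poly P c"
    proof -
      have "coeff (curve_poly f a b) (w * D) = (\<Sum>p\<in>A. C p * coeff (a ^ fst p * b ^ snd p) (w * D))"
        by (simp add: q coeff_sum)
      also have "\<dots> = (\<Sum>p\<in>{p \<in> A. wt p = w}. C p * coeff (a ^ fst p * b ^ snd p) (w * D))"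
      proof (intro sum.mono_neutral_right ballI A)
        fix p assume p: "p \<in> A - {p \<in> A. wt p = w}"
        then have "wt p < w" using wt_le[of p] by auto
        then have "D * wt p < w * D" using a by (simp add: D_def)
        from this have "degree (a ^ fst p * b ^ snd p) < w * D"
          using dt[of "fst p" "snd p"] unfolding wt_def case_prod_unfold by linarith
        then show "C p * coeff (a ^ fst p * b ^ snd p) (w * D) = 0" by (simp add: coeff_eq_0)
      qed auto
      also have "\<dots> = (\<Sum>p\<in>{p \<in> A. wt p = w}. C p * (lead_coeff a ^ w * c ^ snd p))"
      proof (intro sum.cong refl)
        fix p assume "p \<in> {p \<in> A. wt p = w}"
        then show "C p * coeff (a ^ fst p * b ^ snd p) (w * D) = C p * (lead_coeff a ^ w * c ^ snd p)"
          using ct[of "fst p" "snd p"] by (cases p) (auto simp: wt_def mult.commute)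
      qed
      also have "\<dots> = lead_coeff a ^ w * poly P c"
        by (simp add: P_def poly_sum sum_distrib_left case_prod_unfold poly_monom algebra_simps)
      finally show ?thesis .
    qed
    ultimately show ?thesis by (simp add: D_def)
  qed
  ultimately have "has_leading_form m f w P"
    unfolding has_leading_form_def by blast
  moreover have "\<exists>c. f = (\<lambda>_. c)" if "w = 0"
  proof -
    have "A \<subseteq> {(0, 0)}" using wt_le that m by (fastforce simp: wt_def)
    then have "A = {(0, 0)}" using \<open>A \<noteq> {}\<close> by blast
    then have "f = (\<lambda>_. C (0, 0))" using fA by auto
    then show ?thesis by blast
  qed
  moreover have "affine_fun f" if "m = 1" "w = 1"
  proof -
    have "A \<subseteq> {(0, 0), (1, 0), (0, 1)}"
    proof
      fix p assume "p \<in> A"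
      then have "fst p + snd p \<le> 1" using wt_le[of p] that by (simp add: wt_def case_prod_unfold)
      then have "fst p = 0 \<and> snd p = 0 \<or> fst p = 1 \<and> snd p = 0 \<or> fst p = 0 \<and> snd p = 1" by linarith
      then show "p \<in> {(0, 0), (1, 0), (0, 1)}" by (cases p) auto
    qed
    then have "f (x, y) = (\<Sum>(i, j)\<in>{(0, 0), (1, 0), (0, 1)}. if (i, j) \<in> A then C (i, j) * x ^ i * y ^ j else 0)" for x y
      unfolding fA by (intro sum.mono_neutral_cong_left) auto
    then have "f (x, y) = (if (1, 0) \<in> A then C (1, 0) else 0) * x + (if (0, 1) \<in> A then C (0, 1) else 0) * y
        + (if (0, 0) \<in> A then C (0, 0) else 0)" for x y
      by simp
    then show ?thesis unfolding affine_fun_def by blast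
  qed
  ultimately show ?thesis by blast
qed

lemma has_leading_form_coeff:
  assumes "has_leading_form m f w P" "degree a > 0" "degree b \<le> m * degree a"
    "coeff b (m * degree a) = c * lead_coeff a ^ m"
  shows "coeff (curve_poly f a b) (w * degree a) = lead_coeff a ^ w * poly P c"
  using assms unfolding has_leading_form_def by blast

lemma has_leading_form_degree:
  assumes "has_leading_form m f w P" "degree a > 0" "degree b \<le> m * degree a"
    "coeff b (m * degree a) = c * lead_coeff a ^ m" "poly P c \<noteq> 0"
  shows "degree (curve_poly f a b) = w * degree a"
proof (rule antisym)
  have "lead_coeff a \<noteq> 0" using assms(2) by auto
  then have "coeff (curve_poly f a b) (w * degree a) \<noteq> 0"
    using has_leading_form_coeff[OF assms(1-4)] assms(5) by simp
  then show "w * degree a \<le> degree (curve_poly f a b)" by (rule le_degree)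
  show "degree (curve_poly f a b) \<le> w * degree a"
    using assms unfolding has_leading_form_def by blast
qed

section \<open>Generic parameters and the shape of degree sequences\<close>

text \<open>Countably many finite root sets do not cover the uncountable reals. The value
  \<open>0\<close> is avoided too, so that \<open>monom t m\<close> has degree
  \<open>m\<close>.\<close>

lemma ex_common_non_root:
  fixes P :: "'i \<Rightarrow> real poly"
  assumes "countable I" "\<And>i. i \<in> I \<Longrightarrow> P i \<noteq> 0"
  shows "\<exists>t. t \<noteq> 0 \<and> (\<forall>i\<in>I. poly (P i) t \<noteq> 0)"
proof -
  have "countable ({0} \<union> (\<Union>i\<in>I. {t. poly (P i) t = 0}))"
    using assms countable_finite[OF poly_roots_finite] by (intro countable_Un countable_UN) auto
  then have "{0} \<union> (\<Union>i\<in>I. {t. poly (P i) t = 0}) \<noteq> UNIV"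
    using uncountable_UNIV_real by metis
  then show ?thesis by blast
qed

text \<open>The last three assumptions say that the maximum of \<open>D (j - 1)\<close>, \<open>r j * D j\<close>, \<open>D (j + 1)\<close> is
  attained twice. Such a sequence falls to a minimum and rises after it; exact growth to the right is
  proportional to \<open>\<pi> j\<close>, and exact growth to the left to \<open>1 / \<pi> (j + 1)\<close>.\<close>

lemma degree_profile:
  fixes D r :: "int \<Rightarrow> nat" and \<pi> :: "int \<Rightarrow> real"
  assumes r: "\<And>j. r j \<ge> 2" and D: "\<And>j. D j \<ge> 1" and pi: "\<And>j. \<pi> j > 0" "\<And>j. \<pi> (j + 1) = r j * \<pi> j"
    and t1: "\<And>j. D (j - 1) < r j * D j \<Longrightarrow> D (j + 1) = r j * D j"
    and t2: "\<And>j. D (j + 1) < r j * D j \<Longrightarrow> D (j - 1) = r j * D j"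
    and t3: "\<And>j. r j * D j < D (j - 1) \<Longrightarrow> D (j + 1) = D (j - 1)"
  shows "\<exists>N lam mu. (\<forall>j>N. D j = lam * \<pi> j) \<and> (\<forall>j< -N. D j * \<pi> (j + 1) = mu) \<and> lam > 0 \<and> mu > 0 \<and>
    lam * mu \<ge> 1 \<and> (lam * mu = 1 \<longrightarrow> (\<exists>j. D j = 1 \<and> D (j + 1) = 1))"
proof -
  define \<delta> where "\<delta> = (LEAST n. \<exists>j. D j = n)"
  have "\<exists>j. D j = \<delta>" unfolding \<delta>_def by (rule LeastI_ex) blast
  then obtain j1 where j1: "D j1 = \<delta>" by blast
  have min: "\<delta> \<le> D j" for j unfolding \<delta>_def by (rule Least_le) blast
  have \<delta>: "\<delta> \<ge> 1" using D j1 by metis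
  \<comment> \<open>A minimum with a strictly larger left neighbour: if \<open>j1 - 1\<close> is
    minimal as well, \<open>t2\<close> lifts \<open>D (j1 - 2)\<close> to
    \<open>r (j1 - 1) * \<delta>\<close>, and \<open>j1 - 1\<close> serves.\<close>
  have "\<exists>j0. D j0 = \<delta> \<and> D (j0 - 1) > \<delta>"
  proof (cases "D (j1 - 1) = \<delta>")
    case True
    have "\<delta> < r (j1 - 1) * \<delta>" using r[of "j1 - 1"] \<delta> by simp
    then have "D (j1 - 1 - 1) = r (j1 - 1) * \<delta>" using t2[of "j1 - 1"] True j1 by simp
    then show ?thesis using True \<open>\<delta> < r (j1 - 1) * \<delta>\<close> by (intro exI[of _ "j1 - 1"]) simp
  next
    case False
    then show ?thesis using j1 min[of "j1 - 1"] by (intro exI[of _ j1]) simp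
  qed
  then obtain j0 where j0: "D j0 = \<delta>" "D (j0 - 1) > \<delta>" by blast
  have gt: "D k < r j * D j" if "D k \<le> D j" for k j
    using mult_le_mono1[OF r[of j], of "D j"] D[of j] that by linarith
  \<comment> \<open>Monotonicity is carried along with the formula, since
    \<open>D (j - 1) \<le> D j < r j * D j\<close> is what triggers \<open>t1\<close>.\<close>
  have right: "D j \<ge> D (j - 1) \<and> D j = D (j0 + 1) / \<pi> (j0 + 1) * \<pi> j" if "j \<ge> j0 + 1" for j
    using that
  proof (induction j rule: int_ge_induct)
    case base
    then show ?case using min[of "j0 + 1"] j0 pi(1)[of "j0 + 1"] by simp
  next
    case (step j)
    have "D (j + 1) = r j * D j" using t1[of j] gt[of "j - 1" j] step by blast
    moreover have "D j < r j * D j" using gt by simp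
    ultimately show ?case using step pi(2)[of j] by simp
  qed
  have left: "D j \<ge> D (j + 1) \<and> D j * \<pi> (j + 1) = D (j0 - 1) * \<pi> j0" if "j \<le> j0 - 1" for j
    using that
  proof (induction j rule: int_le_induct)
    case base
    then show ?case using j0 by simp
  next
    case (step j)
    have "D (j - 1) = r j * D j" using t2[of j] gt[of "j + 1" j] step by blast
    moreover have "D j < r j * D j" using gt by simp
    ultimately show ?case using step pi(2)[of j] by (simp add: mult_ac)
  qed
  define lam mu where "lam = D (j0 + 1) / \<pi> (j0 + 1)" and "mu = D (j0 - 1) * \<pi> j0"
  have lm: "lam * mu = D (j0 + 1) * D (j0 - 1) / r j0"
    unfolding lam_def mu_def using pi(2)[of j0] pi(1)[of j0] r[of j0] by (simp add: field_simps)
  have main: "lam * mu \<ge> 1 \<and> (lam * mu = 1 \<longrightarrow> D j0 = 1 \<and> D (j0 + 1) = 1)"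
  proof -
    have r0: "real (r j0) > 0" using r[of j0] by simp
    \<comment> \<open>By \<open>lm\<close> the product is
      \<open>D (j0 + 1) * D (j0 - 1) / r j0\<close>. In the first case this is
      \<open>\<delta> * D (j0 + 1)\<close>. In the second it is
      \<open>\<delta> * D (j0 - 1)\<close>, above \<open>1\<close> by the choice of
      \<open>j0\<close>. In the third both neighbours are equal and exceed \<open>r j0\<close>.
      Equality to \<open>1\<close> thus occurs only in the first.\<close>
    consider "D (j0 - 1) = r j0 * \<delta>" | "D (j0 - 1) < r j0 * \<delta>" | "D (j0 - 1) > r j0 * \<delta>" by linarith
    then show ?thesis
    proof cases
      case 1
      have e: "lam * mu = real (\<delta> * D (j0 + 1))" using lm 1 r0 by (simp add: field_simps)
      have "\<delta> * D (j0 + 1) \<ge> 1" using \<delta> D[of "j0 + 1"] by (simp add: Suc_leI)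
      moreover have "real (\<delta> * D (j0 + 1)) = 1 \<longrightarrow> \<delta> = 1 \<and> D (j0 + 1) = 1"
        by (simp only: of_nat_eq_1_iff) auto
      ultimately show ?thesis unfolding e j0(1) by (metis of_nat_1 of_nat_le_iff)
    next
      case 2
      then have "D (j0 + 1) = r j0 * \<delta>" using t1[of j0] j0 by simp
      then have e: "lam * mu = real (\<delta> * D (j0 - 1))" using lm r0 by (simp add: field_simps)
      have "\<delta> * D (j0 - 1) > 1"
        using mult_le_mono1[OF \<delta>, of "D (j0 - 1)"] \<delta> j0(2) by linarith
      then show ?thesis unfolding e by (metis less_imp_le less_irrefl of_nat_1 of_nat_less_iff)
    next
      case 3
      then have e1: "D (j0 + 1) = D (j0 - 1)" using t3[of j0] j0 by simp
      have "r j0 < D (j0 - 1)"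
        using 3 mult_le_mono2[OF \<delta>, of "r j0"] by linarith
      then have "r j0 * 1 < D (j0 - 1) * D (j0 - 1)"
        using mult_le_mono2[OF D[of "j0 - 1"], of "D (j0 - 1)"] by linarith
      then have "real (D (j0 - 1)) * real (D (j0 - 1)) > real (r j0)"
        by (metis mult.right_neutral of_nat_less_iff of_nat_mult)
      then have "lam * mu > 1" using lm e1 r0 by simp
      then show ?thesis by simp
    qed
  qed
  define N where "N = max j0 (- j0)"
  have "\<forall>j>N. D j = lam * \<pi> j" 
    unfolding lam_def by (intro allI impI right[THEN conjunct2]) (simp add: N_def)
  moreover have "\<forall>j< -N. D j * \<pi> (j + 1) = mu" 
    unfolding mu_def by (intro allI impI left[THEN conjunct2]) (simp add: N_def)
  moreover have "lam > 0" "mu > 0"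
    unfolding lam_def mu_def using D[of "j0 + 1"] D[of "j0 - 1"] pi(1) by auto
  moreover have "lam * mu = 1 \<longrightarrow> (\<exists>j. D j = 1 \<and> D (j + 1) = 1)" using main by auto
  ultimately show ?thesis using main
    by (intro exI[of _ N] exI[of _ lam] exI[of _ mu]) simp
qed

section \<open>Polynomial automorphisms and Henon maps\<close>

lemma polynomial_function_Pair:
  assumes "real_polynomial_function f" "real_polynomial_function g"
  shows "polynomial_function (\<lambda>p. (f p, g p))"
proof -
  have "polynomial_function (\<lambda>p. f p *\<^sub>R (1 :: real, 0 :: real) + g p *\<^sub>R (0, 1))"
    using assms by (intro polynomial_function_add polynomial_function_mult polynomial_function_const)
      (simp_all add: real_polynomial_function_eq)
  then show ?thesis by simp
qed

lemma real_polynomial_function_coords: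
  assumes "polynomial_function (f :: real \<times> real \<Rightarrow> real \<times> real)"
  shows "real_polynomial_function (\<lambda>p. fst (f p))" "real_polynomial_function (\<lambda>p. snd (f p))"
  using assms bounded_linear_fst bounded_linear_snd unfolding polynomial_function_def o_def by blast+

lemma real_polynomial_function_poly:
  assumes "real_polynomial_function f"
  shows "real_polynomial_function (\<lambda>p. poly Q (f p))"
proof (induction Q)
  case 0
  then show ?case by auto
next
  case (pCons a Q)
  then show ?case using assms by (simp add: real_polynomial_function.intros(3) real_polynomial_function.intros(2)
        real_polynomial_function.intros(4))
qed

lemma real_polynomial_function_fst_snd:
  "real_polynomial_function (fst :: real \<times> real \<Rightarrow> real)" "real_polynomial_function (snd :: real \<times> real \<Rightarrow> real)"
  by (simp_all add: real_polynomial_function.intros(1) bounded_linear_fst bounded_linear_snd)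

lemma poly_automorphismsI:
  assumes "polynomial_function f" "polynomial_function g" "\<And>p. f (g p) = p" "\<And>p. g (f p) = p"
  shows "f \<in> poly_automorphisms" and "inv f = g"
proof -
  show i: "inv f = g" using assms by (intro inv_equality) auto
  have "bij f" using assms by (intro o_bij[of g]) (auto simp: fun_eq_iff)
  then show "f \<in> poly_automorphisms" using assms i by (simp add: poly_automorphisms_def)
qed

lemma poly_automorphisms_bij: "f \<in> poly_automorphisms \<Longrightarrow> bij f"
  by (simp add: poly_automorphisms_def)

lemma poly_automorphisms_id: "id \<in> poly_automorphisms"
  by (rule poly_automorphismsI(1)[of _ id]) (simp_all add: id_def)

lemma poly_automorphisms_comp:
  assumes "f \<in> poly_automorphisms" "g \<in> poly_automorphisms"
  shows "f \<circ> g \<in> poly_automorphisms"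
  using assms by (auto simp: poly_automorphisms_def o_inv_distrib bij_comp intro: polynomial_function_compose)

lemma poly_automorphisms_inv:
  assumes "f \<in> poly_automorphisms"
  shows "inv f \<in> poly_automorphisms"
  using assms by (auto simp: poly_automorphisms_def inv_inv_eq bij_imp_bij_inv)

lemma funpow_poly_automorphisms:
  assumes "f \<in> poly_automorphisms"
  shows "f ^^ n \<in> poly_automorphisms"
proof (induction n)
  case (Suc n)
  show ?case unfolding funpow.simps by (rule poly_automorphisms_comp[OF assms Suc])
qed (simp only: funpow.simps poly_automorphisms_id)

lemma int_iterate_poly_automorphisms:
  assumes "f \<in> poly_automorphisms"
  shows "int_iterate f k \<in> poly_automorphisms"
  unfolding int_iterate_def by (simp add: assms funpow_poly_automorphisms poly_automorphisms_inv)

lemma int_iterate_0: "int_iterate f 0 = id"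
  by (simp add: int_iterate_def)

lemma int_iterate_Suc:
  assumes "bij f"
  shows "int_iterate f (k + 1) = f \<circ> int_iterate f k"
proof (cases "k \<ge> 0")
  case True
  then have "nat (k + 1) = Suc (nat k)" by simp
  then show ?thesis using True by (simp add: int_iterate_def)
next
  case False
  define n where "n = nat (- k - 1)"
  have n: "nat (- k) = Suc n" "nat (- (k + 1)) = n" using False by (simp_all add: n_def)
  have "int_iterate f (k + 1) = inv f ^^ n"
    using False n by (cases "k + 1 = 0") (auto simp: int_iterate_def n_def)
  moreover have "int_iterate f k = inv f \<circ> inv f ^^ n" using False n by (simp add: int_iterate_def)
  moreover have "f \<circ> (inv f \<circ> X) = X" for X :: "'a \<Rightarrow> 'a"
    using assms by (simp add: fun_eq_iff bij_is_surj surj_f_inv_f)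
  ultimately show ?thesis by simp
qed

lemma int_iterate_pred:
  assumes "bij f"
  shows "int_iterate f (k - 1) = inv f \<circ> int_iterate f k"
  using int_iterate_Suc[OF assms, of "k - 1"] assms
  by (simp add: fun_eq_iff bij_is_inj)

lemma int_iterate_intertwine:
  assumes "bij f" "bij g" "S \<circ> f = g \<circ> S"
  shows "S \<circ> int_iterate f k = int_iterate g k \<circ> S"
proof (induction k rule: int_induct[of _ 0])
  case base
  then show ?case by (simp add: int_iterate_0)
next
  case (step1 k)
  have "S \<circ> int_iterate f (k + 1) = g \<circ> (S \<circ> int_iterate f k)"
    using assms by (metis int_iterate_Suc o_assoc)
  then show ?case using step1 assms by (metis int_iterate_Suc o_assoc)
next
  case (step2 k)
  have "inv g (S p) = S (inv f p)" for p
  proof -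
    have "S (f (inv f p)) = g (S (inv f p))" using fun_cong[OF assms(3), of "inv f p"] by simp
    then show ?thesis using assms by (simp add: bij_is_surj surj_f_inv_f bij_is_inj)
  qed
  then have "S \<circ> int_iterate f (k - 1) = inv g \<circ> (S \<circ> int_iterate f k)"
    using assms by (simp add: int_iterate_pred fun_eq_iff)
  then show ?case using step2 assms by (metis int_iterate_pred o_assoc)
qed

lemma int_iterate_commute:
  assumes "bij f"
  shows "int_iterate f k \<circ> f = f \<circ> int_iterate f k"
  using int_iterate_intertwine[OF assms assms, of f k] by simp

lemma int_iterate_add:
  assumes "bij f"
  shows "int_iterate f (i + j) = int_iterate f i \<circ> int_iterate f j"
proof (induction i rule: int_induct[of _ 0])
  case base
  then show ?case by (simp add: int_iterate_0)
next
  case (step1 i)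
  have "i + 1 + j = (i + j) + 1" by simp
  then show ?case using step1 int_iterate_Suc[OF assms] by (metis o_assoc)
next
  case (step2 i)
  have "i - 1 + j = (i + j) - 1" by simp
  then show ?case using step2 int_iterate_pred[OF assms] by (metis o_assoc)
qed

lemma int_iterate_inv:
  assumes "bij f"
  shows "int_iterate (inv f) k = int_iterate f (- k)"
  using assms by (auto simp: int_iterate_def inv_inv_eq)

lemma bij_int_iterate:
  assumes "bij f"
  shows "bij (int_iterate f k)"
  using int_iterate_add[OF assms, of k "- k"] int_iterate_add[OF assms, of "- k" k]
  by (intro o_bij[of "int_iterate f (- k)"]) (simp_all add: int_iterate_0)

lemma int_iterate_minus:
  assumes "bij f"
  shows "inv (int_iterate f k) = int_iterate f (- k)"
  using int_iterate_add[OF assms, of k "- k"] int_iterate_add[OF assms, of "- k" k]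
  by (intro inv_unique_comp) (simp_all add: int_iterate_0)

section \<open>Henon steps and their orbit sequences\<close>

text \<open>The step \<open>E\<close> of the overview: \<open>\<epsilon> = 1\<close> serves standard
  maps, \<open>\<epsilon> = - 1\<close> the case of linear \<open>p1\<close>, and reversing time
  replaces \<open>\<epsilon>\<close> by \<open>1 / \<epsilon>\<close>.\<close>

definition henon :: "real \<Rightarrow> real poly \<Rightarrow> real \<times> real \<Rightarrow> real \<times> real" where
  "henon \<epsilon> Q = (\<lambda>(x, y). (y, \<epsilon> * x + poly Q y))"

lemma henon_inv:
  assumes "\<epsilon> \<noteq> 0"
  shows "henon \<epsilon> Q \<in> poly_automorphisms" and "inv (henon \<epsilon> Q) = (\<lambda>(x, y). ((y - poly Q x) / \<epsilon>, x))"
proof -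
  have "polynomial_function (\<lambda>p. (snd p, \<epsilon> * fst p + poly Q (snd p)))"
    by (intro polynomial_function_Pair real_polynomial_function_fst_snd real_polynomial_function.intros(3)
        real_polynomial_function.intros(4) real_polynomial_function.intros(2) real_polynomial_function_poly)
  then have f: "polynomial_function (henon \<epsilon> Q)" by (simp add: henon_def case_prod_unfold)
  have "polynomial_function (\<lambda>p. ((snd p - poly Q (fst p)) / \<epsilon>, fst p))"
    by (intro polynomial_function_Pair real_polynomial_function_fst_snd real_polynomial_function_diff
        real_polynomial_function_divide real_polynomial_function_poly)
  then have g: "polynomial_function (\<lambda>(x, y). ((y - poly Q x) / \<epsilon>, x))" by (simp add: case_prod_unfold)
  show "henon \<epsilon> Q \<in> poly_automorphisms" and "inv (henon \<epsilon> Q) = (\<lambda>(x, y). ((y - poly Q x) / \<epsilon>, x))"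
    using assms by (intro poly_automorphismsI[OF f g]; auto simp: henon_def)+
qed

definition henon2 :: "real \<Rightarrow> real poly \<Rightarrow> real poly \<Rightarrow> real \<times> real \<Rightarrow> real \<times> real" where
  "henon2 \<epsilon> Q1 Q2 = henon \<epsilon> Q2 \<circ> henon \<epsilon> Q1"

lemma henon2_aut: "\<epsilon> \<noteq> 0 \<Longrightarrow> henon2 \<epsilon> Q1 Q2 \<in> poly_automorphisms"
  unfolding henon2_def by (intro poly_automorphisms_comp henon_inv(1))

text \<open>Solving the recurrence for its oldest term runs it backwards; the swap puts the two
  coordinates into the order of the reversed sequence, so the result is a step again.\<close>

lemma swap_inv_henon_swap:
  assumes "\<epsilon> \<noteq> 0"
  shows "prod.swap \<circ> inv (henon \<epsilon> Q) \<circ> prod.swap = henon (1 / \<epsilon>) (smult (- 1 / \<epsilon>) Q)"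
  using assms by (auto simp: henon_inv(2) henon_def[of "1 / \<epsilon>"] fun_eq_iff diff_divide_distrib)

text \<open>All coordinates of all iterates in one sequence: indices \<open>2 * k\<close> and
  \<open>2 * k + 1\<close> belong to the \<open>k\<close>-th iterate, also for negative
  \<open>k\<close> because \<open>div\<close> rounds down. For \<open>henon2\<close> a pair that
  starts at an odd index is the state after a half step.\<close>

definition orbit :: "(real \<times> real \<Rightarrow> real \<times> real) \<Rightarrow> int \<Rightarrow> real \<times> real \<Rightarrow> real" where
  "orbit f j p = (if even j then fst else snd) (int_iterate f (j div 2) p)"

lemma orbit_pair: "(orbit f (2 * k) p, orbit f (2 * k + 1) p) = int_iterate f k p"
  by (simp add: orbit_def)

lemma orbit_0_1: "orbit f 0 p = fst p" "orbit f 1 p = snd p"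
  by (simp_all add: orbit_def int_iterate_0)

text \<open>\<open>R1\<close> acts at odd indices because the first half step adds a function of the
  second coordinate to a multiple of the first.\<close>

lemma orbit_henon_rec:
  fixes R1 R2 :: "real poly"
  assumes "\<epsilon> \<noteq> 0"
  defines "G \<equiv> henon2 \<epsilon> R1 R2"
  shows "orbit G (j + 1) p = \<epsilon> * orbit G (j - 1) p + poly (if odd j then R1 else R2) (orbit G j p)"
proof -
  have G': "G (x, y) = (\<epsilon> * x + poly R1 y, \<epsilon> * y + poly R2 (\<epsilon> * x + poly R1 y))" for x y
    by (simp add: G_def henon2_def henon_def)
  have bij: "bij G" unfolding G_def using assms by (intro poly_automorphisms_bij henon2_aut)
  have step: "(orbit G (2 * k + 2) p, orbit G (2 * k + 3) p) = G (orbit G (2 * k) p, orbit G (2 * k + 1) p)" for k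
    using int_iterate_Suc[OF bij, of k] orbit_pair[of G "k + 1" p] orbit_pair[of G k p]
    by (simp add: algebra_simps)
  show ?thesis
  proof (cases "odd j")
    case True
    then obtain k where "j = 2 * k + 1" by (elim oddE)
    then show ?thesis using step[of k] by (simp add: G' add.commute)
  next
    case False
    then obtain k where "j = 2 * k" by auto
    then show ?thesis using step[of "k - 1"] by (simp add: G' algebra_simps)
  qed
qed

lemma swap_inv_henon2_swap:
  assumes "\<epsilon> \<noteq> 0"
  shows "prod.swap \<circ> inv (henon2 \<epsilon> Q1 Q2) \<circ> prod.swap =
    henon2 (1 / \<epsilon>) (smult (- 1 / \<epsilon>) Q2) (smult (- 1 / \<epsilon>) Q1)"
proof -
  have "inv (henon2 \<epsilon> Q1 Q2) = inv (henon \<epsilon> Q1) \<circ> inv (henon \<epsilon> Q2)"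
    unfolding henon2_def using assms by (intro o_inv_distrib poly_automorphisms_bij henon_inv(1))
  moreover have "henon2 (1 / \<epsilon>) (smult (- 1 / \<epsilon>) Q2) (smult (- 1 / \<epsilon>) Q1) =
    (prod.swap \<circ> inv (henon \<epsilon> Q1) \<circ> prod.swap) \<circ> (prod.swap \<circ> inv (henon \<epsilon> Q2) \<circ> prod.swap)"
    unfolding henon2_def swap_inv_henon_swap[OF assms] ..
  ultimately show ?thesis by (simp add: fun_eq_iff)
qed

text \<open>Time reversal reflects the index about \<open>1 / 2\<close>, the midpoint between the
  two coordinates of the starting point. Backward growth of \<open>G\<close> thereby becomes forward
  growth of the swapped inverse.\<close>

lemma orbit_swap:
  assumes "bij G"
  shows "orbit (prod.swap \<circ> inv G \<circ> prod.swap) j p = orbit G (1 - j) (prod.swap p)"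
proof -
  let ?G' = "prod.swap \<circ> inv G \<circ> prod.swap"
  have b: "bij (inv G)" "bij ?G'" using assms by (auto intro!: bij_comp bij_imp_bij_inv)
  have "prod.swap \<circ> inv G = ?G' \<circ> prod.swap" by (simp add: fun_eq_iff)
  then have "prod.swap \<circ> int_iterate (inv G) k = int_iterate ?G' k \<circ> prod.swap" for k
    using b by (intro int_iterate_intertwine)
  then have *: "int_iterate ?G' k p = prod.swap (int_iterate G (- k) (prod.swap p))" for k
    by (metis assms comp_apply int_iterate_inv swap_swap)
  show ?thesis
  proof (cases "even j")
    case True
    then obtain k where j: "j = 2 * k" by (elim evenE) simp
    have "1 - j = 2 * (- k) + 1" by (simp add: j)
    moreover have "odd (1 - j)" "(1 - j) div 2 = - k" using calculation by presburger+
    ultimately show ?thesis using j *[of k] by (simp add: orbit_def)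
  next
    case False
    then obtain k where j: "j = 2 * k + 1" by (elim oddE)
    have "1 - j = 2 * (- k)" by (simp add: j)
    moreover have "even (1 - j)" "(1 - j) div 2 = - k" using calculation by presburger+
    ultimately show ?thesis using j *[of k] by (simp add: orbit_def)
  qed
qed

lemma orbit_polynomial:
  assumes "f \<in> poly_automorphisms"
  shows "real_polynomial_function (orbit f j)"
proof -
  have "polynomial_function (int_iterate f (j div 2))"
    using int_iterate_poly_automorphisms[OF assms] by (simp add: poly_automorphisms_def)
  then show ?thesis
    using real_polynomial_function_coords[of "int_iterate f (j div 2)"]
    unfolding orbit_def by (cases "even j") simp_all
qed

lemma surj_orbit:
  assumes "bij f"
  shows "surj (orbit f j)"
proof -
  have "\<exists>p. y = orbit f j p" for y
  proof -
    obtain p where "int_iterate f (j div 2) p = (y, y)"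
      using bij_int_iterate[OF assms] by (metis bij_pointE)
    then have "y = orbit f j p" by (simp add: orbit_def)
    then show ?thesis ..
  qed
  then show ?thesis unfolding surj_def by blast
qed

text \<open>In a vanishing sum of three terms the highest degree cannot occur only once, and
  composition in one variable multiplies degrees exactly. The last claim ties consecutive leading
  coefficients as soon as the composed term dominates.\<close>

lemma henon_step_degree:
  fixes a0 a1 a2 R :: "real poly"
  assumes a2: "a2 = smult \<epsilon> a0 + pcompose R a1" and "\<epsilon> \<noteq> 0"
  shows "degree a0 < degree R * degree a1 \<Longrightarrow> degree a2 = degree R * degree a1"
    and "degree a2 < degree R * degree a1 \<Longrightarrow> degree a0 = degree R * degree a1"
    and "degree R * degree a1 < degree a0 \<Longrightarrow> degree a2 = degree a0"
    and "degree a0 < degree R * degree a1 \<Longrightarrow> lead_coeff a2 = lead_coeff R * lead_coeff a1 ^ degree R"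
proof -
  show 1: "degree a2 = degree R * degree a1" if "degree a0 < degree R * degree a1"
    unfolding a2 using that assms by (subst degree_add_eq_right) (simp_all add: degree_pcompose)
  show "degree a0 = degree R * degree a1" if "degree a2 < degree R * degree a1"
  proof -
    have "smult \<epsilon> a0 = a2 - pcompose R a1" by (simp add: a2)
    then have "degree (smult \<epsilon> a0) = degree (- pcompose R a1 + a2)" by simp
    also have "\<dots> = degree R * degree a1" using that by (subst degree_add_eq_left) (simp_all add: degree_pcompose)
    finally show ?thesis using assms by simp
  qed
  show "degree a2 = degree a0" if "degree R * degree a1 < degree a0"
    unfolding a2 using that assms by (subst degree_add_eq_left) (simp_all add: degree_pcompose)
  show "lead_coeff a2 = lead_coeff R * lead_coeff a1 ^ degree R" if "degree a0 < degree R * degree a1"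
  proof -
    have "degree a1 > 0" using that by (cases "degree a1") auto
    then have "lead_coeff (pcompose R a1) = lead_coeff R * lead_coeff a1 ^ degree R"
      by (intro lead_coeff_comp)
    then show ?thesis using 1[OF that] that by (simp add: a2 coeff_eq_0 degree_pcompose)
  qed
qed

lemma henon_sequence_growth:
  fixes A :: "int \<Rightarrow> real poly" and d :: real
  assumes e: "\<epsilon> \<noteq> 0" and R: "degree R1 \<ge> 2" "degree R2 \<ge> 2"
    and A: "\<And>j. A (j + 1) = smult \<epsilon> (A (j - 1)) + pcompose (if odd j then R1 else R2) (A j)"
    and pos: "\<And>j. degree (A j) \<ge> 1"
  defines "d \<equiv> real (degree R1 * degree R2)"
  shows "\<exists>N lam mu. lam > 0 \<and> mu > 0 \<and> lam * mu \<ge> 1 \<and>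
    (lam * mu = 1 \<longrightarrow> (\<exists>j. degree (A j) = 1 \<and> degree (A (j + 1)) = 1)) \<and>
    (\<forall>l\<ge>N. degree (A (2 * int l)) = lam * d ^ l / degree R2 \<and> degree (A (2 * int l + 1)) = lam * d ^ l \<and>
           degree (A (- 2 * int l)) = mu * d ^ l \<and> degree (A (1 - 2 * int l)) = mu * d ^ l / degree R1)"
proof -
  define r where "r = (\<lambda>j::int. degree (if odd j then R1 else R2))"
  \<comment> \<open>Scaled so that, for \<open>j \<ge> 1\<close>, it is the degree sequence of the
    orbit of \<open>henon2 \<epsilon> R1 R2\<close> itself on a line with two nonconstant
    coordinates. This makes \<open>lam\<close> and \<open>mu\<close> rates relative to the
    identity.\<close>
  define \<pi> where "\<pi> = (\<lambda>j::int. if odd j then d powi (j div 2) else d powi (j div 2) / degree R2)"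
  have d: "d > 0" "d = real (degree R1) * real (degree R2)" using R by (auto simp: d_def)
  have R0: "real (degree R1) > 0" "real (degree R2) > 0" using R by auto
  have "\<exists>N lam mu. (\<forall>j>N. degree (A j) = lam * \<pi> j) \<and> (\<forall>j< -N. degree (A j) * \<pi> (j + 1) = mu) \<and>
    lam > 0 \<and> mu > 0 \<and> lam * mu \<ge> 1 \<and> (lam * mu = 1 \<longrightarrow> (\<exists>j. degree (A j) = 1 \<and> degree (A (j + 1)) = 1))"
  proof (rule degree_profile)
    show "2 \<le> r j" for j using R by (simp add: r_def)
    show "1 \<le> degree (A j)" for j by (rule pos)
    show "\<pi> j > 0" for j using d R0 by (simp add: \<pi>_def)
    show "\<pi> (j + 1) = real (r j) * \<pi> j" for j
    proof (cases "odd j")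
      case True
      then obtain k where k: "j = 2 * k + 1" by (elim oddE)
      then have "(j + 1) div 2 = k + 1" "j div 2 = k" by auto
      then show ?thesis using True d R0 by (simp add: \<pi>_def r_def power_int_add)
    next
      case False
      then have "(j + 1) div 2 = j div 2" by auto
      then show ?thesis using False R0 by (simp add: \<pi>_def r_def)
    qed
    show "degree (A (j - 1)) < r j * degree (A j) \<Longrightarrow> degree (A (j + 1)) = r j * degree (A j)"
      and "degree (A (j + 1)) < r j * degree (A j) \<Longrightarrow> degree (A (j - 1)) = r j * degree (A j)"
      and "r j * degree (A j) < degree (A (j - 1)) \<Longrightarrow> degree (A (j + 1)) = degree (A (j - 1))" for j
      unfolding r_def using henon_step_degree(1-3)[OF A[of j] e] by blast+
  qed
  then obtain N lam mu where lam: "\<And>j. j > N \<Longrightarrow> degree (A j) = lam * \<pi> j"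
    and mu: "\<And>j. j < - N \<Longrightarrow> degree (A j) * \<pi> (j + 1) = mu"
    and lm: "lam > 0" "mu > 0" "lam * mu \<ge> 1" "lam * mu = 1 \<longrightarrow> (\<exists>j. degree (A j) = 1 \<and> degree (A (j + 1)) = 1)"
    by blast
  have "degree (A (2 * int l)) = lam * d ^ l / degree R2 \<and> degree (A (2 * int l + 1)) = lam * d ^ l \<and>
           degree (A (- 2 * int l)) = mu * d ^ l \<and> degree (A (1 - 2 * int l)) = mu * d ^ l / degree R1"
    if "l \<ge> nat \<bar>N\<bar> + 2" for l
  proof (intro conjI)
    have "2 * int l > N" using that by linarith
    then show "degree (A (2 * int l)) = lam * d ^ l / degree R2" using lam[of "2 * int l"] by (simp add: \<pi>_def)
    have "2 * int l + 1 > N" using that by linarith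
    then show "degree (A (2 * int l + 1)) = lam * d ^ l" using lam[of "2 * int l + 1"] by (simp add: \<pi>_def)
    have "- 2 * int l < - N" using that by linarith
    then have *: "degree (A (- 2 * int l)) * \<pi> (- 2 * int l + 1) = mu" by (rule mu)
    have "(- 2 * int l + 1) div 2 = - int l" by linarith
    then have pi_l: "\<pi> (- 2 * int l + 1) = 1 / d ^ l"
      using d by (simp add: \<pi>_def power_int_minus divide_inverse)
    then show "degree (A (- 2 * int l)) = mu * d ^ l" using *[unfolded pi_l] d(1) by (simp add: field_simps)
    have "1 - 2 * int l < - N" using that by linarith
    then have *: "degree (A (1 - 2 * int l)) * \<pi> (1 - 2 * int l + 1) = mu" by (rule mu)
    have "(1 - 2 * int l + 1) div 2 = 1 - int l" by linarith
    then have "\<pi> (1 - 2 * int l + 1) = d powi (1 - int l) / degree R2"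
      by (simp add: \<pi>_def)
    also have "d powi (1 - int l) = d / d ^ l" using d(1) by (simp add: power_int_diff)
    also have "d / d ^ l / degree R2 = degree R1 / d ^ l" using d(2) R0 by simp
    finally have pi_l: "\<pi> (1 - 2 * int l + 1) = degree R1 / d ^ l" .
    show "degree (A (1 - 2 * int l)) = mu * d ^ l / degree R1"
      using *[unfolded pi_l] d(1) R0 by (simp add: field_simps)
  qed
  then show ?thesis using lm
    by (intro exI[of _ "nat \<bar>N\<bar> + 2"] exI[of _ lam] exI[of _ mu]) simp
qed

section \<open>Growth rates of a conjugacy between Henon maps\<close>

text \<open>From two degrees equal to \<open>1\<close> onwards the composed term dominates every
  step, as \<open>R1\<close> and \<open>R2\<close> have degree at least \<open>2\<close>. Even
  indices are covered from \<open>2\<close> on, because the degree at index \<open>0\<close> is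
  \<open>1\<close> and does not follow the pattern.\<close>

lemma line_degrees:
  fixes a b :: "real poly"
  assumes eps: "\<epsilon> \<noteq> 0" and R: "degree R1 \<ge> 2" "degree R2 \<ge> 2" and ab: "degree a = 1" "degree b = 1"
  shows "degree (curve_poly (orbit (henon2 \<epsilon> R1 R2) (2 * int l + 1)) a b) = (degree R1 * degree R2) ^ l"
    and "degree (curve_poly (orbit (henon2 \<epsilon> R1 R2) (2 * int (Suc l))) a b) = degree R1 * (degree R1 * degree R2) ^ l"
proof -
  define B where "B j = curve_poly (orbit (henon2 \<epsilon> R1 R2) j) a b" for j
  have poly_B: "poly (B j) z = orbit (henon2 \<epsilon> R1 R2) j (poly a z, poly b z)" for j z
    unfolding B_def by (intro poly_curve_poly orbit_polynomial henon2_aut eps)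
  have rec: "B (j + 1) = smult \<epsilon> (B (j - 1)) + pcompose (if odd j then R1 else R2) (B j)" for j
  proof -
    have "poly (B (j + 1)) = poly (smult \<epsilon> (B (j - 1)) + pcompose (if odd j then R1 else R2) (B j))"
      using orbit_henon_rec[OF eps, of R1 R2 j] by (simp add: fun_eq_iff poly_B poly_pcompose)
    then show ?thesis by (simp add: poly_eq_poly_eq_iff)
  qed
  let ?d = "degree R1 * degree R2"
  have step: "degree (B (2 * int l + 2)) = degree R1 * ?d ^ l \<and> degree (B (2 * int l + 3)) = ?d ^ Suc l"
    if "degree (B (2 * int l)) \<le> ?d ^ l" "degree (B (2 * int l + 1)) = ?d ^ l" for l
  proof -
    have p: "?d ^ l > 0" using R by simp
    have "1 * ?d ^ l < degree R1 * ?d ^ l" using R p by (intro mult_strict_right_mono; linarith)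
    then have "degree (B (2 * int l)) < degree R1 * degree (B (2 * int l + 1))"
      unfolding that(2) using that(1) by linarith
    then have 1: "degree (B (2 * int l + 2)) = degree R1 * ?d ^ l"
      using henon_step_degree(1)[OF rec[of "2 * int l + 1"] eps] that by (simp add: add.commute)
    have "1 * ?d ^ l < degree R2 * (degree R1 * ?d ^ l)"
      using R p by (intro mult_less_le_imp_less) auto
    then have "degree (B (2 * int l + 3)) = ?d ^ Suc l"
      using henon_step_degree(1)[OF rec[of "2 * int l + 2"] eps] that 1 by (simp add: add.commute mult_ac)
    with 1 show ?thesis ..
  qed
  have "B 0 = a" "B 1 = b"
    unfolding B_def by (intro curve_poly_eqI orbit_polynomial henon2_aut eps; simp add: orbit_0_1)+
  then have ind: "degree (B (2 * int l)) \<le> ?d ^ l \<and> degree (B (2 * int l + 1)) = ?d ^ l" for l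
  proof (induction l)
    case 0
    then show ?case using ab by simp
  next
    case (Suc l)
    then have s: "degree (B (2 * int l + 2)) = degree R1 * ?d ^ l \<and> degree (B (2 * int l + 3)) = ?d ^ Suc l"
      using step by blast
    have "degree R1 * ?d ^ l \<le> ?d ^ Suc l" using R by simp
    then show ?case using s by (simp add: algebra_simps)
  qed
  show "degree (curve_poly (orbit (henon2 \<epsilon> R1 R2) (2 * int l + 1)) a b) = ?d ^ l"
    using ind[of l] by (simp add: B_def)
  show "degree (curve_poly (orbit (henon2 \<epsilon> R1 R2) (2 * int (Suc l))) a b) = degree R1 * ?d ^ l"
    using step[of l] ind[of l] by (simp add: B_def algebra_simps)
qed

lemma swap_aut: "prod.swap \<in> poly_automorphisms"
proof (rule poly_automorphismsI(1)[of _ prod.swap])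
  show *: "polynomial_function (prod.swap :: real \<times> real \<Rightarrow> real \<times> real)"
    using polynomial_function_Pair[OF real_polynomial_function_fst_snd(2,1)]
    by (simp add: prod.swap_def[abs_def])
  show "polynomial_function (prod.swap :: real \<times> real \<Rightarrow> real \<times> real)" by (rule *)
qed simp_all

text \<open>General enough to be closed under \<open>inverse\<close> and \<open>flip\<close>. For a
  symmetry both maps coincide; for a reversing symmetry \<open>G\<close> is the swapped inverse of
  \<open>F\<close>. By \<open>deg_eq\<close> the degrees on both sides grow by the same factor
  \<open>d\<close>.\<close>

locale henon_conjugacy =
  fixes \<epsilon> :: real and Q1 Q2 R1 R2 :: "real poly" and S :: "real \<times> real \<Rightarrow> real \<times> real"
  assumes eps: "\<epsilon> \<noteq> 0"
    and degs: "degree Q1 \<ge> 2" "degree Q2 \<ge> 2" "degree R1 \<ge> 2" "degree R2 \<ge> 2"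
    and deg_eq: "degree Q1 * degree Q2 = degree R1 * degree R2"
    and S: "S \<in> poly_automorphisms"
    and conj: "S \<circ> henon2 \<epsilon> Q1 Q2 = henon2 \<epsilon> R1 R2 \<circ> S"
begin

abbreviation "F \<equiv> henon2 \<epsilon> Q1 Q2"
abbreviation "G \<equiv> henon2 \<epsilon> R1 R2"
definition d :: real where "d = real (degree R1 * degree R2)"

lemma G_aut: "G \<in> poly_automorphisms" and F_aut: "F \<in> poly_automorphisms"
  using eps henon2_aut by auto

lemma bij_S: "bij S" and bij_G: "bij G" and bij_F: "bij F"
  using S G_aut F_aut poly_automorphisms_bij by blast+

lemma d_pos: "d > 0"
  using degs by (auto simp: d_def)

lemma intertwine: "S (int_iterate F k p) = int_iterate G k (S p)"
  using int_iterate_intertwine[OF bij_F bij_G conj, of k] by (metis comp_apply)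

lemma inv_intertwine: "inv S (int_iterate G k p) = int_iterate F k (inv S p)"
  using intertwine[of k "inv S p"] bij_S
  by (metis bij_inv_eq_iff)

lemma inverse: "henon_conjugacy \<epsilon> R1 R2 Q1 Q2 (inv S)"
proof
  have "inv S (G p) = F (inv S p)" for p
    using inv_intertwine[of 1 p] int_iterate_Suc[OF bij_G, of 0] int_iterate_Suc[OF bij_F, of 0]
    by (simp add: int_iterate_0)
  then show "inv S \<circ> G = F \<circ> inv S"
    by (simp add: fun_eq_iff)
qed (use eps degs deg_eq S poly_automorphisms_inv in auto)

text \<open>The same conjugacy with time reversed: its forward rate is the backward rate of
  \<open>S\<close>.\<close>

lemma flip: "henon_conjugacy (1 / \<epsilon>) (smult (- 1 / \<epsilon>) Q2) (smult (- 1 / \<epsilon>) Q1)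
    (smult (- 1 / \<epsilon>) R2) (smult (- 1 / \<epsilon>) R1) (prod.swap \<circ> S \<circ> prod.swap)"
proof
  show "prod.swap \<circ> S \<circ> prod.swap \<in> poly_automorphisms"
    by (intro poly_automorphisms_comp swap_aut S)
  have "S (inv F p) = inv G (S p)" for p
    using intertwine[of "- 1" p] int_iterate_pred[OF bij_F, of 0] int_iterate_pred[OF bij_G, of 0]
    by (simp add: int_iterate_0)
  then show "prod.swap \<circ> S \<circ> prod.swap \<circ> henon2 (1 / \<epsilon>) (smult (- 1 / \<epsilon>) Q2) (smult (- 1 / \<epsilon>) Q1) =
      henon2 (1 / \<epsilon>) (smult (- 1 / \<epsilon>) R2) (smult (- 1 / \<epsilon>) R1) \<circ> (prod.swap \<circ> S \<circ> prod.swap)"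
    unfolding swap_inv_henon2_swap[OF eps, symmetric] by (simp add: fun_eq_iff)
qed (use eps degs deg_eq in \<open>auto simp: mult.commute\<close>)

abbreviation h :: "int \<Rightarrow> real \<times> real \<Rightarrow> real" where "h j \<equiv> orbit G j \<circ> S"

lemma h_polynomial: "real_polynomial_function (h j)"
  using real_polynomial_function_compose[OF _ orbit_polynomial[OF G_aut]] S
  unfolding poly_automorphisms_def by blast

text \<open>Coordinates of a bijection are onto. This keeps all weights, and so all degrees on
  generic curves, at least \<open>1\<close>, as \<open>degree_profile\<close> demands.\<close>

lemma h_not_const: "h j \<noteq> (\<lambda>_. c)"
proof
  assume h: "h j = (\<lambda>_. c)"
  have "surj (h j)" by (rule comp_surj[OF bij_is_surj[OF bij_S] surj_orbit[OF bij_G]])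
  then obtain p where "h j p = c + 1" by (metis surjD)
  then show False using fun_cong[OF h, of p] by simp
qed

abbreviation A :: "real poly \<Rightarrow> real poly \<Rightarrow> int \<Rightarrow> real poly" where
  "A a b j \<equiv> curve_poly (h j) a b"

lemma poly_A: "poly (A a b j) z = h j (poly a z, poly b z)"
  by (rule poly_curve_poly[OF h_polynomial])

lemma A_rec: "A a b (j + 1) = smult \<epsilon> (A a b (j - 1)) + pcompose (if odd j then R1 else R2) (A a b j)"
proof -
  have "poly (A a b (j + 1)) = poly (smult \<epsilon> (A a b (j - 1)) + pcompose (if odd j then R1 else R2) (A a b j))"
    using orbit_henon_rec[OF eps, of R1 R2 j] by (simp add: fun_eq_iff poly_A poly_pcompose)
  then show ?thesis by (simp add: poly_eq_poly_eq_iff)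
qed

lemma A_growth:
  assumes "\<And>j. degree (A a b j) \<ge> 1"
  shows "\<exists>N lam mu. lam > 0 \<and> mu > 0 \<and> lam * mu \<ge> 1 \<and>
    (lam * mu = 1 \<longrightarrow> (\<exists>j. degree (A a b j) = 1 \<and> degree (A a b (j + 1)) = 1)) \<and>
    (\<forall>l\<ge>N. degree (A a b (2 * int l)) = lam * d ^ l / degree R2 \<and> degree (A a b (2 * int l + 1)) = lam * d ^ l \<and>
           degree (A a b (- 2 * int l)) = mu * d ^ l \<and> degree (A a b (1 - 2 * int l)) = mu * d ^ l / degree R1)"
  unfolding d_def by (rule henon_sequence_growth[OF eps degs(3,4) A_rec assms])

lemma ex_leading_forms:
  assumes m: "m > 0"
  shows "\<exists>w P. \<forall>j. has_leading_form m (h j) (w j) (P j) \<and> w j \<ge> 1 \<and>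
    (m = 1 \<and> w j = 1 \<longrightarrow> affine_fun (h j))"
proof -
  have "\<forall>j. \<exists>w P. has_leading_form m (h j) w P \<and> w \<ge> 1 \<and>
    (m = 1 \<and> w = 1 \<longrightarrow> affine_fun (h j))"
  proof
    fix j
    obtain w P where "has_leading_form m (h j) w P" "w = 0 \<longrightarrow> (\<exists>c. h j = (\<lambda>_. c))"
      "m = 1 \<and> w = 1 \<longrightarrow> affine_fun (h j)"
      using ex_leading_form[OF h_polynomial h_not_const m, of j] by (elim exE conjE) (rule that)
    then show "\<exists>w P. has_leading_form m (h j) w P \<and> w \<ge> 1 \<and>
      (m = 1 \<and> w = 1 \<longrightarrow> affine_fun (h j))"
      using h_not_const[of j] by (intro exI[of _ w] exI[of _ P]) (auto simp: Suc_le_eq)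
  qed
  then show ?thesis by metis
qed

text \<open>On the curve \<open>y = t * x ^ m\<close> the degree of each restriction is the weight
  of \<open>h j\<close>, for all \<open>j\<close> at once. For \<open>m = 1\<close> the curve is a
  line and the weight is the total degree.\<close>

lemma generic_curve:
  assumes m: "m > 0"
  shows "\<exists>w P t. t \<noteq> 0 \<and> (\<forall>j. has_leading_form m (h j) (w j) (P j) \<and> w j \<ge> 1 \<and>
    degree (A [:0, 1:] (monom t m) j) = w j \<and>
    (m = 1 \<and> w j = 1 \<longrightarrow> affine_fun (h j)))"
proof -
  obtain w P where wP: "\<And>j. has_leading_form m (h j) (w j) (P j) \<and> w j \<ge> 1 \<and>
    (m = 1 \<and> w j = 1 \<longrightarrow> affine_fun (h j))"
    using ex_leading_forms[OF m] by blast
  then have "P j \<noteq> 0" for j by (auto simp: has_leading_form_def)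
  then obtain t where t: "t \<noteq> 0" "\<And>j. poly (P j) t \<noteq> 0"
    using ex_common_non_root[of "UNIV :: int set" P] by auto
  have "degree (A [:0, 1:] (monom t m) j) = w j" for j
    using has_leading_form_degree[OF wP[THEN conjunct1], of "[:0, 1:]" "monom t m" t j] t
    by (simp add: degree_monom_eq)
  then show ?thesis using wP t by blast
qed

text \<open>The curve \<open>(A (2 l), A (2 l + 1))\<close> eventually satisfies the hypothesis on curves in
  \<open>has_leading_form\<close>.\<close>

lemma A_curve_regime:
  assumes "lam > 0" "degree (A a b (2 * int l)) = lam * d ^ l / degree R2"
    "degree (A a b (2 * int l - 1)) < degree (A a b (2 * int l + 1))"
    "degree (A a b (2 * int l + 1)) = lam * d ^ l"
  shows "degree (A a b (2 * int l)) > 0"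
    and "degree (A a b (2 * int l + 1)) = degree R2 * degree (A a b (2 * int l))"
    and "lead_coeff (A a b (2 * int l + 1)) = lead_coeff R2 * lead_coeff (A a b (2 * int l)) ^ degree R2"
proof -
  have R2: "real (degree R2) > 0" using degs by simp
  have "real (degree (A a b (2 * int l))) > 0" using assms(1) d_pos R2 by (simp add: assms(2))
  then show "degree (A a b (2 * int l)) > 0" by simp
  have "real (degree (A a b (2 * int l + 1))) = real (degree R2 * degree (A a b (2 * int l)))"
    using R2 by (simp add: assms(2,4))
  then show e: "degree (A a b (2 * int l + 1)) = degree R2 * degree (A a b (2 * int l))"
    by (simp only: of_nat_eq_iff)
  show "lead_coeff (A a b (2 * int l + 1)) = lead_coeff R2 * lead_coeff (A a b (2 * int l)) ^ degree R2"
    using henon_step_degree(4)[OF A_rec[of "2 * int l" a b] eps] assms(3) e by simp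
qed

end

text \<open>Without cancellation in the leading form, the top weight of \<open>h (2 j + 1)\<close> would be multiplied
  by less than \<open>d\<close> in every step, against the growth of the degrees.\<close>

lemma (in henon_conjugacy) ex_tame:
  "\<exists>j w P. has_leading_form (degree Q2) (orbit G (2 * int j + 1) \<circ> S) w P \<and> poly P (lead_coeff Q2) \<noteq> 0"
proof -
  define r where "r = degree Q2"
  have r: "r > 0" using degs by (simp add: r_def)
  obtain w P t where t: "t \<noteq> 0" and wP: "\<And>j. has_leading_form r (h j) (w j) (P j)" "\<And>j. w j \<ge> 1"
    "\<And>j. degree (A [:0, 1:] (monom t r) j) = w j"
    using generic_curve[OF r] by blast
  obtain N lam where lam: "lam > 0" "\<And>l. l \<ge> N \<Longrightarrow> w (2 * int l + 1) = lam * d ^ l"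
    using A_growth[of "[:0, 1:]" "monom t r"] wP by (metis (no_types, lifting))
  \<comment> \<open>\<open>(a1, b1)\<close> is the image of the generic curve under
    \<open>F\<close>. It satisfies the condition on curves in \<open>has_leading_form\<close> with
    \<open>c = lead_coeff Q2\<close>, independently of \<open>t\<close>.\<close>
  define a1 where "a1 = smult \<epsilon> [:0, 1:] + pcompose Q1 (monom t r)"
  define b1 where "b1 = smult \<epsilon> (monom t r) + pcompose Q2 a1"
  have dm: "degree (monom t r) = r" using t by (simp add: degree_monom_eq)
  have "1 < degree Q1 * r"
    using mult_le_mono[OF degs(1,2)] unfolding r_def by linarith
  then have a1: "degree a1 = degree Q1 * r"
    using henon_step_degree(1)[OF a1_def eps] by (simp add: dm)
  have "degree (monom t r) < degree Q2 * degree a1"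
    using mult_strict_left_mono[OF \<open>1 < degree Q1 * r\<close> r] by (simp add: dm a1 mult_ac flip: r_def)
  then have b1: "degree b1 = r * degree a1" "lead_coeff b1 = lead_coeff Q2 * lead_coeff a1 ^ r"
    using henon_step_degree(1,4)[OF b1_def eps] by (simp_all add: r_def)
  have d: "real (degree a1) = d" using a1 deg_eq by (simp add: d_def r_def)
  \<comment> \<open>An odd index in the range of exact growth: from \<open>n\<close> to
    \<open>n + 2\<close> the weight is multiplied by \<open>d = degree a1\<close>. Restricting
    \<open>h (n + 2)\<close> to the generic curve is restricting \<open>h n\<close> to its image
    under \<open>F\<close>.\<close>
  define n where "n = 2 * int N + 1"
  have "curve_poly (h n) a1 b1 = A [:0, 1:] (monom t r) (n + 2)"
  proof (rule curve_poly_eqI[OF h_polynomial])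
    fix z
    have "orbit G (n + 2) (S (z, t * z ^ r)) = snd (int_iterate G (int N + 1) (S (z, t * z ^ r)))"
      by (simp add: orbit_def n_def add.commute)
    also have "\<dots> = snd (int_iterate G (int N) (int_iterate G 1 (S (z, t * z ^ r))))"
      using int_iterate_add[OF bij_G, of "int N" 1] by simp
    also have "int_iterate G 1 (S (z, t * z ^ r)) = S (F (z, t * z ^ r))"
      using intertwine[of 1 "(z, t * z ^ r)"] int_iterate_Suc[OF bij_F, of 0] by (simp add: int_iterate_0)
    also have "F (z, t * z ^ r) = (poly a1 z, poly b1 z)"
      by (simp add: henon2_def henon_def a1_def b1_def poly_pcompose poly_monom mult.commute)
    finally show "h n (poly a1 z, poly b1 z) = poly (A [:0, 1:] (monom t r) (n + 2)) z"
      by (simp add: poly_A poly_monom orbit_def n_def)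
  qed
  then have deg: "degree (curve_poly (h n) a1 b1) = w (n + 2)" using wP(3) by simp
  have "real (w (n + 2)) = real (w n * degree a1)"
    using lam(2)[of N] lam(2)[of "Suc N"] d by (simp add: n_def algebra_simps)
  then have wn: "w (n + 2) = w n * degree a1" by (simp only: of_nat_eq_iff)
  have "coeff (curve_poly (h n) a1 b1) (w n * degree a1) = lead_coeff a1 ^ w n * poly (P n) (lead_coeff Q2)"
  proof (rule has_leading_form_coeff[OF wP(1)])
    show "degree a1 > 0" using a1 \<open>1 < degree Q1 * r\<close> by linarith
  qed (use b1 in simp_all)
  \<comment> \<open>The bound \<open>w n * degree a1\<close> is the actual degree, so this is a
    leading coefficient; a zero of \<open>P n\<close> at \<open>lead_coeff Q2\<close> would
    annihilate it.\<close>
  moreover have "coeff (curve_poly (h n) a1 b1) (w n * degree a1) \<noteq> 0"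
  proof -
    have "degree (curve_poly (h n) a1 b1) \<noteq> 0" using deg wP(2)[of "n + 2"] by simp
    then have "lead_coeff (curve_poly (h n) a1 b1) \<noteq> 0" by auto
    then show ?thesis by (simp add: deg wn)
  qed
  ultimately have "poly (P n) (lead_coeff Q2) \<noteq> 0" by auto
  then show ?thesis using wP(1)[of n] unfolding n_def r_def by blast
qed

context henon_conjugacy
begin

lemma orbit_orbit:
  "orbit F (2 * i + 1) (inv S (int_iterate G k p)) = orbit F (2 * (i + k) + 1) (inv S p)"
  by (simp add: orbit_def inv_intertwine int_iterate_add[OF bij_F])

text \<open>The tame polynomial \<open>orbit F (2 j + 1) \<circ> inv S\<close> of \<open>ex_tame\<close> is evaluated on the curves
  \<open>G ^ l \<circ> S \<circ> (a, b)\<close> and \<open>G ^ l \<circ> (a', b')\<close>; its degree on either is known from the leading form and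
  also from commuting \<open>inv S\<close> with \<open>G ^ l\<close>.\<close>

lemma growth_rates_inverse:
  fixes a b a' b' :: "real poly"
  assumes a: "degree a = 1" "degree b = 1" and a': "degree a' = 1" "degree b' = 1"
    and lam: "lam > 0" "\<And>l. l \<ge> N \<Longrightarrow> degree (A a b (2 * int l)) = lam * d ^ l / degree R2"
      "\<And>l. l \<ge> N \<Longrightarrow> degree (A a b (2 * int l + 1)) = lam * d ^ l"
    and lam': "\<And>l. l \<ge> N' \<Longrightarrow> degree (curve_poly (orbit F (2 * int l + 1) \<circ> inv S) a' b') = lam' * d ^ l"
  shows "lam * lam' = 1"
proof -
  interpret inv: henon_conjugacy \<epsilon> R1 R2 Q1 Q2 "inv S" by (rule inverse)
  \<comment> \<open>The trivial conjugacy of \<open>G\<close> to itself supplies, in the same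
    notation, the iterates of a plain line under \<open>G\<close>, whose forward rate is
    \<open>1\<close>.\<close>
  interpret Gid: henon_conjugacy \<epsilon> R1 R2 R1 R2 id
    by unfold_locales (use eps degs poly_automorphisms_id in auto)
  have d1: "d > 1"
  proof -
    have "2 * 2 \<le> degree R1 * degree R2" using degs by (intro mult_le_mono)
    then have "real 4 \<le> d" unfolding d_def by (simp only: of_nat_le_iff)
    then show ?thesis by simp
  qed
  obtain j w P where P: "has_leading_form (degree R2) (orbit F (2 * int j + 1) \<circ> inv S) w P" "poly P (lead_coeff R2) \<noteq> 0"
    using inv.ex_tame by blast
  have R2: "real (degree R2) > 0" using degs by simp
  \<comment> \<open>One beyond \<open>N\<close>, so that the rate is available at
    \<open>l - 1\<close> too and the degree increases from index \<open>2 * l - 1\<close> to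
    \<open>2 * l + 1\<close>.\<close>
  define l where "l = N + 1"
  have dl: "d ^ l > 0" "d ^ N < d ^ l" using d1 by (simp_all add: l_def)
  have "real (degree (A a b (2 * int l - 1))) < degree (A a b (2 * int l + 1))"
    using lam(3)[of N] lam(3)[of l] lam(1) dl by (simp add: l_def add.commute)
  then have "degree (A a b (2 * int l - 1)) < degree (A a b (2 * int l + 1))"
    by (simp only: of_nat_less_iff)
  moreover have "l \<ge> N" by (simp add: l_def)
  ultimately have reg: "degree (A a b (2 * int l)) > 0"
      "degree (A a b (2 * int l + 1)) = degree R2 * degree (A a b (2 * int l))"
      "lead_coeff (A a b (2 * int l + 1)) = lead_coeff R2 * lead_coeff (A a b (2 * int l)) ^ degree R2"
    using A_curve_regime[of lam l a b] lam by blast+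
  have "degree (curve_poly (orbit F (2 * int j + 1) \<circ> inv S) (A a b (2 * int l)) (A a b (2 * int l + 1))) =
      w * degree (A a b (2 * int l))"
    using has_leading_form_degree[OF P(1) reg(1) _ _ P(2)] reg by simp
  \<comment> \<open>Here \<open>inv S\<close> undoes \<open>S\<close>: what remains is an iterate of
    \<open>F\<close> on a line, of degree \<open>d ^ (j + l)\<close>. Comparison with the leading
    form relates \<open>w\<close> to \<open>lam\<close>.\<close>
  moreover have "curve_poly (orbit F (2 * int j + 1) \<circ> inv S) (A a b (2 * int l)) (A a b (2 * int l + 1)) =
      curve_poly (orbit F (2 * int (j + l) + 1)) a b"
  proof (rule curve_poly_eqI[OF inv.h_polynomial])
    fix z
    have "(orbit F (2 * int j + 1) \<circ> inv S) (poly (A a b (2 * int l)) z, poly (A a b (2 * int l + 1)) z)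
       = orbit F (2 * int j + 1) (inv S (int_iterate G (int l) (S (poly a z, poly b z))))"
      by (simp add: poly_A orbit_pair)
    also have "\<dots> = orbit F (2 * int (j + l) + 1) (poly a z, poly b z)"
      using bij_S by (simp add: orbit_orbit bij_is_inj)
    also have "\<dots> = poly (curve_poly (orbit F (2 * int (j + l) + 1)) a b) z"
      by (simp add: poly_curve_poly[OF orbit_polynomial[OF F_aut]])
    finally show "(orbit F (2 * int j + 1) \<circ> inv S) (poly (A a b (2 * int l)) z, poly (A a b (2 * int l + 1)) z)
       = poly (curve_poly (orbit F (2 * int (j + l) + 1)) a b) z" .
  qed
  moreover have "degree (curve_poly (orbit F (2 * int (j + l) + 1)) a b) = d ^ (j + l)"
    using line_degrees(1)[OF eps degs(1,2) a, of "j + l"] deg_eq by (simp add: d_def)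
  ultimately have "d ^ (j + l) = w * (lam * d ^ l / degree R2)"
    using lam(2)[of l] by (simp add: l_def)
  then have 1: "d ^ j * degree R2 = w * lam"
    using R2 dl d1 by (simp add: power_add field_simps)
  \<comment> \<open>The same tame polynomial is now applied to iterates of a line on which
    \<open>S\<close> has not acted. This relates \<open>w\<close> to \<open>lam'\<close>, and
    eliminating \<open>w\<close> yields the claim.\<close>
  define l where "l = N' + 1"
  have dl: "d ^ l > 0" using d1 by simp
  have g: "real (degree (Gid.A a' b' (2 * int k + 1))) = d ^ k" for k
    using line_degrees(1)[OF eps degs(3,4) a', of k] by (simp add: d_def)
  have g2: "real (degree (Gid.A a' b' (2 * int l))) = d ^ l / degree R2"
    using line_degrees(2)[OF eps degs(3,4) a', of N'] R2 by (simp add: d_def l_def field_simps)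
  have "real (degree (Gid.A a' b' (2 * int l - 1))) < degree (Gid.A a' b' (2 * int l + 1))"
    using g[of N'] g[of l] d1 by (simp add: l_def add.commute)
  then have "degree (Gid.A a' b' (2 * int l - 1)) < degree (Gid.A a' b' (2 * int l + 1))"
    by (simp only: of_nat_less_iff)
  moreover have "degree (Gid.A a' b' (2 * int l)) = 1 * Gid.d ^ l / degree R2" "degree (Gid.A a' b' (2 * int l + 1)) = 1 * Gid.d ^ l"
    using g g2 by simp_all
  ultimately have reg: "degree (Gid.A a' b' (2 * int l)) > 0"
      "degree (Gid.A a' b' (2 * int l + 1)) = degree R2 * degree (Gid.A a' b' (2 * int l))"
      "lead_coeff (Gid.A a' b' (2 * int l + 1)) = lead_coeff R2 * lead_coeff (Gid.A a' b' (2 * int l)) ^ degree R2"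
    using Gid.A_curve_regime[OF zero_less_one, of l a' b'] by blast+
  have "degree (curve_poly (orbit F (2 * int j + 1) \<circ> inv S) (Gid.A a' b' (2 * int l)) (Gid.A a' b' (2 * int l + 1))) =
      w * degree (Gid.A a' b' (2 * int l))"
    using has_leading_form_degree[OF P(1) reg(1) _ _ P(2)] reg by simp
  moreover have "curve_poly (orbit F (2 * int j + 1) \<circ> inv S) (Gid.A a' b' (2 * int l)) (Gid.A a' b' (2 * int l + 1)) =
      inv.A a' b' (2 * int (j + l) + 1)"
  proof (rule curve_poly_eqI[OF inv.h_polynomial])
    fix z
    have "(orbit F (2 * int j + 1) \<circ> inv S) (poly (Gid.A a' b' (2 * int l)) z, poly (Gid.A a' b' (2 * int l + 1)) z)
       = orbit F (2 * int j + 1) (inv S (int_iterate G (int l) (poly a' z, poly b' z)))"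
      by (simp add: Gid.poly_A orbit_pair del: o_id)
    also have "\<dots> = poly (inv.A a' b' (2 * int (j + l) + 1)) z"
      by (simp add: orbit_orbit inv.poly_A)
    finally show "(orbit F (2 * int j + 1) \<circ> inv S) (poly (Gid.A a' b' (2 * int l)) z, poly (Gid.A a' b' (2 * int l + 1)) z)
       = poly (inv.A a' b' (2 * int (j + l) + 1)) z" .
  qed
  ultimately have "lam' * d ^ (j + l) = w * (d ^ l / degree R2)"
    using lam'[of "j + l"] g2 by (simp add: l_def)
  then have 2: "lam' * d ^ j * degree R2 = w"
    using R2 dl d1 by (simp add: power_add field_simps)
  have "d ^ j * degree R2 * (lam * lam') = d ^ j * degree R2 * 1"
    using 1 2 by (simp add: algebra_simps)
  then show ?thesis using R2 d1 by simp
qed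

text \<open>Both \<open>lam * mu\<close> and \<open>lam' * mu'\<close> are at least
  \<open>1\<close>, while \<open>lam * lam' = mu * mu' = 1\<close>; hence all products equal
  \<open>1\<close>. On a generic line the two degrees equal to \<open>1\<close> are total
  degrees.\<close>

lemma affine_pair:
  "\<exists>j. affine_fun (h j) \<and>
       affine_fun (h (j + 1))"
proof -
  interpret inv: henon_conjugacy \<epsilon> R1 R2 Q1 Q2 "inv S" by (rule inverse)
  interpret fl: henon_conjugacy "1 / \<epsilon>" "smult (- 1 / \<epsilon>) Q2" "smult (- 1 / \<epsilon>) Q1"
    "smult (- 1 / \<epsilon>) R2" "smult (- 1 / \<epsilon>) R1" "prod.swap \<circ> S \<circ> prod.swap" by (rule flip)
  obtain w P t where t: "t \<noteq> 0" "\<And>j. w j \<ge> 1" "\<And>j. degree (A [:0, 1:] (monom t 1) j) = w j"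
    "\<And>j. w j = 1 \<Longrightarrow> affine_fun (h j)"
    using generic_curve[of 1] by auto
  obtain w' P' t' where t': "t' \<noteq> 0" "\<And>j. w' j \<ge> 1" "\<And>j. degree (inv.A [:0, 1:] (monom t' 1) j) = w' j"
    using inv.generic_curve[of 1] by auto
  define a b b' where "a = [:0, 1 :: real:]" and "b = monom t 1" and "b' = monom t' 1"
  have ab: "degree a = 1" "degree b = 1" "degree b' = 1"
    using t(1) t'(1) by (simp_all add: a_def b_def b'_def degree_monom_eq)
  obtain N lam mu where lm: "lam > 0" "mu > 0" "lam * mu \<ge> 1"
    "lam * mu = 1 \<longrightarrow> (\<exists>j. degree (A a b j) = 1 \<and> degree (A a b (j + 1)) = 1)"
    and g: "\<And>l. l \<ge> N \<Longrightarrow> degree (A a b (2 * int l)) = lam * d ^ l / degree R2 \<and> degree (A a b (2 * int l + 1)) = lam * d ^ l \<and>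
           degree (A a b (- 2 * int l)) = mu * d ^ l \<and> degree (A a b (1 - 2 * int l)) = mu * d ^ l / degree R1"
    using A_growth[of a b] t by (auto simp: a_def b_def)
  have dd: "inv.d = d" "fl.d = d"
    unfolding d_def inv.d_def fl.d_def using deg_eq eps by (simp_all add: mult.commute)
  obtain N' lam' mu' where lm': "lam' > 0" "mu' > 0" "lam' * mu' \<ge> 1"
    and g': "\<And>l. l \<ge> N' \<Longrightarrow> degree (inv.A a b' (2 * int l)) = lam' * d ^ l / degree Q2 \<and> degree (inv.A a b' (2 * int l + 1)) = lam' * d ^ l \<and>
           degree (inv.A a b' (- 2 * int l)) = mu' * d ^ l \<and> degree (inv.A a b' (1 - 2 * int l)) = mu' * d ^ l / degree Q1"
    using inv.A_growth[of a b'] t' unfolding dd by (auto simp: a_def b'_def)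
  have "lam * lam' = 1"
    using growth_rates_inverse[of a b a b' lam N N' lam'] ab lm g g' by simp
  \<comment> \<open>This is the forward statement for the flipped conjugacy; \<open>fA\<close> and
    \<open>fA'\<close> translate its sequences by \<open>j \<mapsto> 1 - j\<close>.\<close>
  moreover have "mu * mu' = 1"
  proof (rule fl.growth_rates_inverse[of b a b' a mu N N' mu'])
    have fA: "fl.A b a j = A a b (1 - j)" for j
    proof (rule curve_poly_eqI[OF fl.h_polynomial])
      show "(orbit fl.G j \<circ> (prod.swap \<circ> S \<circ> prod.swap)) (poly b z, poly a z) = poly (A a b (1 - j)) z" for z
        unfolding swap_inv_henon2_swap[OF eps, symmetric] by (simp add: poly_A orbit_swap[OF bij_G])
    qed
    have inv_sSs: "inv (prod.swap \<circ> S \<circ> prod.swap) = prod.swap \<circ> inv S \<circ> prod.swap"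
      using bij_S by (intro inv_unique_comp) (simp_all add: fun_eq_iff bij_is_inj bij_is_surj surj_f_inv_f)
    have fA': "curve_poly (orbit fl.F j \<circ> inv (prod.swap \<circ> S \<circ> prod.swap)) b' a = inv.A a b' (1 - j)" for j
    proof (rule curve_poly_eqI)
      show "real_polynomial_function (orbit fl.F j \<circ> inv (prod.swap \<circ> S \<circ> prod.swap))"
        by (rule henon_conjugacy.h_polynomial[OF fl.inverse])
      show "(orbit fl.F j \<circ> inv (prod.swap \<circ> S \<circ> prod.swap)) (poly b' z, poly a z) = poly (inv.A a b' (1 - j)) z" for z
        unfolding swap_inv_henon2_swap[OF eps, symmetric] inv_sSs by (simp add: inv.poly_A orbit_swap[OF bij_F])
    qed
    show "degree (fl.A b a (2 * int l)) = mu * fl.d ^ l / degree (smult (- 1 / \<epsilon>) R1)" if "l \<ge> N" for l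
      unfolding fA dd using g[OF that] eps by simp
    show "degree (fl.A b a (2 * int l + 1)) = mu * fl.d ^ l" if "l \<ge> N" for l
      unfolding fA dd using g[OF that] by simp
    show "degree (curve_poly (orbit fl.F (2 * int l + 1) \<circ> inv (prod.swap \<circ> S \<circ> prod.swap)) b' a) = mu' * fl.d ^ l"
      if "l \<ge> N'" for l
      unfolding fA' dd using g'[OF that] by simp
  qed (use ab lm in auto)
  ultimately have "(lam * mu) * (lam' * mu') = 1" by (simp add: algebra_simps)
  then have "lam * mu = 1"
    using lm(3) lm'(3) mult_mono[of 1 "lam' * mu'" "lam * mu" "lam * mu"] by (simp add: mult.commute)
  then obtain j where "degree (A a b j) = 1" "degree (A a b (j + 1)) = 1" using lm(4) by blast
  then have "w j = 1" "w (j + 1) = 1" using t(3) unfolding a_def b_def by metis+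
  then show ?thesis using t(4) by blast
qed

end

section \<open>Reduction to affine conjugacies\<close>

text \<open>Degrees in the first coordinate decide: a term in \<open>y\<close> in \<open>f\<close>
  would bring in \<open>Q2\<close> composed with \<open>Q1\<close>, whose degree no other term
  attains, and a term in \<open>x\<close> in \<open>g\<close> would put a nonconstant
  \<open>R1 (a2 * x + c2)\<close> against terms whose slopes cancel.\<close>

lemma affine_intertwiner:
  fixes f g :: "real \<times> real \<Rightarrow> real"
  assumes eps: "\<epsilon> \<noteq> 0"
    and degs: "degree Q1 \<ge> 2" "degree Q2 \<ge> 2" "degree R1 \<ge> 2" "degree R2 \<ge> 2"
    and deg_eq: "degree Q1 * degree Q2 = degree R1 * degree R2"
    and aff: "affine_fun f" "affine_fun g"
    and A: "A = (\<lambda>p. (f p, g p))" "bij A" "A \<circ> henon2 \<epsilon> Q1 Q2 = henon2 \<epsilon> R1 R2 \<circ> A"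
  shows "\<exists>\<alpha> \<beta> \<gamma> \<delta>. \<alpha> \<noteq> 0 \<and> \<gamma> \<noteq> 0 \<and> A = diag_affine \<alpha> \<beta> \<gamma> \<delta> \<and>
    (\<forall>y. \<alpha> * poly Q1 y + \<beta> = \<epsilon> * \<beta> + poly R1 (\<gamma> * y + \<delta>)) \<and>
    (\<forall>x. \<gamma> * poly Q2 x + \<delta> = \<epsilon> * \<delta> + poly R2 (\<alpha> * x + \<beta>))"
proof -
  obtain a1 b1 c1 where f: "\<And>x y. f (x, y) = a1 * x + b1 * y + c1"
    using aff(1) unfolding affine_fun_def by blast
  obtain a2 b2 c2 where g: "\<And>x y. g (x, y) = a2 * x + b2 * y + c2"
    using aff(2) unfolding affine_fun_def by blast
  have H: "henon2 \<epsilon> P P' (x, y) = (\<epsilon> * x + poly P y, \<epsilon> * y + poly P' (\<epsilon> * x + poly P y))" for P P' x y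
    by (simp add: henon2_def henon_def)
  have eq: "A (henon2 \<epsilon> Q1 Q2 (x, y)) = henon2 \<epsilon> R1 R2 (A (x, y))" for x y
    using fun_cong[OF A(3), of "(x, y)"] by simp
  have e1: "a1 * (\<epsilon> * x + poly Q1 y) + b1 * (\<epsilon> * y + poly Q2 (\<epsilon> * x + poly Q1 y)) + c1 =
      \<epsilon> * (a1 * x + b1 * y + c1) + poly R1 (a2 * x + b2 * y + c2)" for x y
    using eq[of x y] by (simp add: A(1) H f g)
  have b1: "b1 = 0"
  proof (rule ccontr)
    assume b1: "b1 \<noteq> 0"
    define r where "r = pcompose R1 [:c2, b2:] + [:\<epsilon> * c1 - c1:] - smult a1 Q1"
    have "poly (smult b1 (pcompose Q2 Q1)) y = poly r y" for y
      using e1[of 0 y] by (simp add: r_def poly_pcompose algebra_simps)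
    then have "smult b1 (pcompose Q2 Q1) = r"
      by (simp add: fun_eq_iff flip: poly_eq_poly_eq_iff)
    then have "degree r = degree Q2 * degree Q1"
      using b1 by (metis degree_smult_eq degree_pcompose)
    moreover have "degree r \<le> max (degree R1) (degree Q1)"
    proof -
      have "degree (pcompose R1 [:c2, b2:]) \<le> degree R1"
        using degree_pcompose[of R1 "[:c2, b2:]"] by simp
      then have "degree (pcompose R1 [:c2, b2:] + [:\<epsilon> * c1 - c1:]) \<le> degree R1"
        by (intro degree_add_le) auto
      then show ?thesis unfolding r_def
        by (intro degree_diff_le) (auto intro: le_trans[OF degree_smult_le])
    qed
    moreover have "degree Q1 < degree Q2 * degree Q1" "degree R1 < degree R2 * degree R1"
      using degs by simp_all
    moreover have "degree Q2 * degree Q1 = degree R2 * degree R1"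
      using deg_eq by (simp add: mult.commute)
    ultimately show False by linarith
  qed
  have a2: "a2 = 0"
  proof (rule ccontr)
    assume a2: "a2 \<noteq> 0"
    have "poly (pcompose R1 [:c2, a2:]) x = poly [:poly R1 c2:] x" for x
      using e1[of x 0] e1[of 0 0] b1 by (simp add: poly_pcompose algebra_simps)
    then have "pcompose R1 [:c2, a2:] = [:poly R1 c2:]"
      by (simp add: fun_eq_iff flip: poly_eq_poly_eq_iff)
    then have "degree (pcompose R1 [:c2, a2:]) = 0" by simp
    then show False using a2 degs by (simp add: degree_pcompose)
  qed
  have A': "A = diag_affine a1 c1 b2 c2"
    by (simp add: A(1) diag_affine_def fun_eq_iff f g b1 a2)
  have "inj A" using A(2) by (simp add: bij_is_inj)
  have "a1 \<noteq> 0"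
    using injD[OF \<open>inj A\<close>, of "(0, 0)" "(1, 0)"] by (auto simp: A' diag_affine_def)
  moreover have "b2 \<noteq> 0"
    using injD[OF \<open>inj A\<close>, of "(0, 0)" "(0, 1)"] by (auto simp: A' diag_affine_def)
  moreover have "a1 * poly Q1 y + c1 = \<epsilon> * c1 + poly R1 (b2 * y + c2)" for y
    using e1[of 0 y] by (simp add: b1)
  moreover have "b2 * poly Q2 x + c2 = \<epsilon> * c2 + poly R2 (a1 * x + c1)" for x
  proof -
    \<comment> \<open>The image of \<open>(u, 0)\<close> under the left-hand map has first
      coordinate \<open>x\<close>, so the argument of \<open>Q2\<close> is arbitrary.\<close>
    define u where "u = (x - poly Q1 0) / \<epsilon>"
    have u: "\<epsilon> * u + poly Q1 0 = x" using eps by (simp add: u_def)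
    have "\<epsilon> * (a1 * u + c1) + poly R1 c2 = a1 * x + c1"
      using e1[of u 0] by (simp add: b1 a2 u)
    then show ?thesis using eq[of u 0] by (simp add: A' diag_affine_def H u)
  qed
  ultimately show ?thesis using A' by blast
qed

text \<open>The two alternatives are the parities of the index in \<open>affine_pair\<close>. At an
  odd index the affine pair lies half a step beyond an iterate, and the extra step
  \<open>henon \<epsilon> R1\<close> conjugates \<open>G\<close> to the map with its two steps in
  the other order.\<close>

lemma (in henon_conjugacy) classification:
  "\<exists>k \<alpha> \<beta> \<gamma> \<delta>. \<alpha> \<noteq> 0 \<and> \<gamma> \<noteq> 0 \<and>
    (int_iterate G k \<circ> S = diag_affine \<alpha> \<beta> \<gamma> \<delta> \<and>
      (\<forall>y. \<alpha> * poly Q1 y + \<beta> = \<epsilon> * \<beta> + poly R1 (\<gamma> * y + \<delta>)) \<and>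
      (\<forall>x. \<gamma> * poly Q2 x + \<delta> = \<epsilon> * \<delta> + poly R2 (\<alpha> * x + \<beta>)) \<or>
     henon \<epsilon> R1 \<circ> int_iterate G k \<circ> S = diag_affine \<alpha> \<beta> \<gamma> \<delta> \<and>
      (\<forall>y. \<alpha> * poly Q1 y + \<beta> = \<epsilon> * \<beta> + poly R2 (\<gamma> * y + \<delta>)) \<and>
      (\<forall>x. \<gamma> * poly Q2 x + \<delta> = \<epsilon> * \<delta> + poly R1 (\<alpha> * x + \<beta>)))"
proof -
  obtain j where j: "affine_fun (h j)" "affine_fun (h (j + 1))" using affine_pair by blast
  have comm: "int_iterate G k \<circ> S \<circ> F = G \<circ> (int_iterate G k \<circ> S)" for k
    using conj int_iterate_commute[OF bij_G, of k] by (metis o_assoc)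
  show ?thesis
  proof (cases "even j")
    case True
    then obtain k where k: "j = 2 * k" by auto
    have "bij (int_iterate G k \<circ> S)" by (intro bij_comp bij_S bij_int_iterate bij_G)
    moreover have "int_iterate G k \<circ> S = (\<lambda>p. (h j p, h (j + 1) p))"
      by (simp add: fun_eq_iff k orbit_pair)
    ultimately show ?thesis
      using affine_intertwiner[OF eps degs deg_eq j _ _ comm] by meson
  next
    case False
    then obtain k where k: "j = 2 * k + 1" by (elim oddE)
    define B where "B = henon \<epsilon> R1 \<circ> int_iterate G k \<circ> S"
    have "bij B" unfolding B_def
      by (intro bij_comp bij_S bij_int_iterate bij_G poly_automorphisms_bij henon_inv(1) eps)
    moreover have "B = (\<lambda>p. (h j p, h (j + 1) p))"
    proof
      fix p
      have "int_iterate G k (S p) = (h (2 * k) p, h (2 * k + 1) p)" by (simp add: orbit_pair)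
      then show "B p = (h j p, h (j + 1) p)"
        using orbit_henon_rec[OF eps, of R1 R2 j "S p"] by (simp add: B_def k henon_def)
    qed
    moreover have "B \<circ> F = henon2 \<epsilon> R2 R1 \<circ> B"
    proof -
      have "B \<circ> F = henon \<epsilon> R1 \<circ> (int_iterate G k \<circ> S \<circ> F)" by (simp add: B_def o_assoc)
      also have "\<dots> = henon2 \<epsilon> R2 R1 \<circ> B"
        unfolding comm by (simp add: henon2_def B_def o_assoc)
      finally show ?thesis .
    qed
    moreover have "degree Q1 * degree Q2 = degree R2 * degree R1" using deg_eq by (simp add: mult.commute)
    ultimately have "\<exists>\<alpha> \<beta> \<gamma> \<delta>. \<alpha> \<noteq> 0 \<and> \<gamma> \<noteq> 0 \<and> B = diag_affine \<alpha> \<beta> \<gamma> \<delta> \<and>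
      (\<forall>y. \<alpha> * poly Q1 y + \<beta> = \<epsilon> * \<beta> + poly R2 (\<gamma> * y + \<delta>)) \<and>
      (\<forall>x. \<gamma> * poly Q2 x + \<delta> = \<epsilon> * \<delta> + poly R1 (\<alpha> * x + \<beta>))"
      by (intro affine_intertwiner[OF eps degs(1,2,4,3) _ j])
    then show ?thesis unfolding B_def by blast
  qed
qed

section \<open>Infinite order and auxiliary facts on polynomials in one variable\<close>

text \<open>On the diagonal the second coordinate of the \<open>l\<close>-th iterate has degree
  \<open>(degree R1 * degree R2) ^ l\<close>, which is \<open>1\<close> only for
  \<open>l = 0\<close>. This later shows that explicit symmetries are not powers.\<close>

lemma henon2_infinite_order:
  assumes "\<epsilon> \<noteq> 0" "degree R1 \<ge> 2" "degree R2 \<ge> 2" "int_iterate (henon2 \<epsilon> R1 R2) k = id"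
  shows "k = 0"
proof -
  let ?G = "henon2 \<epsilon> R1 R2"
  have bij: "bij ?G" using assms(1) by (intro poly_automorphisms_bij henon2_aut)
  have nat: "l = 0" if "int_iterate ?G (int l) = id" for l
  proof -
    have "curve_poly (orbit ?G (2 * int l + 1)) [:0, 1:] [:0, 1:] = [:0, 1:]"
      by (rule curve_poly_eqI) (use that in \<open>auto intro!: orbit_polynomial henon2_aut assms(1) simp: orbit_def\<close>)
    then have "(degree R1 * degree R2) ^ l = 1"
      using line_degrees(1)[OF assms(1-3), of "[:0, 1:]" "[:0, 1:]" l] by simp
    moreover have "2 * 2 \<le> degree R1 * degree R2" using assms by (intro mult_le_mono)
    ultimately show "l = 0" by (cases l) auto
  qed
  have "int_iterate ?G (- k) = id"
    using int_iterate_minus[OF bij, of k] assms(4) by simp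
  then show ?thesis using nat[of "nat k"] nat[of "nat (- k)"] assms(4) by (cases "k \<ge> 0") auto
qed

lemma poly_scale_lead:
  fixes p q :: "real poly"
  assumes "\<alpha> \<noteq> 0" "\<sigma> \<noteq> 0" "\<gamma> \<noteq> 0" "\<And>x. \<alpha> * poly p x = \<sigma> * poly q (\<gamma> * x + \<delta>)"
  shows "degree p = degree q" and "\<alpha> * lead_coeff p = \<sigma> * lead_coeff q * \<gamma> ^ degree q"
proof -
  have "poly (smult \<alpha> p) x = poly (smult \<sigma> (pcompose q [:\<delta>, \<gamma>:])) x" for x
    using assms(4)[of x] by (simp add: poly_pcompose add.commute mult.commute)
  then have e: "smult \<alpha> p = smult \<sigma> (pcompose q [:\<delta>, \<gamma>:])"
    by (simp add: fun_eq_iff flip: poly_eq_poly_eq_iff)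
  have "degree (smult \<alpha> p) = degree (smult \<sigma> (pcompose q [:\<delta>, \<gamma>:]))" by (simp only: e)
  then show "degree p = degree q" using assms by (simp add: degree_pcompose)
  have "lead_coeff (smult \<alpha> p) = lead_coeff (smult \<sigma> (pcompose q [:\<delta>, \<gamma>:]))" by (simp only: e)
  then show "\<alpha> * lead_coeff p = \<sigma> * lead_coeff q * \<gamma> ^ degree q"
    using assms unfolding lead_coeff_smult by (subst (asm) lead_coeff_comp) auto
qed

text \<open>A nonzero period would repeat the value at \<open>0\<close> at infinitely many
  points.\<close>

lemma poly_translation_invariant:
  fixes p :: "real poly"
  assumes "degree p > 0" "\<And>x. poly p (x + \<delta>) = poly p x"
  shows "\<delta> = 0"
proof (rule ccontr)
  assume d: "\<delta> \<noteq> 0"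
  have "poly p (real n * \<delta>) = poly p 0" for n
  proof (induction n)
    case (Suc n)
    then show ?case using assms(2)[of "real n * \<delta>"] by (simp add: algebra_simps)
  qed simp
  then have "range (\<lambda>n. real n * \<delta>) \<subseteq> {x. poly (p - [:poly p 0:]) x = 0}" by auto
  moreover have "infinite (range (\<lambda>n. real n * \<delta>))"
    using d by (intro range_inj_infinite) (auto simp: inj_def)
  ultimately have "p - [:poly p 0:] = 0" using poly_roots_finite finite_subset by blast
  then have "p = [:poly p 0:]" by simp
  then show False using assms(1) by (metis degree_pCons_0 less_irrefl)
qed

lemma abs_eq_1_of_power:
  fixes x :: real
  assumes "\<bar>x\<bar> = \<bar>x\<bar> ^ n" "n \<ge> 2" "x \<noteq> 0"
  shows "\<bar>x\<bar> = 1"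
proof -
  obtain m where n: "n = Suc m" "m \<ge> 1" using assms(2) by (cases n) auto
  have "\<bar>x\<bar> ^ m = 1" using assms(1,3) by (simp add: n)
  then show ?thesis using n by (metis abs_ge_zero power_eq_1_iff not_one_le_zero abs_abs real_norm_def)
qed

lemma poly_rescale_poly: "poly (rescale_poly a c d p) x = a * poly p ((x - d) / c)"
  by (simp add: rescale_poly_def poly_pcompose diff_divide_distrib)

section \<open>Symmetries of standard maps\<close>

lemma symmetries_iff:
  assumes "bij M"
  shows "S \<in> symmetries M \<longleftrightarrow> S \<in> poly_automorphisms \<and> S \<circ> M = M \<circ> S"
proof -
  have "S \<circ> M \<circ> inv S = M \<longleftrightarrow> S \<circ> M = M \<circ> S" if "bij S"
  proof
    assume "S \<circ> M \<circ> inv S = M"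
    then have "S \<circ> M \<circ> inv S \<circ> S = M \<circ> S" by simp
    then show "S \<circ> M = M \<circ> S" using that by (simp add: o_assoc[symmetric] bij_is_inj)
  next
    assume "S \<circ> M = M \<circ> S"
    then have "S (M p) = M (S p)" for p by (metis comp_apply)
    then show "S \<circ> M \<circ> inv S = M" using that by (simp add: fun_eq_iff bij_is_surj surj_f_inv_f)
  qed
  then show ?thesis unfolding symmetries_def using poly_automorphisms_bij by blast
qed

text \<open>The equation on the right contains no inverse, so explicit reversors can be verified by
  evaluating polynomial maps.\<close>

lemma reversing_symmetries_iff:
  assumes "bij M"
  shows "R \<in> reversing_symmetries M \<longleftrightarrow> R \<in> poly_automorphisms \<and> M \<circ> R \<circ> M = R"
proof -
  have "R \<circ> M \<circ> inv R = inv M \<longleftrightarrow> M \<circ> R \<circ> M = R" if "bij R"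
  proof
    assume "R \<circ> M \<circ> inv R = inv M"
    then have "R (M p) = inv M (R p)" for p
      using that by (metis bij_is_inj comp_apply inv_f_f)
    then show "M \<circ> R \<circ> M = R"
      using assms by (simp add: fun_eq_iff bij_is_surj surj_f_inv_f)
  next
    assume "M \<circ> R \<circ> M = R"
    then have "R (M p) = inv M (R p)" for p
      using assms by (metis bij_is_inj comp_apply inv_f_f)
    then show "R \<circ> M \<circ> inv R = inv M"
      using that by (simp add: fun_eq_iff bij_is_surj surj_f_inv_f)
  qed
  then show ?thesis unfolding reversing_symmetries_def using poly_automorphisms_bij by blast
qed

lemma reversing_symmetries_comp_left:
  assumes "M \<in> poly_automorphisms" "R \<in> reversing_symmetries M"
  shows "M \<circ> R \<in> reversing_symmetries M" and "R \<circ> M \<in> reversing_symmetries M"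
proof -
  have M: "bij M" by (rule poly_automorphisms_bij[OF assms(1)])
  have R: "R \<in> poly_automorphisms" "M \<circ> R \<circ> M = R" using assms(2) reversing_symmetries_iff[OF M] by auto
  have "M \<circ> (M \<circ> R) \<circ> M = M \<circ> (M \<circ> R \<circ> M)" "M \<circ> (R \<circ> M) \<circ> M = (M \<circ> R \<circ> M) \<circ> M"
    by (simp_all only: o_assoc)
  then have "M \<circ> (M \<circ> R) \<circ> M = M \<circ> R" "M \<circ> (R \<circ> M) \<circ> M = R \<circ> M"
    by (simp_all only: R(2))
  then show "M \<circ> R \<in> reversing_symmetries M" and "R \<circ> M \<in> reversing_symmetries M"
    using R(1) assms(1) by (auto simp: reversing_symmetries_iff[OF M] poly_automorphisms_comp)
qed

lemma conjugate_symmetries: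
  assumes T: "T \<in> poly_automorphisms" and M: "M \<in> poly_automorphisms" and M': "M' = T \<circ> M \<circ> inv T"
  shows "S \<in> symmetries M' \<Longrightarrow> inv T \<circ> S \<circ> T \<in> symmetries M"
    and "R \<in> reversing_symmetries M' \<Longrightarrow> inv T \<circ> R \<circ> T \<in> reversing_symmetries M"
proof -
  note [simp] = bij_is_inj[OF poly_automorphisms_bij[OF T]] surj_f_inv_f[OF bij_is_surj[OF poly_automorphisms_bij[OF T]]]
  have bM: "bij M" by (rule poly_automorphisms_bij[OF M])
  have bM': "bij M'" unfolding M'
    by (intro poly_automorphisms_bij poly_automorphisms_comp poly_automorphisms_inv T M)
  show "inv T \<circ> S \<circ> T \<in> symmetries M" if "S \<in> symmetries M'"
  proof -
    have S: "S \<in> poly_automorphisms" "S \<circ> M' = M' \<circ> S" using that symmetries_iff[OF bM'] by auto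
    have "S (T (M p)) = T (M (inv T (S (T p))))" for p
      using fun_cong[OF S(2), of "T p"] by (simp add: M')
    then have "inv T \<circ> S \<circ> T \<circ> M = M \<circ> (inv T \<circ> S \<circ> T)" by (simp add: fun_eq_iff)
    then show ?thesis
      using S(1) T by (simp add: symmetries_iff[OF bM] poly_automorphisms_comp poly_automorphisms_inv)
  qed
  show "inv T \<circ> R \<circ> T \<in> reversing_symmetries M" if "R \<in> reversing_symmetries M'"
  proof -
    have R: "R \<in> poly_automorphisms" "M' \<circ> R \<circ> M' = R" using that reversing_symmetries_iff[OF bM'] by auto
    have "T (M (inv T (R (T (M p))))) = R (T p)" for p
      using fun_cong[OF R(2), of "T p"] by (simp add: M')
    then have "inv T (T (M (inv T (R (T (M p)))))) = inv T (R (T p))" for p by simp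
    then have "M \<circ> (inv T \<circ> R \<circ> T) \<circ> M = inv T \<circ> R \<circ> T" by (simp add: fun_eq_iff)
    then show ?thesis
      using R(1) T by (simp add: reversing_symmetries_iff[OF bM] poly_automorphisms_comp poly_automorphisms_inv)
  qed
qed

lemma diag_affine_aut:
  assumes "\<alpha> * \<gamma> \<noteq> 0"
  shows "diag_affine \<alpha> \<beta> \<gamma> \<delta> \<in> poly_automorphisms"
    and "inv (diag_affine \<alpha> \<beta> \<gamma> \<delta>) = (\<lambda>(x, y). ((x - \<beta>) / \<alpha>, (y - \<delta>) / \<gamma>))"
proof -
  have "polynomial_function (\<lambda>p. (\<alpha> * fst p + \<beta>, \<gamma> * snd p + \<delta>))"
    by (intro polynomial_function_Pair real_polynomial_function_fst_snd real_polynomial_function.intros(2-4))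
  then have f: "polynomial_function (diag_affine \<alpha> \<beta> \<gamma> \<delta>)" by (simp add: diag_affine_def case_prod_unfold)
  have "polynomial_function (\<lambda>p. ((fst p - \<beta>) / \<alpha>, (snd p - \<delta>) / \<gamma>))"
    by (intro polynomial_function_Pair real_polynomial_function_fst_snd real_polynomial_function_diff
        real_polynomial_function_divide real_polynomial_function.intros(2))
  then have g: "polynomial_function (\<lambda>(x, y). ((x - \<beta>) / \<alpha>, (y - \<delta>) / \<gamma>))" by (simp add: case_prod_unfold)
  show "diag_affine \<alpha> \<beta> \<gamma> \<delta> \<in> poly_automorphisms"
    and "inv (diag_affine \<alpha> \<beta> \<gamma> \<delta>) = (\<lambda>(x, y). ((x - \<beta>) / \<alpha>, (y - \<delta>) / \<gamma>))"
    using assms by (intro poly_automorphismsI[OF f g]; auto simp: diag_affine_def)+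
qed

lemma gen_standard_map_apply:
  "gen_standard_map p1 p2 (x, y) = (x + poly p1 y, y + poly p2 (x + poly p1 y))"
  by (simp add: gen_standard_map_def Let_def)

lemma gen_standard_map_henon2: "gen_standard_map p1 p2 = henon2 1 p1 p2"
  by (simp add: fun_eq_iff gen_standard_map_apply henon2_def henon_def)

lemma gen_standard_map_aut: "gen_standard_map p1 p2 \<in> poly_automorphisms"
  by (simp add: gen_standard_map_henon2 henon2_aut)

lemma conjugate_gen_standard_map:
  assumes "\<alpha> * \<gamma> \<noteq> 0"
  shows "diag_affine \<alpha> \<beta> \<gamma> \<delta> \<circ> gen_standard_map p1 p2 \<circ> inv (diag_affine \<alpha> \<beta> \<gamma> \<delta>) =
    gen_standard_map (rescale_poly \<alpha> \<gamma> \<delta> p1) (rescale_poly \<gamma> \<alpha> \<beta> p2)"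
proof -
  have "(\<alpha> * ((x - \<beta>) / \<alpha> + u) + \<beta>) = x + \<alpha> * u" "(y - \<delta>) / \<gamma> + v = (y + \<gamma> * v - \<delta>) / \<gamma>"
    "(x - \<beta>) / \<alpha> + u = (x + \<alpha> * u - \<beta>) / \<alpha>" "\<gamma> * ((y - \<delta>) / \<gamma> + v) + \<delta> = y + \<gamma> * v" for x y u v
    using assms by (simp_all add: field_simps)
  then show ?thesis
    by (simp add: fun_eq_iff diag_affine_aut(2)[OF assms] gen_standard_map_apply poly_rescale_poly)
      (simp add: diag_affine_def)
qed

text \<open>The hypothesis is oddness about \<open>\<kappa> / 2\<close>, and \<open>d\<close> is the
  shift that moves this centre to \<open>0\<close>.\<close>

lemma odd_rescale_poly:
  assumes "\<And>y. poly p (- y + \<kappa>) = - poly p y" "c \<noteq> 0" "d = - c * \<kappa> / 2"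
  shows "odd_poly (rescale_poly a c d p)"
  unfolding odd_poly_def
proof
  fix x
  have "(- x - d) / c = - ((x - d) / c) + \<kappa>" using assms(2,3) by (simp add: field_simps)
  then show "poly (rescale_poly a c d p) (- x) = - poly (rescale_poly a c d p) x"
    using assms(1)[of "(x - d) / c"] by (simp add: poly_rescale_poly)
qed

lemma even_rescale_poly:
  assumes "\<And>y. poly p (- y + \<kappa>) = poly p y" "c \<noteq> 0" "d = - c * \<kappa> / 2"
  shows "even_poly (rescale_poly a c d p)"
  unfolding even_poly_def
proof
  fix x
  have "(- x - d) / c = - ((x - d) / c) + \<kappa>" using assms(2,3) by (simp add: field_simps)
  then show "poly (rescale_poly a c d p) (- x) = poly (rescale_poly a c d p) x"
    using assms(1)[of "(x - d) / c"] by (simp add: poly_rescale_poly)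
qed

section \<open>Functional equations linking \<open>p1\<close> and \<open>p2\<close>\<close>

lemma poly_eqI_ext: "(\<And>x. poly p x = poly q x) \<Longrightarrow> p = (q :: real poly)"
  by (simp add: fun_eq_iff flip: poly_eq_poly_eq_iff)

text \<open>A pair of equations linking each polynomial to itself: comparing leading coefficients gives
  \<open>\<bar>\<alpha>\<bar> = \<bar>\<gamma>\<bar> ^ degree p1\<close> and \<open>\<bar>\<gamma>\<bar> = \<bar>\<alpha>\<bar> ^ degree p2\<close>.\<close>

lemma self_linked_scales:
  fixes p1 p2 :: "real poly"
  assumes deg: "degree p1 \<ge> 2" "degree p2 \<ge> 2" and nz: "\<alpha> \<noteq> 0" "\<gamma> \<noteq> 0" and s: "\<sigma> = 1 \<or> \<sigma> = - 1"
    and e1: "\<And>y. \<alpha> * poly p1 y = \<sigma> * poly p1 (\<gamma> * y + \<delta>)"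
    and e2: "\<And>x. \<gamma> * poly p2 x = \<sigma> * poly p2 (\<alpha> * x + \<beta>)"
  shows "\<alpha> = \<sigma> * \<gamma> ^ degree p1" and "\<gamma> = \<sigma> * \<alpha> ^ degree p2" and "\<bar>\<alpha>\<bar> = 1" and "\<bar>\<gamma>\<bar> = 1"
proof -
  have s0: "\<sigma> \<noteq> 0" "\<bar>\<sigma>\<bar> = 1" using s by auto
  have l: "lead_coeff p1 \<noteq> 0" "lead_coeff p2 \<noteq> 0" using deg by auto
  show a: "\<alpha> = \<sigma> * \<gamma> ^ degree p1"
    using poly_scale_lead(2)[OF nz(1) s0(1) nz(2) e1] l by (simp add: mult_ac)
  show c: "\<gamma> = \<sigma> * \<alpha> ^ degree p2"
    using poly_scale_lead(2)[OF nz(2) s0(1) nz(1) e2] l by (simp add: mult_ac)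
  have aa: "\<bar>\<alpha>\<bar> = \<bar>\<gamma>\<bar> ^ degree p1" by (subst a) (simp add: abs_mult s0 power_abs)
  have cc: "\<bar>\<gamma>\<bar> = \<bar>\<alpha>\<bar> ^ degree p2" by (subst c) (simp add: abs_mult s0 power_abs)
  have "\<bar>\<alpha>\<bar> = \<bar>\<alpha>\<bar> ^ (degree p2 * degree p1)"
    unfolding power_mult cc[symmetric] by (rule aa)
  moreover have "2 \<le> degree p2 * degree p1" using mult_le_mono[OF deg(2,1)] by simp
  ultimately show 1: "\<bar>\<alpha>\<bar> = 1" by (rule abs_eq_1_of_power) (rule nz(1))
  show "\<bar>\<gamma>\<bar> = 1" using cc 1 by simp
qed

text \<open>Inserting one equation into the other gives a relation of \<open>p1\<close> to itself
  with scale \<open>\<alpha> * \<gamma>\<close>, the sign squaring to \<open>1\<close>. Leading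
  coefficients leave only the scales \<open>1\<close> and \<open>- 1\<close>; the latter is a
  reflection with \<open>\<kappa> = \<alpha> * \<delta> + \<beta>\<close>.\<close>

lemma cross_linked_scales:
  fixes p1 p2 :: "real poly"
  assumes deg: "degree p1 \<ge> 2" "degree p2 \<ge> 2" and nz: "\<alpha> \<noteq> 0" "\<gamma> \<noteq> 0" and s: "\<sigma> = 1 \<or> \<sigma> = - 1"
    and e1: "\<And>y. \<alpha> * poly p1 y = \<sigma> * poly p2 (\<gamma> * y + \<delta>)"
    and e2: "\<And>x. \<gamma> * poly p2 x = \<sigma> * poly p1 (\<alpha> * x + \<beta>)"
  shows "\<alpha> * \<gamma> = 1 \<or> \<alpha> * \<gamma> = - 1 \<and> (\<exists>\<kappa>. \<forall>y. poly p1 (- y + \<kappa>) = - poly p1 y)"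
proof -
  have s0: "\<sigma> \<noteq> 0" "\<sigma> * \<sigma> = 1" using s by auto
  have m0: "\<alpha> * \<gamma> \<noteq> 0" using nz by simp
  have e: "\<alpha> * \<gamma> * poly p1 y = 1 * poly p1 (\<alpha> * \<gamma> * y + (\<alpha> * \<delta> + \<beta>))" for y
  proof -
    have "\<alpha> * \<gamma> * poly p1 y = \<gamma> * (\<alpha> * poly p1 y)" by simp
    also have "\<dots> = \<sigma> * (\<gamma> * poly p2 (\<gamma> * y + \<delta>))" by (simp add: e1)
    also have "\<dots> = (\<sigma> * \<sigma>) * poly p1 (\<alpha> * (\<gamma> * y + \<delta>) + \<beta>)" by (simp add: e2)
    finally show ?thesis by (simp add: s0 algebra_simps)
  qed
  have "\<alpha> * \<gamma> * lead_coeff p1 = 1 * lead_coeff p1 * (\<alpha> * \<gamma>) ^ degree p1"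
    by (rule poly_scale_lead(2)[OF m0 _ m0 e]) simp
  moreover have "lead_coeff p1 \<noteq> 0" using deg by auto
  ultimately have m: "\<alpha> * \<gamma> = (\<alpha> * \<gamma>) ^ degree p1" by (simp add: mult_ac)
  then have "\<bar>\<alpha> * \<gamma>\<bar> = \<bar>\<alpha> * \<gamma>\<bar> ^ degree p1" by (metis power_abs)
  then have "\<bar>\<alpha> * \<gamma>\<bar> = 1" using deg(1) m0 by (rule abs_eq_1_of_power)
  then consider "\<alpha> * \<gamma> = 1" | "\<alpha> * \<gamma> = - 1" by linarith
  then show ?thesis
  proof cases
    case 2
    have "\<forall>y. poly p1 (- y + (\<alpha> * \<delta> + \<beta>)) = - poly p1 y" using e by (simp add: 2)
    then show ?thesis using 2 by blast
  qed simp
qed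

text \<open>Conjugation by \<open>(\<alpha> * x + \<beta> + d, y + d)\<close> makes the polynomials
  agree up to the sign \<open>m * \<sigma>\<close>; the free shift \<open>d\<close> is kept for
  centring \<open>p1\<close> where it has to be odd. With \<open>m = 1\<close> and
  \<open>m = - 1\<close>, the sign \<open>\<sigma> = 1\<close> yields S2 and S3, and
  \<open>\<sigma> = - 1\<close> yields R4 and R5.\<close>

lemma cross_linked_rescaled:
  fixes p1 p2 :: "real poly"
  assumes nz: "\<alpha> \<noteq> 0" and m: "\<alpha> * \<gamma> = m" and mm: "m = 1 \<or> m = - 1" and s: "\<sigma> = 1 \<or> \<sigma> = - 1"
    and e2: "\<And>x. \<gamma> * poly p2 x = \<sigma> * poly p1 (\<alpha> * x + \<beta>)"
  shows "rescale_poly 1 \<alpha> (\<beta> + d) p2 = smult (m * \<sigma>) (rescale_poly \<alpha> 1 d p1)"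
proof (rule poly_eqI_ext)
  fix x
  have "poly p2 u = m * \<sigma> * (\<alpha> * poly p1 (\<alpha> * u + \<beta>))" for u
  proof -
    have "poly p2 u = m * (m * poly p2 u)" using mm by auto
    also have "\<dots> = m * (\<alpha> * (\<gamma> * poly p2 u))" by (simp add: m[symmetric] mult.assoc)
    also have "\<dots> = m * \<sigma> * (\<alpha> * poly p1 (\<alpha> * u + \<beta>))" by (simp add: e2 mult_ac)
    finally show ?thesis .
  qed
  from this[of "(x - (\<beta> + d)) / \<alpha>"]
  show "poly (rescale_poly 1 \<alpha> (\<beta> + d) p2) x = poly (smult (m * \<sigma>) (rescale_poly \<alpha> 1 d p1)) x"
    using nz by (simp add: poly_rescale_poly)
qed

text \<open>An affine part linking each polynomial to itself gives S1, unless it is the identity and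
  \<open>S\<close> is a power. Cross-linking gives S2 or S3 according to the sign of
  \<open>\<alpha> * \<gamma>\<close>.\<close>

lemma gen_standard_map_symmetry_necessary:
  assumes deg: "degree p1 \<ge> 2" "degree p2 \<ge> 2"
    and sym: "S \<in> symmetries (gen_standard_map p1 p2)" and non_power: "\<And>k. S \<noteq> int_iterate (gen_standard_map p1 p2) k"
  shows "\<exists>\<alpha> \<beta> \<gamma> \<delta>. \<alpha> * \<gamma> \<noteq> 0 \<and>
    (odd_poly (rescale_poly \<alpha> \<gamma> \<delta> p1) \<and> odd_poly (rescale_poly \<gamma> \<alpha> \<beta> p2) \<or>
     rescale_poly \<gamma> \<alpha> \<beta> p2 = rescale_poly \<alpha> \<gamma> \<delta> p1 \<or>
     odd_poly (rescale_poly \<alpha> \<gamma> \<delta> p1) \<and> rescale_poly \<gamma> \<alpha> \<beta> p2 = - rescale_poly \<alpha> \<gamma> \<delta> p1)"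
    (is "\<exists>\<alpha> \<beta> \<gamma> \<delta>. ?P \<alpha> \<beta> \<gamma> \<delta>")
proof -
  define L where "L = gen_standard_map p1 p2"
  have bij: "bij L" unfolding L_def by (intro poly_automorphisms_bij gen_standard_map_aut)
  interpret henon_conjugacy 1 p1 p2 p1 p2 S
    using deg sym symmetries_iff[OF bij] by unfold_locales (auto simp: L_def gen_standard_map_henon2)
  have "\<exists>k \<alpha> \<beta> \<gamma> \<delta>. \<alpha> \<noteq> 0 \<and> \<gamma> \<noteq> 0 \<and>
     (int_iterate L k \<circ> S = diag_affine \<alpha> \<beta> \<gamma> \<delta> \<and>
      (\<forall>y. \<alpha> * poly p1 y = poly p1 (\<gamma> * y + \<delta>)) \<and> (\<forall>x. \<gamma> * poly p2 x = poly p2 (\<alpha> * x + \<beta>)) \<or>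
      (\<forall>y. \<alpha> * poly p1 y = poly p2 (\<gamma> * y + \<delta>)) \<and> (\<forall>x. \<gamma> * poly p2 x = poly p1 (\<alpha> * x + \<beta>)))"
    using classification by (simp add: L_def gen_standard_map_henon2) blast
  then obtain k \<alpha> \<beta> \<gamma> \<delta> where nz: "\<alpha> \<noteq> 0" "\<gamma> \<noteq> 0" and
    "int_iterate L k \<circ> S = diag_affine \<alpha> \<beta> \<gamma> \<delta> \<and>
      (\<forall>y. \<alpha> * poly p1 y = poly p1 (\<gamma> * y + \<delta>)) \<and> (\<forall>x. \<gamma> * poly p2 x = poly p2 (\<alpha> * x + \<beta>)) \<or>
      (\<forall>y. \<alpha> * poly p1 y = poly p2 (\<gamma> * y + \<delta>)) \<and> (\<forall>x. \<gamma> * poly p2 x = poly p1 (\<alpha> * x + \<beta>))"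
    by blast
  then consider
    (self) "int_iterate L k \<circ> S = diag_affine \<alpha> \<beta> \<gamma> \<delta>"
      "\<And>y. \<alpha> * poly p1 y = 1 * poly p1 (\<gamma> * y + \<delta>)" "\<And>x. \<gamma> * poly p2 x = 1 * poly p2 (\<alpha> * x + \<beta>)"
  | (cross) "\<And>y. \<alpha> * poly p1 y = 1 * poly p2 (\<gamma> * y + \<delta>)" "\<And>x. \<gamma> * poly p2 x = 1 * poly p1 (\<alpha> * x + \<beta>)"
    by auto
  then show ?thesis
  proof cases
    case self
    have sc: "\<alpha> = 1 * \<gamma> ^ degree p1" "\<gamma> = 1 * \<alpha> ^ degree p2" "\<bar>\<alpha>\<bar> = 1" "\<bar>\<gamma>\<bar> = 1"
      by (rule self_linked_scales[OF deg nz _ self(2,3)]; simp)+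
    \<comment> \<open>With both scales \<open>1\<close> the shifts are periods of \<open>p1\<close>
      and \<open>p2\<close>, hence zero, and \<open>S\<close> would be a power of
      \<open>L\<close>.\<close>
    have "\<alpha> \<noteq> 1"
    proof
      assume 1: "\<alpha> = 1"
      then have 2: "\<gamma> = 1" using sc(2) by simp
      have "\<delta> = 0" using deg self(2) 1 2 by (intro poly_translation_invariant[of p1]) auto
      moreover have "\<beta> = 0" using deg self(3) 1 2 by (intro poly_translation_invariant[of p2]) auto
      ultimately have "int_iterate L k \<circ> S = id"
        using self(1) 1 2 by (simp add: diag_affine_def fun_eq_iff)
      then have "int_iterate L (- k) \<circ> (int_iterate L k \<circ> S) = int_iterate L (- k)" by simp
      then have "S = int_iterate L (- k)"
        using int_iterate_add[OF bij, of "- k" k] by (simp add: o_assoc int_iterate_0)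
      then show False using non_power unfolding L_def by blast
    qed
    then have a: "\<alpha> = - 1" using sc(3) by linarith
    have "\<gamma> \<noteq> 1" using sc(1) a by auto
    then have c: "\<gamma> = - 1" using sc(4) by linarith
    have "poly p1 (- y + \<delta>) = - poly p1 y" for y using self(2)[of y] a c by simp
    then have "odd_poly (rescale_poly 1 1 (- \<delta> / 2) p1)" by (rule odd_rescale_poly) simp_all
    moreover have "poly p2 (- x + \<beta>) = - poly p2 x" for x using self(3)[of x] a c by simp
    then have "odd_poly (rescale_poly 1 1 (- \<beta> / 2) p2)" by (rule odd_rescale_poly) simp_all
    ultimately have "?P 1 (- \<beta> / 2) 1 (- \<delta> / 2)" by simp
    then show ?thesis by blast
  next
    case cross
    have "\<alpha> * \<gamma> = 1 \<or> \<alpha> * \<gamma> = - 1 \<and> (\<exists>\<kappa>. \<forall>y. poly p1 (- y + \<kappa>) = - poly p1 y)"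
      by (rule cross_linked_scales[OF deg nz _ cross]) simp
    then show ?thesis
    proof
      assume "\<alpha> * \<gamma> = 1"
      from cross_linked_rescaled[OF nz(1) this _ _ cross(2), of 0]
      have "?P \<alpha> \<beta> 1 0" using nz by simp
      then show ?thesis by blast
    next
      assume "\<alpha> * \<gamma> = - 1 \<and> (\<exists>\<kappa>. \<forall>y. poly p1 (- y + \<kappa>) = - poly p1 y)"
      then obtain \<kappa> where m: "\<alpha> * \<gamma> = - 1" and \<kappa>: "\<And>y. poly p1 (- y + \<kappa>) = - poly p1 y" by blast
      have "odd_poly (rescale_poly \<alpha> 1 (- \<kappa> / 2) p1)" by (rule odd_rescale_poly[OF \<kappa>]) simp_all
      with cross_linked_rescaled[OF nz(1) m _ _ cross(2), of "- \<kappa> / 2"]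
      have "?P \<alpha> (\<beta> + (- \<kappa> / 2)) 1 (- \<kappa> / 2)" using nz by simp
      then show ?thesis by blast
    qed
  qed
qed

text \<open>The target of the conjugacy has the polynomials \<open>- p2\<close> and
  \<open>- p1\<close>, in exchanged order. So here it is the first alternative of
  \<open>classification\<close> that cross-links \<open>p1\<close> and \<open>p2\<close>, giving R4
  and R5, while the second links each to itself.\<close>

lemma gen_standard_map_reversing_necessary:
  assumes deg: "degree p1 \<ge> 2" "degree p2 \<ge> 2"
    and R: "R \<in> reversing_symmetries (gen_standard_map p1 p2)"
  shows "\<exists>\<alpha> \<beta> \<gamma> \<delta>. \<alpha> * \<gamma> \<noteq> 0 \<and>
    (odd_poly (rescale_poly \<gamma> \<alpha> \<beta> p2) \<or> odd_poly (rescale_poly \<alpha> \<gamma> \<delta> p1) \<or>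
     even_poly (rescale_poly \<alpha> \<gamma> \<delta> p1) \<and> even_poly (rescale_poly \<gamma> \<alpha> \<beta> p2) \<or>
     rescale_poly \<gamma> \<alpha> \<beta> p2 = - rescale_poly \<alpha> \<gamma> \<delta> p1 \<or>
     odd_poly (rescale_poly \<alpha> \<gamma> \<delta> p1) \<and> rescale_poly \<gamma> \<alpha> \<beta> p2 = rescale_poly \<alpha> \<gamma> \<delta> p1)"
    (is "\<exists>\<alpha> \<beta> \<gamma> \<delta>. ?P \<alpha> \<beta> \<gamma> \<delta>")
proof -
  define L where "L = gen_standard_map p1 p2"
  have bij: "bij L" unfolding L_def by (intro poly_automorphisms_bij gen_standard_map_aut)
  have R': "R \<in> poly_automorphisms" "L \<circ> R \<circ> L = R"
    using R reversing_symmetries_iff[OF bij] by (auto simp: L_def)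
  have "R (L p) = inv L (R p)" for p
    using fun_cong[OF R'(2), of p] bij by (metis bij_is_inj comp_apply inv_f_f)
  then have "prod.swap \<circ> R \<circ> L = (prod.swap \<circ> inv L \<circ> prod.swap) \<circ> (prod.swap \<circ> R)"
    by (simp add: fun_eq_iff)
  then have "prod.swap \<circ> R \<circ> henon2 1 p1 p2 = henon2 1 (- p2) (- p1) \<circ> (prod.swap \<circ> R)"
    using swap_inv_henon2_swap[of 1 p1 p2] by (simp add: L_def gen_standard_map_henon2)
  then interpret henon_conjugacy 1 p1 p2 "- p2" "- p1" "prod.swap \<circ> R"
    using deg R'(1) swap_aut by unfold_locales (auto simp: mult.commute poly_automorphisms_comp)
  obtain k \<alpha> \<beta> \<gamma> \<delta> where nz: "\<alpha> \<noteq> 0" "\<gamma> \<noteq> 0" and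
    "(\<forall>y. \<alpha> * poly p1 y = - poly p2 (\<gamma> * y + \<delta>)) \<and> (\<forall>x. \<gamma> * poly p2 x = - poly p1 (\<alpha> * x + \<beta>)) \<or>
     (\<forall>y. \<alpha> * poly p1 y = - poly p1 (\<gamma> * y + \<delta>)) \<and> (\<forall>x. \<gamma> * poly p2 x = - poly p2 (\<alpha> * x + \<beta>))"
    using classification by auto
  then consider
    (cross) "\<And>y. \<alpha> * poly p1 y = - 1 * poly p2 (\<gamma> * y + \<delta>)" "\<And>x. \<gamma> * poly p2 x = - 1 * poly p1 (\<alpha> * x + \<beta>)"
  | (self) "\<And>y. \<alpha> * poly p1 y = - 1 * poly p1 (\<gamma> * y + \<delta>)" "\<And>x. \<gamma> * poly p2 x = - 1 * poly p2 (\<alpha> * x + \<beta>)"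
    by auto
  then show ?thesis
  proof cases
    case self
    have sc: "\<alpha> = - 1 * \<gamma> ^ degree p1" "\<gamma> = - 1 * \<alpha> ^ degree p2" "\<bar>\<alpha>\<bar> = 1" "\<bar>\<gamma>\<bar> = 1"
      by (rule self_linked_scales[OF deg nz _ self]; simp)+
    \<comment> \<open>These sign patterns are R1, R2 and R3 in this order;
      \<open>\<alpha> = \<gamma> = 1\<close> contradicts the sign in \<open>sc\<close>.\<close>
    consider "\<gamma> = 1" "\<alpha> = - 1" | "\<gamma> = - 1" "\<alpha> = 1" | "\<gamma> = - 1" "\<alpha> = - 1"
    proof -
      have "\<gamma> = 1 \<or> \<gamma> = - 1" "\<alpha> = 1 \<or> \<alpha> = - 1" using sc(3,4) by linarith+
      moreover have "\<gamma> = 1 \<Longrightarrow> \<alpha> = - 1" using sc(1) by simp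
      ultimately show ?thesis using that by blast
    qed
    then show ?thesis
    proof cases
      case 1
      have "poly p2 (- x + \<beta>) = - poly p2 x" for x using self(2)[of x] 1 by simp
      then have "odd_poly (rescale_poly 1 1 (- \<beta> / 2) p2)" by (rule odd_rescale_poly) simp_all
      then have "?P 1 (- \<beta> / 2) 1 0" by simp
      then show ?thesis by blast
    next
      case 2
      have "poly p1 (- y + \<delta>) = - poly p1 y" for y using self(1)[of y] 2 by simp
      then have "odd_poly (rescale_poly 1 1 (- \<delta> / 2) p1)" by (rule odd_rescale_poly) simp_all
      then have "?P 1 0 1 (- \<delta> / 2)" by simp
      then show ?thesis by blast
    next
      case 3
      have "poly p1 (- y + \<delta>) = poly p1 y" for y using self(1)[of y] 3 by simp
      then have "even_poly (rescale_poly 1 1 (- \<delta> / 2) p1)" by (rule even_rescale_poly) simp_all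
      moreover have "poly p2 (- x + \<beta>) = poly p2 x" for x using self(2)[of x] 3 by simp
      then have "even_poly (rescale_poly 1 1 (- \<beta> / 2) p2)" by (rule even_rescale_poly) simp_all
      ultimately have "?P 1 (- \<beta> / 2) 1 (- \<delta> / 2)" by simp
      then show ?thesis by blast
    qed
  next
    case cross
    have "\<alpha> * \<gamma> = 1 \<or> \<alpha> * \<gamma> = - 1 \<and> (\<exists>\<kappa>. \<forall>y. poly p1 (- y + \<kappa>) = - poly p1 y)"
      by (rule cross_linked_scales[OF deg nz _ cross]) simp
    then show ?thesis
    proof
      assume "\<alpha> * \<gamma> = 1"
      from cross_linked_rescaled[OF nz(1) this _ _ cross(2), of 0]
      have "?P \<alpha> \<beta> 1 0" using nz by simp
      then show ?thesis by blast
    next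
      assume "\<alpha> * \<gamma> = - 1 \<and> (\<exists>\<kappa>. \<forall>y. poly p1 (- y + \<kappa>) = - poly p1 y)"
      then obtain \<kappa> where m: "\<alpha> * \<gamma> = - 1" and \<kappa>: "\<And>y. poly p1 (- y + \<kappa>) = - poly p1 y" by blast
      have "odd_poly (rescale_poly \<alpha> 1 (- \<kappa> / 2) p1)" by (rule odd_rescale_poly[OF \<kappa>]) simp_all
      with cross_linked_rescaled[OF nz(1) m _ _ cross(2), of "- \<kappa> / 2"]
      have "?P \<alpha> (\<beta> + (- \<kappa> / 2)) 1 (- \<kappa> / 2)" using nz by simp
      then show ?thesis by blast
    qed
  qed
qed

section \<open>Standard maps with linear \<open>p1\<close>\<close>

lemma int_iterate_square:
  assumes "bij f"
  shows "int_iterate (f \<circ> f) k = int_iterate f (2 * k)"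
proof (induction k rule: int_induct[of _ 0])
  case base
  then show ?case by (simp add: int_iterate_0)
next
  case (step1 k)
  have "2 * (k + 1) = 2 * k + 1 + 1" by simp
  then show ?case
    using step1 int_iterate_Suc[OF assms] int_iterate_Suc[OF bij_comp[OF assms assms]] by (metis o_assoc)
next
  case (step2 k)
  have "2 * (k - 1) = 2 * k - 1 - 1" by simp
  moreover have "inv (f \<circ> f) = inv f \<circ> inv f" by (rule o_inv_distrib[OF assms assms])
  ultimately show ?case
    using step2 int_iterate_pred[OF assms] int_iterate_pred[OF bij_comp[OF assms assms]] by (metis o_assoc)
qed

lemma int_iterate_inj:
  assumes "bij f" "\<And>k. int_iterate f k = id \<Longrightarrow> k = 0" "int_iterate f i = int_iterate f j"
  shows "i = j"
proof -
  have "int_iterate f (i + (- j)) = int_iterate f (j + (- j))"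
    unfolding int_iterate_add[OF assms(1)] assms(3) ..
  then show ?thesis using assms(2)[of "i + (- j)"] by (simp add: int_iterate_0)
qed

text \<open>In the coordinates \<open>(x, x')\<close> a standard map with linear \<open>p1\<close> is a single Henon step.\<close>

lemma linear_shear_conjugacy:
  fixes a b :: real
  assumes "a \<noteq> 0"
  defines "K \<equiv> \<lambda>(x, y). (x, x + poly [:b, a:] y)"
  shows "K \<in> poly_automorphisms"
    and "K \<circ> gen_standard_map [:b, a:] p2 = henon (- 1) ([:0, 2:] + smult a p2) \<circ> K"
proof -
  have f: "polynomial_function K" unfolding K_def case_prod_unfold
    by (intro polynomial_function_Pair real_polynomial_function_fst_snd real_polynomial_function.intros(3)
        real_polynomial_function_poly)
  have g: "polynomial_function (\<lambda>(x, y). (x, (y - x - b) / a))" unfolding case_prod_unfold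
    by (intro polynomial_function_Pair real_polynomial_function_fst_snd real_polynomial_function_diff
        real_polynomial_function_divide real_polynomial_function.intros(2))
  show "K \<in> poly_automorphisms"
    using assms(1) by (intro poly_automorphismsI(1)[OF f g]) (auto simp: K_def field_simps)
  \<comment> \<open>With \<open>x' = x + a * y + b\<close> the next value is
    \<open>x'' = x' + a * y' + b = 2 * x' - x + a * p2 x'\<close>; this is where the summand
    \<open>[:0, 2:]\<close> and the parameter \<open>- 1\<close> come from.\<close>
  show "K \<circ> gen_standard_map [:b, a:] p2 = henon (- 1) ([:0, 2:] + smult a p2) \<circ> K"
    by (simp add: fun_eq_iff K_def gen_standard_map_apply henon_def algebra_simps)
qed

lemma linear_standard_map_infinite_order:
  assumes a: "a \<noteq> 0" and deg: "degree p2 \<ge> 2" and id: "int_iterate (gen_standard_map [:b, a:] p2) k = id"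
  shows "k = 0"
proof -
  define Q where "Q = [:0, 2:] + smult a p2"
  define M where "M = henon (- 1) Q"
  define K where "K = (\<lambda>(x, y). (x, x + poly [:b, a:] y))"
  have K: "bij K" "K \<circ> gen_standard_map [:b, a:] p2 = M \<circ> K"
    using linear_shear_conjugacy[OF a] poly_automorphisms_bij unfolding K_def M_def Q_def by auto
  have M: "bij M" unfolding M_def by (intro poly_automorphisms_bij henon_inv(1)) simp
  have "degree [:0, 2 :: real:] < degree (smult a p2)" using a deg by simp
  then have Q: "degree Q \<ge> 2" unfolding Q_def using a deg by (subst degree_add_eq_right) auto
  have "K = int_iterate M k \<circ> K"
    using int_iterate_intertwine[OF poly_automorphisms_bij[OF gen_standard_map_aut] M K(2), of k] id by simp
  then have "K \<circ> inv K = int_iterate M k \<circ> (K \<circ> inv K)" by (simp add: o_assoc)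
  moreover have "K \<circ> inv K = (id :: real \<times> real \<Rightarrow> _)" using K(1) by (simp add: bij_is_surj flip: surj_iff)
  ultimately have "int_iterate M k = id" by simp
  \<comment> \<open>The growth results concern double steps, so the exponent is doubled to pass from
    \<open>M\<close> to \<open>M \<circ> M\<close>.\<close>
  then have "int_iterate M (k + k) = id" using int_iterate_add[OF M, of k k] by simp
  then have "int_iterate (henon2 (- 1) Q Q) k = id"
    using int_iterate_square[OF M, of k] by (simp add: henon2_def M_def flip: mult_2)
  then show ?thesis using henon2_infinite_order[of "- 1" Q Q k] Q by simp
qed

text \<open>The single step \<open>M\<close> is treated through the double step
  \<open>M \<circ> M\<close>, and both alternatives of \<open>classification\<close> become powers
  of \<open>M\<close>. The affine part then commutes with \<open>M\<close> itself and not only with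
  its square, which forces \<open>\<alpha> = \<gamma>\<close> and
  \<open>\<beta> = \<delta>\<close>.\<close>

lemma linear_standard_map_symmetry_necessary:
  assumes a: "a \<noteq> 0" and deg: "degree p2 \<ge> 2"
    and sym: "T \<in> symmetries (gen_standard_map [:b, a:] p2)"
    and non_power: "\<And>k. T \<noteq> int_iterate (gen_standard_map [:b, a:] p2) k"
  shows "\<exists>\<kappa>. \<forall>x. poly p2 (- x + \<kappa>) = - poly p2 x"
proof -
  define L where "L = gen_standard_map [:b, a:] p2"
  define Q where "Q = [:0, 2:] + smult a p2"
  define M where "M = henon (- 1) Q"
  define K where "K = (\<lambda>(x, y). (x, x + poly [:b, a:] y))"
  have K: "K \<in> poly_automorphisms" "K \<circ> L = M \<circ> K"
    using linear_shear_conjugacy[OF a] unfolding K_def M_def Q_def L_def by auto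
  have bK: "bij K" by (rule poly_automorphisms_bij[OF K(1)])
  have L: "bij L" unfolding L_def by (intro poly_automorphisms_bij gen_standard_map_aut)
  have M: "bij M" unfolding M_def by (intro poly_automorphisms_bij henon_inv(1)) simp
  have KK: "inv K (K p) = p" "K (inv K p) = p" for p
    using bK by (simp_all add: bij_is_inj bij_is_surj surj_f_inv_f)
  have KL: "K (L p) = M (K p)" for p using K(2) by (metis comp_apply)
  have Qdeg: "degree Q \<ge> 2"
  proof -
    have "degree [:0, 2 :: real:] < degree (smult a p2)" using a deg by simp
    then show ?thesis unfolding Q_def using a deg by (subst degree_add_eq_right) auto
  qed
  have T: "T \<in> poly_automorphisms" "T (L p) = L (T p)" for p
  proof -
    have "T \<in> poly_automorphisms \<and> T \<circ> L = L \<circ> T"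
      using sym symmetries_iff[OF L, of T] by (simp only: L_def)
    then show "T \<in> poly_automorphisms" "T (L p) = L (T p)" by (simp, metis comp_apply)
  qed
  define S where "S = K \<circ> T \<circ> inv K"
  have SM: "S (M p) = M (S p)" for p
  proof -
    have "inv K (M p) = L (inv K p)" using KL[of "inv K p"] KK by metis
    then show ?thesis by (simp add: S_def KK T(2) KL)
  qed
  have "S \<circ> (M \<circ> M) = (M \<circ> M) \<circ> S" by (rule ext) (simp add: SM)
  then have "S \<circ> henon2 (- 1) Q Q = henon2 (- 1) Q Q \<circ> S" by (simp only: henon2_def M_def)
  moreover have "S \<in> poly_automorphisms"
    unfolding S_def by (intro poly_automorphisms_comp poly_automorphisms_inv K(1) T(1))
  ultimately interpret henon_conjugacy "- 1" Q Q Q Q S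
    using Qdeg by unfold_locales simp_all
  have MM: "int_iterate (henon2 (- 1) Q Q) k = int_iterate M (2 * k)" for k
    using int_iterate_square[OF M, of k] by (simp add: henon2_def M_def)
  have "\<exists>i \<alpha> \<beta> \<gamma> \<delta>. \<alpha> \<noteq> 0 \<and> int_iterate M i \<circ> S = diag_affine \<alpha> \<beta> \<gamma> \<delta>"
  proof -
    obtain k \<alpha> \<beta> \<gamma> \<delta> where nz: "\<alpha> \<noteq> 0" and
      "int_iterate G k \<circ> S = diag_affine \<alpha> \<beta> \<gamma> \<delta> \<or>
       henon (- 1) Q \<circ> int_iterate G k \<circ> S = diag_affine \<alpha> \<beta> \<gamma> \<delta>"
      using classification by (elim exE conjE disjE) blast+
    moreover have "henon (- 1) Q \<circ> int_iterate G k = int_iterate M (2 * k + 1)"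
      using int_iterate_Suc[OF M, of "2 * k"] by (simp add: M_def MM)
    ultimately show ?thesis unfolding MM by metis
  qed
  then obtain i \<alpha> \<beta> \<gamma> \<delta> where nz: "\<alpha> \<noteq> 0" and A: "int_iterate M i \<circ> S = diag_affine \<alpha> \<beta> \<gamma> \<delta>"
    by blast
  have comm: "diag_affine \<alpha> \<beta> \<gamma> \<delta> (M p) = M (diag_affine \<alpha> \<beta> \<gamma> \<delta> p)" for p
    unfolding A[symmetric] using int_iterate_commute[OF M, of i] by (simp add: SM) (metis comp_apply)
  have c1: "\<alpha> * y + \<beta> = \<gamma> * y + \<delta>" and c2: "\<gamma> * (poly Q y - x) + \<delta> = poly Q (\<gamma> * y + \<delta>) - (\<alpha> * x + \<beta>)" for x y
    using comm[of "(x, y)"] by (simp_all add: diag_affine_def M_def henon_def algebra_simps)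
  have bd: "\<beta> = \<delta>" "\<alpha> = \<gamma>" using c1[of 0] c1[of 1] by simp_all
  have p2: "\<alpha> * poly p2 y = 1 * poly p2 (\<alpha> * y + \<beta>)" for y
  proof -
    have "a * (\<alpha> * poly p2 y) = a * poly p2 (\<alpha> * y + \<beta>)"
      using c2[of y 0] by (simp add: bd Q_def algebra_simps)
    then show ?thesis using a by simp
  qed
  have "\<alpha> * lead_coeff p2 = 1 * lead_coeff p2 * \<alpha> ^ degree p2"
    by (rule poly_scale_lead(2)[OF nz _ nz p2]) simp
  moreover have "lead_coeff p2 \<noteq> 0" using deg by auto
  ultimately have "\<alpha> = \<alpha> ^ degree p2" by (simp add: mult_ac)
  then have "\<bar>\<alpha>\<bar> = \<bar>\<alpha>\<bar> ^ degree p2" by (metis power_abs)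
  then have "\<bar>\<alpha>\<bar> = 1" using deg nz by (rule abs_eq_1_of_power)
  \<comment> \<open>As \<open>p2\<close> has no nonzero period, the affine part would be the
    identity; then \<open>S\<close> is a power of \<open>M\<close>, and pulling back by
    \<open>K\<close> makes \<open>T\<close> the same power of \<open>L\<close>.\<close>
  moreover have "\<alpha> \<noteq> 1"
  proof
    assume 1: "\<alpha> = 1"
    then have "\<beta> = 0" using deg p2 by (intro poly_translation_invariant[of p2]) auto
    then have "int_iterate M i \<circ> S = id"
      using A 1 bd by (simp add: diag_affine_def fun_eq_iff)
    then have "int_iterate M (- i) \<circ> (int_iterate M i \<circ> S) = int_iterate M (- i)" by simp
    then have "S = int_iterate M (- i)"
      using int_iterate_add[OF M, of "- i" i] by (simp add: o_assoc int_iterate_0)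
    then have "S (K p) = int_iterate M (- i) (K p)" for p by simp
    then have "K (T p) = int_iterate M (- i) (K p)" for p by (simp add: S_def KK)
    then have "K (T p) = K (int_iterate L (- i) p)" for p
      using int_iterate_intertwine[OF L M K(2), of "- i"] by (metis comp_apply)
    then have "T = int_iterate L (- i)" using KK(1) by (metis ext)
    then show False using non_power unfolding L_def by blast
  qed
  ultimately have "\<alpha> = - 1" by linarith
  then have "poly p2 (- x + \<beta>) = - poly p2 x" for x using p2[of x] by simp
  then show ?thesis by blast
qed

section \<open>Verification of the explicit symmetries and reversors\<close>

lemmas polynomial_function_intros = polynomial_function_Pair real_polynomial_function_fst_snd
  real_polynomial_function.intros(2-4) real_polynomial_function_minus real_polynomial_function_diff
  real_polynomial_function_divide real_polynomial_function_poly

lemma polynomial_involution_aut: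
  assumes "polynomial_function f" "f \<circ> f = id"
  shows "f \<in> poly_automorphisms"
  using assms by (intro poly_automorphismsI(1)[of f f]) (simp_all add: pointfree_idE)

lemma odd_polyD: "odd_poly p \<Longrightarrow> poly p (- x) = - poly p x"
  by (simp add: odd_poly_def)

lemma even_polyD: "even_poly p \<Longrightarrow> poly p (- x) = poly p x"
  by (simp add: even_poly_def)

text \<open>Simplification distributes the minus sign over sums, so oddness must also be available
  for arguments of the form \<open>- x - y\<close>.\<close>

lemma odd_poly_minus_add: "odd_poly p \<Longrightarrow> poly p (- x - y) = - poly p (x + y)"
  using odd_polyD[of p "x + y"] by simp

lemma even_poly_minus_add: "even_poly p \<Longrightarrow> poly p (- x - y) = poly p (x + y)"
  using even_polyD[of p "x + y"] by simp

lemma symmetry_S1: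
  assumes "odd_poly P1" "odd_poly P2"
  shows "(\<lambda>(x, y). (- x, - y)) \<in> symmetries (gen_standard_map P1 P2)"
    and "(\<lambda>(x, y). (- x, - y)) \<circ> (\<lambda>(x, y). (- x, - y)) = (id :: real \<times> real \<Rightarrow> real \<times> real)"
proof -
  show i: "(\<lambda>(x, y). (- x, - y)) \<circ> (\<lambda>(x, y). (- x, - y)) = (id :: real \<times> real \<Rightarrow> real \<times> real)"
    by (simp add: fun_eq_iff)
  have "polynomial_function (\<lambda>(x :: real, y :: real). (- x, - y))"
    unfolding case_prod_unfold by (intro polynomial_function_intros)
  then show "(\<lambda>(x, y). (- x, - y)) \<in> symmetries (gen_standard_map P1 P2)"
    using assms i
    by (simp add: symmetries_iff poly_automorphisms_bij gen_standard_map_aut polynomial_involution_aut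
        fun_eq_iff gen_standard_map_apply odd_polyD odd_poly_minus_add)
qed

lemma symmetry_S2:
  shows "(\<lambda>(x, y). (y, x + poly P y)) \<in> symmetries (gen_standard_map P P)"
    and "(\<lambda>(x, y). (y, x + poly P y)) \<circ> (\<lambda>(x, y). (y, x + poly P y)) = gen_standard_map P P"
proof -
  show "(\<lambda>(x, y). (y, x + poly P y)) \<circ> (\<lambda>(x, y). (y, x + poly P y)) = gen_standard_map P P"
    by (simp add: fun_eq_iff gen_standard_map_apply)
  have "(\<lambda>(x, y). (y, x + poly P y)) \<in> poly_automorphisms"
    using henon_inv(1)[of 1 P] by (simp add: henon_def)
  then show "(\<lambda>(x, y). (y, x + poly P y)) \<in> symmetries (gen_standard_map P P)"
    by (simp add: symmetries_iff poly_automorphisms_bij gen_standard_map_aut fun_eq_iff gen_standard_map_apply)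
qed

lemma symmetry_S3:
  assumes "odd_poly P"
  shows "(\<lambda>(x, y). (y, - x - poly P y)) \<in> symmetries (gen_standard_map P (- P))"
    and "(\<lambda>(x, y). (y, - x - poly P y)) \<circ> (\<lambda>(x, y). (y, - x - poly P y)) = (\<lambda>z. - gen_standard_map P (- P) z)"
proof -
  show "(\<lambda>(x, y). (y, - x - poly P y)) \<circ> (\<lambda>(x, y). (y, - x - poly P y)) = (\<lambda>z. - gen_standard_map P (- P) z)"
    using assms by (simp add: fun_eq_iff gen_standard_map_apply odd_poly_minus_add)
  have "(\<lambda>(x, y). (y, - x - poly P y)) \<in> poly_automorphisms"
    using henon_inv(1)[of "- 1" "- P"] by (simp add: henon_def)
  then show "(\<lambda>(x, y). (y, - x - poly P y)) \<in> symmetries (gen_standard_map P (- P))"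
    using assms
    by (simp add: symmetries_iff poly_automorphisms_bij gen_standard_map_aut fun_eq_iff gen_standard_map_apply
        odd_poly_minus_add odd_polyD)
qed

lemma reversor_R1:
  fixes P1 P2 :: "real poly"
  assumes "odd_poly P2"
  defines "M \<equiv> gen_standard_map P1 P2" and "R \<equiv> \<lambda>(x, y). (- x - poly P1 y, y)"
  shows "R \<in> reversing_symmetries M" "R \<circ> R = id" "M \<circ> R \<in> reversing_symmetries M"
    "M \<circ> R = (\<lambda>(x, y). (- x, y - poly P2 x))"
proof -
  show i: "R \<circ> R = id" by (simp add: R_def fun_eq_iff)
  have "polynomial_function R"
    unfolding R_def case_prod_unfold by (intro polynomial_function_intros)
  then show r: "R \<in> reversing_symmetries M"
    using assms(1) i unfolding M_def
    by (simp add: reversing_symmetries_iff poly_automorphisms_bij gen_standard_map_aut polynomial_involution_aut)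
      (simp add: R_def fun_eq_iff gen_standard_map_apply odd_polyD odd_poly_minus_add)
  show "M \<circ> R \<in> reversing_symmetries M"
    using r unfolding M_def by (intro reversing_symmetries_comp_left gen_standard_map_aut)
  show "M \<circ> R = (\<lambda>(x, y). (- x, y - poly P2 x))"
    using assms(1) by (simp add: M_def R_def fun_eq_iff gen_standard_map_apply odd_polyD)
qed

lemma reversor_R2:
  fixes P1 P2 :: "real poly"
  assumes "odd_poly P1"
  defines "M \<equiv> gen_standard_map P1 P2" and "R \<equiv> \<lambda>(x, y). (x + poly P1 y, - y)"
  shows "R \<in> reversing_symmetries M" "R \<circ> R = id" "M \<circ> R \<in> reversing_symmetries M"
    "M \<circ> R = (\<lambda>(x, y). (x, - y + poly P2 x))"
proof -
  show i: "R \<circ> R = id" using assms(1) by (simp add: R_def fun_eq_iff odd_polyD)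
  have "polynomial_function R"
    unfolding R_def case_prod_unfold by (intro polynomial_function_intros)
  then show r: "R \<in> reversing_symmetries M"
    using assms(1) i unfolding M_def
    by (simp add: reversing_symmetries_iff poly_automorphisms_bij gen_standard_map_aut polynomial_involution_aut)
      (simp add: R_def fun_eq_iff gen_standard_map_apply odd_polyD odd_poly_minus_add)
  show "M \<circ> R \<in> reversing_symmetries M"
    using r unfolding M_def by (intro reversing_symmetries_comp_left gen_standard_map_aut)
  show "M \<circ> R = (\<lambda>(x, y). (x, - y + poly P2 x))"
    using assms(1) by (simp add: M_def R_def fun_eq_iff gen_standard_map_apply odd_polyD)
qed

lemma reversor_R3:
  fixes P1 P2 :: "real poly"
  assumes "even_poly P1" "even_poly P2"
  defines "M \<equiv> gen_standard_map P1 P2" and "R \<equiv> \<lambda>(x, y). (- x - poly P1 y, - y)"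
  shows "R \<in> reversing_symmetries M" "R \<circ> R = id" "M \<circ> R \<in> reversing_symmetries M"
    "M \<circ> R = (\<lambda>(x, y). (- x, - y + poly P2 x))"
proof -
  show i: "R \<circ> R = id" using assms(1) by (simp add: R_def fun_eq_iff even_polyD)
  have "polynomial_function R"
    unfolding R_def case_prod_unfold by (intro polynomial_function_intros)
  then show r: "R \<in> reversing_symmetries M"
    using assms(1,2) i unfolding M_def
    by (simp add: reversing_symmetries_iff poly_automorphisms_bij gen_standard_map_aut polynomial_involution_aut)
      (simp add: R_def fun_eq_iff gen_standard_map_apply even_polyD even_poly_minus_add)
  show "M \<circ> R \<in> reversing_symmetries M"
    using r unfolding M_def by (intro reversing_symmetries_comp_left gen_standard_map_aut)
  show "M \<circ> R = (\<lambda>(x, y). (- x, - y + poly P2 x))"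
    using assms(1,2) by (simp add: M_def R_def fun_eq_iff gen_standard_map_apply even_polyD)
qed

lemma reversor_R4:
  fixes P :: "real poly"
  defines "M \<equiv> gen_standard_map P (- P)" and "R \<equiv> \<lambda>(x :: real, y :: real). (y, x)"
  shows "R \<in> reversing_symmetries M" "R \<circ> R = id" "M \<circ> R \<in> reversing_symmetries M"
    "M \<circ> R = (\<lambda>(x, y). let x' = y + poly P x in (x', x - poly P x'))"
proof -
  show i: "R \<circ> R = id" by (simp add: R_def fun_eq_iff)
  have "polynomial_function R"
    unfolding R_def case_prod_unfold by (intro polynomial_function_intros)
  then show r: "R \<in> reversing_symmetries M"
    using i unfolding M_def
    by (simp add: reversing_symmetries_iff poly_automorphisms_bij gen_standard_map_aut polynomial_involution_aut)
      (simp add: R_def fun_eq_iff gen_standard_map_apply)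
  show "M \<circ> R \<in> reversing_symmetries M"
    using r unfolding M_def by (intro reversing_symmetries_comp_left gen_standard_map_aut)
  show "M \<circ> R = (\<lambda>(x, y). let x' = y + poly P x in (x', x - poly P x'))"
    by (simp add: M_def R_def fun_eq_iff gen_standard_map_apply Let_def)
qed

lemma reversor_R5:
  fixes P :: "real poly"
  assumes "odd_poly P"
  defines "M \<equiv> gen_standard_map P P" and "R \<equiv> \<lambda>(x :: real, y :: real). (y, - x)"
  shows "R \<in> reversing_symmetries M" "R ^^ 4 = id"
proof -
  have "R = henon (- 1) 0" by (simp add: R_def henon_def fun_eq_iff)
  then have "R \<in> poly_automorphisms" by (simp add: henon_inv(1))
  then show "R \<in> reversing_symmetries M"
    using assms(1) unfolding M_def
    by (simp add: reversing_symmetries_iff poly_automorphisms_bij gen_standard_map_aut)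
      (simp add: R_def fun_eq_iff gen_standard_map_apply odd_polyD odd_poly_minus_add)
  show "R ^^ 4 = id" by (simp add: R_def fun_eq_iff numeral_eq_Suc)
qed

lemma degree_rescale_poly:
  assumes "a \<noteq> 0" "c \<noteq> 0"
  shows "degree (rescale_poly a c d p) = degree p"
  using assms by (simp add: rescale_poly_def degree_pcompose)

text \<open>Powers of \<open>M\<close> have distinct exponents, so a symmetry equal to the
  \<open>k\<close>-th power would give an equation between exponents: \<open>2 * k = 0\<close> for
  S1, \<open>2 * k = 1\<close> for S2 and \<open>4 * k = 2\<close> for S3. Only the first is
  solvable, and S1 is not the identity.\<close>

lemma gen_standard_map_symmetry_sufficient:
  fixes P1 P2 :: "real poly"
  assumes deg: "degree P1 \<ge> 2" "degree P2 \<ge> 2"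
    and cond: "odd_poly P1 \<and> odd_poly P2 \<or> P2 = P1 \<or> odd_poly P1 \<and> P2 = - P1"
  shows "\<exists>S\<in>symmetries (gen_standard_map P1 P2). \<forall>k. S \<noteq> int_iterate (gen_standard_map P1 P2) k"
proof -
  define M where "M = gen_standard_map P1 P2"
  have bij: "bij M" unfolding M_def by (intro poly_automorphisms_bij gen_standard_map_aut)
  have inj: "i = j" if "int_iterate M i = int_iterate M j" for i j
    using bij _ that
  proof (rule int_iterate_inj)
    show "k = 0" if "int_iterate M k = id" for k
      using henon2_infinite_order[of 1 P1 P2 k] deg that by (simp add: M_def gen_standard_map_henon2)
  qed
  have double: "int_iterate M (k + k) = int_iterate M k \<circ> int_iterate M k" for k
    by (rule int_iterate_add[OF bij])
  have one: "int_iterate M 1 = M" using int_iterate_Suc[OF bij, of 0] by (simp add: int_iterate_0)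
  have "\<exists>S\<in>symmetries M. \<forall>k. S \<noteq> int_iterate M k"
    using cond
  proof (elim disjE conjE)
    assume "odd_poly P1" "odd_poly P2"
    note S = symmetry_S1[OF this, folded M_def]
    show ?thesis
    proof (intro bexI[OF _ S(1)] allI notI)
      fix k
      assume k: "(\<lambda>(x, y). (- x, - y)) = int_iterate M k"
      have "int_iterate M (k + k) = int_iterate M 0"
        unfolding double k[symmetric] S(2) int_iterate_0 ..
      then have "k = 0" using inj by fastforce
      then have "(\<lambda>(x, y). (- x, - y)) = (id :: real \<times> real \<Rightarrow> real \<times> real)" using k by (simp add: int_iterate_0)
      from fun_cong[OF this, of "(1, 1)"] show False by simp
    qed
  next
    assume P: "P2 = P1"
    note S = symmetry_S2[of P1, folded M_def[unfolded P]]
    show ?thesis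
    proof (intro bexI[OF _ S(1)] allI notI)
      fix k
      assume k: "(\<lambda>(x, y). (y, x + poly P1 y)) = int_iterate M k"
      have "int_iterate M (k + k) = int_iterate M 1"
        unfolding double k[symmetric] S(2) one ..
      then have "k + k = 1" by (rule inj)
      then show False by presburger
    qed
  next
    assume P: "odd_poly P1" "P2 = - P1"
    note S = symmetry_S3[OF P(1), folded M_def[unfolded P(2)]]
    \<comment> \<open>Oddness of \<open>M\<close> cancels the signs when the square of S3, which is
      minus \<open>M\<close>, is squared again.\<close>
    have neg: "M (- z) = - M z" for z
      using P by (cases z) (simp add: M_def gen_standard_map_apply odd_polyD odd_poly_minus_add)
    show ?thesis
    proof (intro bexI[OF _ S(1)] allI notI)
      fix k
      assume k: "(\<lambda>(x, y). (y, - x - poly P1 y)) = int_iterate M k"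
      have "int_iterate M (k + k) = (\<lambda>z. - M z)"
        unfolding double k[symmetric] S(2) ..
      then have "int_iterate M (k + k + (k + k)) = (\<lambda>z. - M z) \<circ> (\<lambda>z. - M z)"
        by (simp only: int_iterate_add[OF bij, of "k + k" "k + k"])
      also have "\<dots> = M \<circ> M" by (rule ext) (simp add: neg)
      also have "\<dots> = int_iterate M (1 + 1)" by (simp only: double one)
      finally have "k + k + (k + k) = 1 + 1" by (rule inj)
      then show False by presburger
    qed
  qed
  then show ?thesis unfolding M_def .
qed

lemma conjugate_nontrivial_symmetry:
  assumes T: "T \<in> poly_automorphisms" and M: "M \<in> poly_automorphisms" and M': "M' = T \<circ> M \<circ> inv T"
    and ex: "\<exists>S\<in>symmetries M'. \<forall>k. S \<noteq> int_iterate M' k"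
  shows "\<exists>S\<in>symmetries M. \<forall>k. S \<noteq> int_iterate M k"
proof -
  obtain S where S: "S \<in> symmetries M'" "\<And>k. S \<noteq> int_iterate M' k" using ex by blast
  have TT: "T (inv T p) = p" for p
    using T poly_automorphisms_bij by (metis bij_is_surj surj_f_inv_f)
  have "T \<circ> M = M' \<circ> T"
    using T poly_automorphisms_bij by (auto simp: M' fun_eq_iff bij_is_inj)
  moreover have "bij M'" unfolding M'
    by (intro poly_automorphisms_bij poly_automorphisms_comp poly_automorphisms_inv T M)
  ultimately have tw: "T \<circ> int_iterate M k = int_iterate M' k \<circ> T" for k
    using poly_automorphisms_bij[OF M] by (intro int_iterate_intertwine)
  have "inv T \<circ> S \<circ> T \<noteq> int_iterate M k" for k
  proof
    assume "inv T \<circ> S \<circ> T = int_iterate M k"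
    then have "T \<circ> (inv T \<circ> S \<circ> T) \<circ> inv T = int_iterate M' k \<circ> T \<circ> inv T" using tw by simp
    then have "S = int_iterate M' k" by (simp add: fun_eq_iff TT)
    then show False using S(2) by blast
  qed
  then show ?thesis using conjugate_symmetries(1)[OF T M M' S(1)] by blast
qed

section \<open>Reversors and normal form for linear \<open>p1\<close>\<close>

lemma linear_reversors:
  fixes P1 P2 :: "real poly"
  assumes "\<And>y. poly P1 y = y"
  defines "M \<equiv> gen_standard_map P1 P2" and "R \<equiv> \<lambda>(x, y). (x, - y + poly P2 x)"
  shows "M = (\<lambda>(x, y). let x' = x + y in (x', y + poly P2 x'))"
    "R \<in> reversing_symmetries M" "R \<circ> R = id" "R \<circ> M \<in> reversing_symmetries M"
    "R \<circ> M = (\<lambda>(x, y). (x + y, - y))"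
proof -
  show "M = (\<lambda>(x, y). let x' = x + y in (x', y + poly P2 x'))"
    by (simp add: M_def fun_eq_iff gen_standard_map_apply assms(1) Let_def)
  show i: "R \<circ> R = id" by (simp add: R_def fun_eq_iff)
  have "polynomial_function R"
    unfolding R_def case_prod_unfold by (intro polynomial_function_intros)
  then show r: "R \<in> reversing_symmetries M"
    using i unfolding M_def
    by (simp add: reversing_symmetries_iff poly_automorphisms_bij gen_standard_map_aut polynomial_involution_aut)
      (simp add: R_def fun_eq_iff gen_standard_map_apply assms(1))
  show "R \<circ> M \<in> reversing_symmetries M"
    using r unfolding M_def by (intro reversing_symmetries_comp_left gen_standard_map_aut)
  show "R \<circ> M = (\<lambda>(x, y). (x + y, - y))"
    by (simp add: M_def R_def fun_eq_iff gen_standard_map_apply assms(1))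
qed

lemma linear_odd_reversors:
  fixes P1 P2 :: "real poly"
  assumes "\<And>y. poly P1 y = y" "odd_poly P2"
  defines "M \<equiv> gen_standard_map P1 P2" and "R \<equiv> \<lambda>(x, y). (- x, y - poly P2 x)"
  shows "R \<in> reversing_symmetries M" "R \<circ> R = id" "R \<circ> M \<in> reversing_symmetries M"
    "R \<circ> M = (\<lambda>(x, y). (- x - y, y))"
proof -
  show i: "R \<circ> R = id" using assms(2) by (simp add: R_def fun_eq_iff odd_polyD)
  have "polynomial_function R"
    unfolding R_def case_prod_unfold by (intro polynomial_function_intros)
  then show r: "R \<in> reversing_symmetries M"
    using i unfolding M_def
    by (simp add: reversing_symmetries_iff poly_automorphisms_bij gen_standard_map_aut polynomial_involution_aut)
      (simp add: R_def fun_eq_iff gen_standard_map_apply assms(1) odd_polyD[OF assms(2)])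
  show "R \<circ> M \<in> reversing_symmetries M"
    using r unfolding M_def by (intro reversing_symmetries_comp_left gen_standard_map_aut)
  show "R \<circ> M = (\<lambda>(x, y). (- x - y, y))"
    by (simp add: M_def R_def fun_eq_iff gen_standard_map_apply assms(1))
qed

lemma degree_1_decompose:
  assumes "degree (p :: real poly) = 1"
  obtains a b where "p = [:b, a:]" "a \<noteq> 0"
proof -
  obtain b q where p: "p = pCons b q" by (cases p)
  with assms have "degree q = 0" "q \<noteq> 0" by (auto simp: degree_pCons_eq_if split: if_splits)
  then obtain a where "q = [:a:]" by (metis degree_eq_zeroE)
  then show ?thesis using that[of b a] p \<open>q \<noteq> 0\<close> by simp
qed

lemma normalise_linear:
  assumes "a \<noteq> 0"
  shows "poly (rescale_poly (1 / a) 1 (b / a) [:b, a:]) y = y"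
  using assms by (simp add: poly_rescale_poly field_simps)

theorem corollary1:
  fixes p1 p2 :: "real poly" and L :: "real \<times> real \<Rightarrow> real \<times> real"
    and T :: "real \<Rightarrow> real \<Rightarrow> real \<Rightarrow> real \<Rightarrow> real \<times> real \<Rightarrow> real \<times> real"
    and L' :: "real \<Rightarrow> real \<Rightarrow> real \<Rightarrow> real \<Rightarrow> real \<times> real \<Rightarrow> real \<times> real"
    and q1 q2 :: "real \<Rightarrow> real \<Rightarrow> real \<Rightarrow> real \<Rightarrow> real poly"
  assumes L: "L = gen_standard_map p1 p2" and L_aut: "L \<in> poly_automorphisms"
    and T: "\<And>\<alpha> \<beta> \<gamma> \<delta>. T \<alpha> \<beta> \<gamma> \<delta> = diag_affine \<alpha> \<beta> \<gamma> \<delta>"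
    and L': "\<And>\<alpha> \<beta> \<gamma> \<delta>. L' \<alpha> \<beta> \<gamma> \<delta> = T \<alpha> \<beta> \<gamma> \<delta> \<circ> L \<circ> inv (T \<alpha> \<beta> \<gamma> \<delta>)"
    and q1: "\<And>\<alpha> \<beta> \<gamma> \<delta>. q1 \<alpha> \<beta> \<gamma> \<delta> = rescale_poly \<alpha> \<gamma> \<delta> p1"
    and q2: "\<And>\<alpha> \<beta> \<gamma> \<delta>. q2 \<alpha> \<beta> \<gamma> \<delta> = rescale_poly \<gamma> \<alpha> \<beta> p2"
  shows
    "\<comment> \<open>conjugation by \<open>T\<close>\<close>
     (\<forall>\<alpha> \<beta> \<gamma> \<delta>. \<alpha> * \<gamma> \<noteq> 0 \<longrightarrow>
        L' \<alpha> \<beta> \<gamma> \<delta> = gen_standard_map (q1 \<alpha> \<beta> \<gamma> \<delta>) (q2 \<alpha> \<beta> \<gamma> \<delta>) \<and>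
        (\<forall>y. poly (q1 \<alpha> \<beta> \<gamma> \<delta>) y = \<alpha> * poly p1 ((y - \<delta>) / \<gamma>)) \<and>
        (\<forall>x. poly (q2 \<alpha> \<beta> \<gamma> \<delta>) x = \<gamma> * poly p2 ((x - \<beta>) / \<alpha>)))
   \<and>
     \<comment> \<open>(A)\<close>
     (degree p1 \<ge> 2 \<and> degree p2 \<ge> 2 \<longrightarrow>
        \<comment> \<open>(A1)\<close>
        ((\<exists>S \<in> symmetries L. \<forall>k. S \<noteq> int_iterate L k) \<longleftrightarrow>
         (\<exists>\<alpha> \<beta> \<gamma> \<delta>. \<alpha> * \<gamma> \<noteq> 0 \<and>
            (let P1 = q1 \<alpha> \<beta> \<gamma> \<delta>; P2 = q2 \<alpha> \<beta> \<gamma> \<delta> in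
               odd_poly P1 \<and> odd_poly P2
             \<or> P2 = P1
             \<or> odd_poly P1 \<and> P2 = - P1)))
      \<and> (\<forall>\<alpha> \<beta> \<gamma> \<delta>. \<alpha> * \<gamma> \<noteq> 0 \<longrightarrow>
          (let P1 = q1 \<alpha> \<beta> \<gamma> \<delta>; P2 = q2 \<alpha> \<beta> \<gamma> \<delta>; M = L' \<alpha> \<beta> \<gamma> \<delta>;
               S1 = (\<lambda>(x, y). (- x, - y));
               S2 = (\<lambda>(x, y). (y, x + poly P1 y));
               S3 = (\<lambda>(x, y). (y, - x - poly P1 y))
           in
             (odd_poly P1 \<and> odd_poly P2 \<longrightarrow> S1 \<in> symmetries M \<and> S1 \<circ> S1 = id)
           \<and> (P2 = P1 \<longrightarrow> S2 \<in> symmetries M \<and> S2 \<circ> S2 = M)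
           \<and> (odd_poly P1 \<and> P2 = - P1 \<longrightarrow>
                S3 \<in> symmetries M \<and> S3 \<circ> S3 = (\<lambda>z. - M z))))
        \<comment> \<open>(A2)\<close>
      \<and> ((\<exists>R. R \<in> reversing_symmetries L) \<longleftrightarrow>
         (\<exists>\<alpha> \<beta> \<gamma> \<delta>. \<alpha> * \<gamma> \<noteq> 0 \<and>
            (let P1 = q1 \<alpha> \<beta> \<gamma> \<delta>; P2 = q2 \<alpha> \<beta> \<gamma> \<delta> in
               odd_poly P2
             \<or> odd_poly P1
             \<or> even_poly P1 \<and> even_poly P2
             \<or> P2 = - P1
             \<or> odd_poly P1 \<and> P2 = P1)))
      \<and> (\<forall>\<alpha> \<beta> \<gamma> \<delta>. \<alpha> * \<gamma> \<noteq> 0 \<longrightarrow>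
          (let P1 = q1 \<alpha> \<beta> \<gamma> \<delta>; P2 = q2 \<alpha> \<beta> \<gamma> \<delta>; M = L' \<alpha> \<beta> \<gamma> \<delta>;
               R1 = (\<lambda>(x, y). (- x - poly P1 y, y));
               R2 = (\<lambda>(x, y). (x + poly P1 y, - y));
               R3 = (\<lambda>(x, y). (- x - poly P1 y, - y));
               R4 = (\<lambda>(x, y). (y, x));
               R5 = (\<lambda>(x, y). (y, - x))
           in
             (odd_poly P2 \<longrightarrow>
                R1 \<in> reversing_symmetries M \<and> R1 \<circ> R1 = id \<and>
                M \<circ> R1 \<in> reversing_symmetries M \<and>
                M \<circ> R1 = (\<lambda>(x, y). (- x, y - poly P2 x)))
           \<and> (odd_poly P1 \<longrightarrow>
                R2 \<in> reversing_symmetries M \<and> R2 \<circ> R2 = id \<and>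
                M \<circ> R2 \<in> reversing_symmetries M \<and>
                M \<circ> R2 = (\<lambda>(x, y). (x, - y + poly P2 x)))
           \<and> (even_poly P1 \<and> even_poly P2 \<longrightarrow>
                R3 \<in> reversing_symmetries M \<and> R3 \<circ> R3 = id \<and>
                M \<circ> R3 \<in> reversing_symmetries M \<and>
                M \<circ> R3 = (\<lambda>(x, y). (- x, - y + poly P2 x)))
           \<and> (P2 = - P1 \<longrightarrow>
                R4 \<in> reversing_symmetries M \<and> R4 \<circ> R4 = id \<and>
                M \<circ> R4 \<in> reversing_symmetries M \<and>
                M \<circ> R4 = (\<lambda>(x, y). let x' = y + poly P1 x in (x', x - poly P1 x')))
           \<and> (odd_poly P1 \<and> P2 = P1 \<longrightarrow>
                R5 \<in> reversing_symmetries M \<and> R5 ^^ 4 = id))))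
   \<and>
     \<comment> \<open>(B)\<close>
     (degree p1 = 1 \<and> degree p2 \<ge> 2 \<longrightarrow>
        \<comment> \<open>(B1)\<close>
        ((\<exists>S \<in> symmetries L. \<forall>k. S \<noteq> int_iterate L k) \<longleftrightarrow>
         (\<exists>\<alpha> \<beta> \<gamma> \<delta>. \<alpha> * \<gamma> \<noteq> 0 \<and>
            (\<forall>y. poly (q1 \<alpha> \<beta> \<gamma> \<delta>) y = y) \<and> odd_poly (q2 \<alpha> \<beta> \<gamma> \<delta>)))
      \<and> (\<forall>\<alpha> \<beta> \<gamma> \<delta>. \<alpha> * \<gamma> \<noteq> 0 \<and>
            (\<forall>y. poly (q1 \<alpha> \<beta> \<gamma> \<delta>) y = y) \<and> odd_poly (q2 \<alpha> \<beta> \<gamma> \<delta>) \<longrightarrow>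
          (\<lambda>(x, y). (- x, - y)) \<in> symmetries (L' \<alpha> \<beta> \<gamma> \<delta>))
        \<comment> \<open>(B2)\<close>
      \<and> (\<exists>R. R \<in> reversing_symmetries L)
      \<and> (\<exists>\<alpha> \<beta> \<gamma> \<delta>. \<alpha> * \<gamma> \<noteq> 0 \<and> (\<forall>y. poly (q1 \<alpha> \<beta> \<gamma> \<delta>) y = y))
      \<and> (\<forall>\<alpha> \<beta> \<gamma> \<delta>. \<alpha> * \<gamma> \<noteq> 0 \<and> (\<forall>y. poly (q1 \<alpha> \<beta> \<gamma> \<delta>) y = y) \<longrightarrow>
          (let P2 = q2 \<alpha> \<beta> \<gamma> \<delta>; M = L' \<alpha> \<beta> \<gamma> \<delta>;
               R1 = (\<lambda>(x, y). (- x, y - poly P2 x));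
               R2 = (\<lambda>(x, y). (x, - y + poly P2 x))
           in
             M = (\<lambda>(x, y). let x' = x + y in (x', y + poly P2 x'))
           \<and> R2 \<in> reversing_symmetries M \<and> R2 \<circ> R2 = id
           \<and> R2 \<circ> M \<in> reversing_symmetries M \<and> R2 \<circ> M = (\<lambda>(x, y). (x + y, - y))
           \<and> (odd_poly P2 \<longrightarrow>
                R1 \<in> reversing_symmetries M \<and> R1 \<circ> R1 = id \<and>
                R1 \<circ> M \<in> reversing_symmetries M \<and>
                R1 \<circ> M = (\<lambda>(x, y). (- x - y, y))))))"
proof -
  let ?T = "\<lambda>\<alpha> \<beta> \<gamma> \<delta>. diag_affine \<alpha> \<beta> \<gamma> \<delta>"
  have L'_eq: "L' \<alpha> \<beta> \<gamma> \<delta> = gen_standard_map (q1 \<alpha> \<beta> \<gamma> \<delta>) (q2 \<alpha> \<beta> \<gamma> \<delta>)" if "\<alpha> * \<gamma> \<noteq> 0" for \<alpha> \<beta> \<gamma> \<delta>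
    unfolding L' T L q1 q2 by (rule conjugate_gen_standard_map[OF that])
  note T_aut = diag_affine_aut(1)
  have L'_T: "L' \<alpha> \<beta> \<gamma> \<delta> = ?T \<alpha> \<beta> \<gamma> \<delta> \<circ> L \<circ> inv (?T \<alpha> \<beta> \<gamma> \<delta>)" for \<alpha> \<beta> \<gamma> \<delta>
    by (simp only: L' T)
  have reversing_transfer: "\<exists>R. R \<in> reversing_symmetries L"
    if "\<alpha> * \<gamma> \<noteq> 0" "R \<in> reversing_symmetries (L' \<alpha> \<beta> \<gamma> \<delta>)" for \<alpha> \<beta> \<gamma> \<delta> R
    using conjugate_symmetries(2)[OF T_aut[OF that(1)] L_aut L'_T that(2)] by blast
  have q_poly: "poly (q1 \<alpha> \<beta> \<gamma> \<delta>) y = \<alpha> * poly p1 ((y - \<delta>) / \<gamma>)"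
    "poly (q2 \<alpha> \<beta> \<gamma> \<delta>) y = \<gamma> * poly p2 ((y - \<beta>) / \<alpha>)" for \<alpha> \<beta> \<gamma> \<delta> y
    by (simp_all add: q1 q2 poly_rescale_poly)
  have A1: "(\<exists>S \<in> symmetries L. \<forall>k. S \<noteq> int_iterate L k) \<longleftrightarrow>
         (\<exists>\<alpha> \<beta> \<gamma> \<delta>. \<alpha> * \<gamma> \<noteq> 0 \<and>
            (let P1 = q1 \<alpha> \<beta> \<gamma> \<delta>; P2 = q2 \<alpha> \<beta> \<gamma> \<delta> in
               odd_poly P1 \<and> odd_poly P2 \<or> P2 = P1 \<or> odd_poly P1 \<and> P2 = - P1))"
    if deg: "degree p1 \<ge> 2" "degree p2 \<ge> 2"
    unfolding Let_def
  proof
    assume "\<exists>S \<in> symmetries L. \<forall>k. S \<noteq> int_iterate L k"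
    then obtain S where "S \<in> symmetries L" "\<And>k. S \<noteq> int_iterate L k" by blast
    from gen_standard_map_symmetry_necessary[OF deg this[unfolded L]]
    show "\<exists>\<alpha> \<beta> \<gamma> \<delta>. \<alpha> * \<gamma> \<noteq> 0 \<and> (odd_poly (q1 \<alpha> \<beta> \<gamma> \<delta>) \<and> odd_poly (q2 \<alpha> \<beta> \<gamma> \<delta>) \<or>
      q2 \<alpha> \<beta> \<gamma> \<delta> = q1 \<alpha> \<beta> \<gamma> \<delta> \<or> odd_poly (q1 \<alpha> \<beta> \<gamma> \<delta>) \<and> q2 \<alpha> \<beta> \<gamma> \<delta> = - q1 \<alpha> \<beta> \<gamma> \<delta>)"
      by (simp only: q1 q2)
  next
    assume "\<exists>\<alpha> \<beta> \<gamma> \<delta>. \<alpha> * \<gamma> \<noteq> 0 \<and> (odd_poly (q1 \<alpha> \<beta> \<gamma> \<delta>) \<and> odd_poly (q2 \<alpha> \<beta> \<gamma> \<delta>) \<or>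
      q2 \<alpha> \<beta> \<gamma> \<delta> = q1 \<alpha> \<beta> \<gamma> \<delta> \<or> odd_poly (q1 \<alpha> \<beta> \<gamma> \<delta>) \<and> q2 \<alpha> \<beta> \<gamma> \<delta> = - q1 \<alpha> \<beta> \<gamma> \<delta>)"
    then obtain \<alpha> \<beta> \<gamma> \<delta> where nz: "\<alpha> * \<gamma> \<noteq> 0" and c: "odd_poly (q1 \<alpha> \<beta> \<gamma> \<delta>) \<and> odd_poly (q2 \<alpha> \<beta> \<gamma> \<delta>) \<or>
      q2 \<alpha> \<beta> \<gamma> \<delta> = q1 \<alpha> \<beta> \<gamma> \<delta> \<or> odd_poly (q1 \<alpha> \<beta> \<gamma> \<delta>) \<and> q2 \<alpha> \<beta> \<gamma> \<delta> = - q1 \<alpha> \<beta> \<gamma> \<delta>"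
      by blast
    have "degree (q1 \<alpha> \<beta> \<gamma> \<delta>) \<ge> 2" "degree (q2 \<alpha> \<beta> \<gamma> \<delta>) \<ge> 2"
      using nz deg by (simp_all add: q1 q2 degree_rescale_poly)
    from gen_standard_map_symmetry_sufficient[OF this c, folded L'_eq[OF nz]]
    show "\<exists>S \<in> symmetries L. \<forall>k. S \<noteq> int_iterate L k"
      by (rule conjugate_nontrivial_symmetry[OF T_aut[OF nz] L_aut L'_T])
  qed
  have A2: "(\<exists>R. R \<in> reversing_symmetries L) \<longleftrightarrow>
         (\<exists>\<alpha> \<beta> \<gamma> \<delta>. \<alpha> * \<gamma> \<noteq> 0 \<and>
            (let P1 = q1 \<alpha> \<beta> \<gamma> \<delta>; P2 = q2 \<alpha> \<beta> \<gamma> \<delta> in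
               odd_poly P2 \<or> odd_poly P1 \<or> even_poly P1 \<and> even_poly P2 \<or> P2 = - P1 \<or>
               odd_poly P1 \<and> P2 = P1))"
    if deg: "degree p1 \<ge> 2" "degree p2 \<ge> 2"
    unfolding Let_def
  proof
    assume "\<exists>R. R \<in> reversing_symmetries L"
    then obtain R where "R \<in> reversing_symmetries L" by blast
    from gen_standard_map_reversing_necessary[OF deg this[unfolded L]]
    show "\<exists>\<alpha> \<beta> \<gamma> \<delta>. \<alpha> * \<gamma> \<noteq> 0 \<and> (odd_poly (q2 \<alpha> \<beta> \<gamma> \<delta>) \<or> odd_poly (q1 \<alpha> \<beta> \<gamma> \<delta>) \<or>
      even_poly (q1 \<alpha> \<beta> \<gamma> \<delta>) \<and> even_poly (q2 \<alpha> \<beta> \<gamma> \<delta>) \<or> q2 \<alpha> \<beta> \<gamma> \<delta> = - q1 \<alpha> \<beta> \<gamma> \<delta> \<or>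
      odd_poly (q1 \<alpha> \<beta> \<gamma> \<delta>) \<and> q2 \<alpha> \<beta> \<gamma> \<delta> = q1 \<alpha> \<beta> \<gamma> \<delta>)"
      by (simp only: q1 q2)
  next
    assume "\<exists>\<alpha> \<beta> \<gamma> \<delta>. \<alpha> * \<gamma> \<noteq> 0 \<and> (odd_poly (q2 \<alpha> \<beta> \<gamma> \<delta>) \<or> odd_poly (q1 \<alpha> \<beta> \<gamma> \<delta>) \<or>
      even_poly (q1 \<alpha> \<beta> \<gamma> \<delta>) \<and> even_poly (q2 \<alpha> \<beta> \<gamma> \<delta>) \<or> q2 \<alpha> \<beta> \<gamma> \<delta> = - q1 \<alpha> \<beta> \<gamma> \<delta> \<or>
      odd_poly (q1 \<alpha> \<beta> \<gamma> \<delta>) \<and> q2 \<alpha> \<beta> \<gamma> \<delta> = q1 \<alpha> \<beta> \<gamma> \<delta>)"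
    \<comment> \<open>R5 needs no case of its own for existence: its condition includes that of
      R2.\<close>
    then obtain \<alpha> \<beta> \<gamma> \<delta> where nz: "\<alpha> * \<gamma> \<noteq> 0" and c: "odd_poly (q2 \<alpha> \<beta> \<gamma> \<delta>) \<or> odd_poly (q1 \<alpha> \<beta> \<gamma> \<delta>) \<or>
      even_poly (q1 \<alpha> \<beta> \<gamma> \<delta>) \<and> even_poly (q2 \<alpha> \<beta> \<gamma> \<delta>) \<or> q2 \<alpha> \<beta> \<gamma> \<delta> = - q1 \<alpha> \<beta> \<gamma> \<delta>"
      by blast
    from c have "\<exists>R. R \<in> reversing_symmetries (L' \<alpha> \<beta> \<gamma> \<delta>)"
      unfolding L'_eq[OF nz]
    proof (elim disjE conjE)
      assume "q2 \<alpha> \<beta> \<gamma> \<delta> = - q1 \<alpha> \<beta> \<gamma> \<delta>"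
      then show "\<exists>R. R \<in> reversing_symmetries (gen_standard_map (q1 \<alpha> \<beta> \<gamma> \<delta>) (q2 \<alpha> \<beta> \<gamma> \<delta>))"
        by (simp only:) (rule exI, rule reversor_R4(1))
    qed (rule exI, (rule reversor_R1(1) reversor_R2(1) reversor_R3(1); assumption))+
    then show "\<exists>R. R \<in> reversing_symmetries L" using reversing_transfer[OF nz] by blast
  qed
  have B1: "(\<exists>S \<in> symmetries L. \<forall>k. S \<noteq> int_iterate L k) \<longleftrightarrow>
         (\<exists>\<alpha> \<beta> \<gamma> \<delta>. \<alpha> * \<gamma> \<noteq> 0 \<and>
            (\<forall>y. poly (q1 \<alpha> \<beta> \<gamma> \<delta>) y = y) \<and> odd_poly (q2 \<alpha> \<beta> \<gamma> \<delta>))"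
    if deg: "degree p1 = 1" "degree p2 \<ge> 2"
  proof
    obtain a b where p1: "p1 = [:b, a:]" "a \<noteq> 0" using degree_1_decompose[OF deg(1)] .
    assume "\<exists>S \<in> symmetries L. \<forall>k. S \<noteq> int_iterate L k"
    then obtain S where "S \<in> symmetries L" "\<And>k. S \<noteq> int_iterate L k" by blast
    from linear_standard_map_symmetry_necessary[OF p1(2) deg(2) this[unfolded L p1(1)]]
    obtain \<kappa> where \<kappa>: "\<And>x. poly p2 (- x + \<kappa>) = - poly p2 x" by blast
    \<comment> \<open>Scaling by \<open>1 / a\<close> and shifting by \<open>b / a\<close> turn
      \<open>p1\<close> into the identity; the shift of \<open>x\<close> remains free and moves the
      centre \<open>\<kappa> / 2\<close> of \<open>p2\<close> to \<open>0\<close>.\<close>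
    have "odd_poly (q2 (1 / a) (- (1 / a) * \<kappa> / 2) 1 (b / a))"
      unfolding q2 by (rule odd_rescale_poly[OF \<kappa>]) (use p1(2) in simp_all)
    then show "\<exists>\<alpha> \<beta> \<gamma> \<delta>. \<alpha> * \<gamma> \<noteq> 0 \<and> (\<forall>y. poly (q1 \<alpha> \<beta> \<gamma> \<delta>) y = y) \<and> odd_poly (q2 \<alpha> \<beta> \<gamma> \<delta>)"
      using normalise_linear[OF p1(2), of b] p1
      by (intro exI[of _ "1 / a"] exI[of _ "- (1 / a) * \<kappa> / 2"] exI[of _ 1] exI[of _ "b / a"]) (simp add: q1)
  next
    assume "\<exists>\<alpha> \<beta> \<gamma> \<delta>. \<alpha> * \<gamma> \<noteq> 0 \<and> (\<forall>y. poly (q1 \<alpha> \<beta> \<gamma> \<delta>) y = y) \<and> odd_poly (q2 \<alpha> \<beta> \<gamma> \<delta>)"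
    then obtain \<alpha> \<beta> \<gamma> \<delta> where nz: "\<alpha> * \<gamma> \<noteq> 0" and id: "\<And>y. poly (q1 \<alpha> \<beta> \<gamma> \<delta>) y = y"
      and odd: "odd_poly (q2 \<alpha> \<beta> \<gamma> \<delta>)" by blast
    define M where "M = L' \<alpha> \<beta> \<gamma> \<delta>"
    have q1': "q1 \<alpha> \<beta> \<gamma> \<delta> = [:0, 1:]" by (rule poly_eqI_ext) (simp add: id)
    have M: "M = gen_standard_map [:0, 1:] (q2 \<alpha> \<beta> \<gamma> \<delta>)" unfolding M_def L'_eq[OF nz] q1' ..
    have bij: "bij M" unfolding M by (intro poly_automorphisms_bij gen_standard_map_aut)
    have deg2: "degree (q2 \<alpha> \<beta> \<gamma> \<delta>) \<ge> 2" using nz deg by (simp add: q2 degree_rescale_poly)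
    have S: "(\<lambda>(x, y). (- x, - y)) \<in> symmetries M"
      unfolding M using symmetry_S1(1)[of "[:0, 1:]"] odd by (simp add: odd_poly_def)
    have "(\<lambda>(x, y). (- x, - y)) \<noteq> int_iterate M k" for k
    proof
      assume k: "(\<lambda>(x, y). (- x, - y)) = int_iterate M k"
      have "int_iterate M (k + k) = (\<lambda>(x, y). (- x, - y)) \<circ> (\<lambda>(x, y). (- x, - y))"
        unfolding int_iterate_add[OF bij] k ..
      also have "\<dots> = id" by (simp add: fun_eq_iff)
      finally have "k + k = 0"
        unfolding M by (intro linear_standard_map_infinite_order[OF _ deg2, of 1 0]) simp_all
      then have "(\<lambda>(x, y). (- x, - y)) = (id :: real \<times> real \<Rightarrow> real \<times> real)"
        using k by (simp add: int_iterate_0)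
      from fun_cong[OF this, of "(1, 1)"] show False by simp
    qed
    then have "\<exists>S\<in>symmetries M. \<forall>k. S \<noteq> int_iterate M k" using S by blast
    then show "\<exists>S \<in> symmetries L. \<forall>k. S \<noteq> int_iterate L k"
      unfolding M_def by (rule conjugate_nontrivial_symmetry[OF T_aut[OF nz] L_aut L'_T])
  qed
  have normal_form: "\<exists>\<alpha> \<beta> \<gamma> \<delta>. \<alpha> * \<gamma> \<noteq> 0 \<and> (\<forall>y. poly (q1 \<alpha> \<beta> \<gamma> \<delta>) y = y)" if deg: "degree p1 = 1"
  proof -
    obtain a b where p1: "p1 = [:b, a:]" "a \<noteq> 0" using degree_1_decompose[OF deg] .
    then show ?thesis using normalise_linear[OF p1(2), of b]
      by (intro exI[of _ "1 / a"] exI[of _ 0] exI[of _ 1] exI[of _ "b / a"]) (simp add: q1)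
  qed
  have B2: "\<exists>R. R \<in> reversing_symmetries L" if deg: "degree p1 = 1"
  proof -
    obtain \<alpha> \<beta> \<gamma> \<delta> where nz: "\<alpha> * \<gamma> \<noteq> 0" and id: "\<And>y. poly (q1 \<alpha> \<beta> \<gamma> \<delta>) y = y"
      using normal_form[OF deg] by blast
    show ?thesis
      using reversing_transfer[OF nz] linear_reversors(2)[OF id] unfolding L'_eq[OF nz] by blast
  qed
  show ?thesis
    apply (intro conjI impI)
    subgoal by (intro allI impI conjI L'_eq q_poly)
    subgoal by (elim conjE) (rule A1)
    subgoal
      unfolding Let_def
      \<comment> \<open>The hypothesis on \<open>\<alpha> * \<gamma>\<close> discharges the side
        condition of \<open>L'_eq\<close>, and an equation between the two polynomials serves as a
        rewrite rule at the same time, so that the goals take the form of the lemmas below.\<close>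
      apply (intro allI impI conjI; elim conjE; (simp only: L'_eq not_False_eq_True)?)
      subgoal by (rule symmetry_S1; assumption)
      subgoal by (rule symmetry_S1; assumption)
      subgoal by (rule symmetry_S2; assumption)
      subgoal by (rule symmetry_S2; assumption)
      subgoal by (rule symmetry_S3; assumption)
      subgoal by (rule symmetry_S3; assumption)
      done
    subgoal by (elim conjE) (rule A2)
    subgoal
      unfolding Let_def
      apply (intro allI impI conjI; elim conjE; (simp only: L'_eq not_False_eq_True)?)
      subgoal by (rule reversor_R1; assumption)
      subgoal by (rule reversor_R1; assumption)
      subgoal by (rule reversor_R1; assumption)
      subgoal by (rule reversor_R1; assumption)
      subgoal by (rule reversor_R2; assumption)
      subgoal by (rule reversor_R2; assumption)
      subgoal by (rule reversor_R2; assumption)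
      subgoal by (rule reversor_R2; assumption)
      subgoal by (rule reversor_R3; assumption)
      subgoal by (rule reversor_R3; assumption)
      subgoal by (rule reversor_R3; assumption)
      subgoal by (rule reversor_R3; assumption)
      subgoal by (rule reversor_R4; assumption)
      subgoal by (rule reversor_R4; assumption)
      subgoal by (rule reversor_R4; assumption)
      subgoal by (rule reversor_R4[unfolded Let_def])
      subgoal by (rule reversor_R5; assumption)
      subgoal by (rule reversor_R5; assumption)
      done
    subgoal by (elim conjE) (rule B1)
    subgoal
      apply (intro allI impI; elim conjE; (simp only: L'_eq not_False_eq_True)?)
      subgoal by (rule symmetry_S1(1)) (simp_all add: odd_poly_def)
      done
    subgoal by (elim conjE) (rule B2)
    subgoal by (elim conjE) (rule normal_form)
    subgoal
      unfolding Let_def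
      apply (intro allI impI conjI; elim conjE; (simp only: L'_eq not_False_eq_True)?)
      subgoal by (rule linear_reversors(1)[unfolded Let_def]) blast
      subgoal by (rule linear_reversors(2)) blast
      subgoal by (rule linear_reversors(3)) blast
      subgoal by (rule linear_reversors(4)) blast
      subgoal by (rule linear_reversors(5)) blast
      subgoal by (rule linear_odd_reversors(1)) (blast, assumption)
      subgoal by (rule linear_odd_reversors(2)) (blast, assumption)
      subgoal by (rule linear_odd_reversors(3)) (blast, assumption)
      subgoal by (rule linear_odd_reversors(4)) (blast, assumption)
      done
    done
qed

end
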